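(* Let $N\ge3$ and let $q\in\mathbb C^\times$ be generic. Let the quantum affine algebra $U_q(\widehat{\mathfrak{gl}}_N)$, with the operator $q^D$ added, act on $V_Q$ at level one through the algebra $\mathcal B$ (see the context). Then $V_Q$ is an irreducible $U_q(\widehat{\mathfrak{gl}}_N)$-module with the weight space decomposition $$V_Q=\bigoplus_{\mu\in\mathcal P}V_\mu,\qquad \mathcal P=\{\omega_0+\alpha+n\tau:\alpha\in Q,\ n\in\mathbb Z_{\le0}\}.$$ Moreover, $V_Q$ is completely reducible as a $U_q(\widehat{\mathfrak{sl}}_N)$-module.
   Context: Generic $q$: nonzero and not a root of unity; fix $q^{1/2}$ and a logarithm of $q$, used to define $q^s$, $s\in\mathbb C$. $[m]=\frac{q^m-q^{-m}}{q-q^{-1}}$, $[mc]=\frac{q^{mc}-q^{-mc}}{q-q^{-1}}$. **$U_q(\widehat{\mathfrak{gl}}_N)$**: unital associative algebra generated by $\epsilon_{im}$, $k_{i0}^{\pm1}$ ($1\le i\le N$, $m\in\mathbb Z\setminus\{0\}$), $x^\pm_{jn}$ ($1\le j\le N-1$, $n\in\mathbb Z$) and $q^{c/2}$, subject to the relations that $q^{c/2}$ is central and ($(a_{ij})$ the Cartan matrix of type $A_{N-1}$) - $[\epsilon_{im},\epsilon_{jn}]=\frac{[m]}m[mc]\delta_{ij}\delta_{m,-n}$; - $[\epsilon_{im},x^\pm_{jn}]=0$ for $j\ne i,i-1$; $[\epsilon_{im},x^\pm_{in}]=\pm\frac{[m]}mq^{\mp|m|c/2+|m|/2}x^\pm_{i,m+n}$;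 $[\epsilon_{im},x^\pm_{i-1,n}]=\mp\frac{[m]}mq^{\mp|m|c/2-|m|/2}x^\pm_{i-1,m+n}$; - $x^\pm_{i,m+1}x^\pm_{jn}-q^{\pm a_{ij}}x^\pm_{jn}x^\pm_{i,m+1}=q^{\pm a_{ij}}x^\pm_{im}x^\pm_{j,n+1}-x^\pm_{j,n+1}x^\pm_{im}$; $[x^\pm_{im},x^\pm_{jn}]=0$ for $|i-j|>1$; - $[x^+_{im},x^-_{jn}]=\frac{\delta_{ij}}{q-q^{-1}}(k^+_{i,m+n}q^{(m-n)c/2}-k^-_{i,m+n}q^{(n-m)c/2})$, where $k_i^\pm(z)=\sum_{n\ge0}k^\pm_{i,\pm n}z^{\mp n}=k_{i0}^{\pm1}\exp(\pm(q-q^{-1})\sum_{n>0}(q^{n/2}\epsilon_{i,\pm n}-q^{-n/2}\epsilon_{i+1,\pm n})z^{\mp n})$ (the other $k^\pm_{i,n}$ are $0$); - $x^\pm_{im_1}x^\pm_{im_2}x^\pm_{jn}-(q+q^{-1})x^\pm_{im_1}x^\pm_{jn}x^\pm_{im_2}+x^\pm_{jn}x^\pm_{im_1}x^\pm_{im_2}+\{m_1\leftrightarrow m_2\}=0$ for $|i-j|=1$. Put $x_i^\pm(z)=\sum_n x^\pm_{in}z^{-n}$. $U_q(\widehat{\mathfrak{sl}}_N)\subset U_q(\widehat{\mathfrak{gl}}_N)$ is the subalgebra generated by $h_{im}=q^{|m|/2}\epsilon_{im}-q^{-|m|/2}\epsilon_{i+1,m}$, $q^{c/2}$, $k_{i0}^{\pm1}$,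 $x^\pm_{in}$ ($1\le i\le N-1$, $m\ne0$, $n\in\mathbb Z$). **Fock space.** Let $\bigoplus_{i=1}^N\mathbb Z\epsilon_i$ carry the form $(\epsilon_i,\epsilon_j)=\delta_{ij}$, $Q=\bigoplus_{i=1}^{N-1}\mathbb Z(\epsilon_i-\epsilon_{i+1})$. Let $\varepsilon:Q\times Q\to\{\pm1\}$ be bimultiplicative with $\varepsilon(\alpha,\alpha)=(-1)^{(\alpha,\alpha)/2}$. On $\mathbb C[Q]=\bigoplus_{\alpha\in Q}\mathbb Ce^\alpha$: $e_\beta e^\alpha=\varepsilon(\beta,\alpha)e^{\alpha+\beta}$ ($\beta\in Q$); for $\beta\in\bigoplus\mathbb C\epsilon_i$, $\beta(0)e^\alpha=(\beta,\alpha)e^\alpha$ (form extended bilinearly), $q^\beta e^\alpha=q^{(\beta,\alpha)}e^\alpha$, and for $\beta\in\bigoplus\mathbb Z\epsilon_i$, $z^\beta e^\alpha=z^{(\beta,\alpha)}e^\alpha$. The Heisenberg algebra with generators $\epsilon_i(n)$ ($1\le i\le N$, $n\ne0$), $[\epsilon_i(m),\epsilon_j(n)]=m\delta_{ij}\delta_{m+n,0}$, acts on $S(\mathcal H^-)=\mathbb C[\epsilon_i(-n):1\le i\le N,n\ge1]$ with $\epsilon_i(-n)$ acting by multiplication and $\epsilon_i(n)$ by $n\,\partial/\partial\epsilon_i(-n)$ ($n\geq 1$). $V_Q=S(\mathcal H^-)\otimes\mathbb C[Q]$. **Vertex operators and the action.** For $\alpha=\pm\epsilon_i$, $E_\pm(\alpha,z)=\exp\big(\mp\sum_{n\ge1}\frac{\alpha(\pm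 n)}nz^{\mp n}\big)$ with $(-\epsilon_i)(n)=-\epsilon_i(n)$. For $i\ne j$ in $\{1,\dots,N\}$, $X_{ij}(z)=E_-(\epsilon_i,z)E_-(-\epsilon_j,zq^{i-j})E_+(\epsilon_i,z)E_+(-\epsilon_j,zq^{j-i})\,e_{\epsilon_i-\epsilon_j}\,z^{\epsilon_i-\epsilon_j+1}$. For $1\le i\le N-1$ put $E_i(z)=X_{i,i+1}(z)$, $F_i(z)=X_{i+1,i}(z)$. $\mathcal B$ is the unital associative algebra of operators on $V_Q$ generated by the coefficients of $E_i(z),F_i(z)$ ($1\le i\le N-1$) and by $\epsilon_i(n)$, $q^{\pm\epsilon_i}$ ($1\le i\le N$, $n\ne0$). $U_q(\widehat{\mathfrak{gl}}_N)$ acts on $V_Q$ through $\mathcal B$, as a homomorphic image of it, with $x_i^+(z)\mapsto E_i(z)$, $x_i^-(z)\mapsto F_i(z)$, $k_{i0}\mapsto q^{\epsilon_i-\epsilon_{i+1}}$ ($1\le i\le N-1$), $\epsilon_{im}\mapsto\frac{[m]}m\epsilon_i(m)$ ($1\le i\le N$), and $c=1$ (i.e. $q^{c/2}\mapsto q^{1/2}$). The operator $q^D$ (below) is added to both $U_q(\widehat{\mathfrak{gl}}_N)$ and $\mathcal B$. **Weights.** $\mathfrak h=H\oplus\mathbb CC\oplus\mathbb CD$ with $H=Q\otimes_{\mathbb Z}\mathbb C$, the Cartan subalgebra of the affine Lie algebra $\mathfrak{gl}_N(\mathbb C[t,t^{-1}])\oplus\mathbb CC\oplus\mathbb CD$.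 It acts on $V_Q$ by $h\mapsto h(0)$ for $h\in H$, $C\mapsto1$, $D\mapsto-\frac12\sum_{i=1}^N\epsilon_i(0)^2-\sum_{i=1}^N\sum_{n\ge1}\epsilon_i(-n)\epsilon_i(n)$. For $\mu\in\mathfrak h^*$, $V_\mu=\{v\in V_Q: hv=\mu(h)v\ \forall h\in\mathfrak h\}$ is the weight space for the affine Lie algebra; the weight space for $U_q(\widehat{\mathfrak{gl}}_N)$ is $V^\mu=\{v\in V_Q: q^hv=q^{\mu(h)}v\ \forall h\in\mathfrak h\}$, and $V^\mu=V_\mu$. $\omega_0,\tau\in\mathfrak h^*$ are given by $\omega_0|_{H\oplus\mathbb CD}=0$, $\omega_0(C)=1$, $\tau|_{H\oplus\mathbb CC}=0$, $\tau(D)=1$; $\alpha\in Q$ is viewed in $\mathfrak h^*$ via $\alpha(h)=(\alpha,h)$ for $h\in H$, $\alpha(C)=\alpha(D)=0$. *)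

theory Defs
  imports Complex_Main "HOL-Library.Poly_Mapping"
begin

section \<open>The space \<open>V_Q\<close>\<close>

text \<open>
  A monomial in the variables \<open>\<epsilon>_i(-n)\<close> is its exponent function on the indices \<open>(i, n)\<close>; a lattice
  vector is its coefficient function.  The key \<open>(p, \<alpha>)\<close> stands for the basis vector
  \<open>\<epsilon>^p \<otimes> e^\<alpha>\<close>.  The type \<open>fock\<close> has indices from all of \<open>\<nat>\<close>; the space attached to \<open>N\<close> is the
  subset \<open>VQ N\<close> below.
\<close>

type_synonym monom = "(nat \<times> nat) \<Rightarrow>\<^sub>0 nat"
type_synonym lattice = "nat \<Rightarrow>\<^sub>0 int"
type_synonym basis = "monom \<times> lattice"
type_synonym fock = "basis \<Rightarrow>\<^sub>0 complex"
type_synonym operator = "fock \<Rightarrow> fock"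

abbreviation lk :: "('a \<Rightarrow>\<^sub>0 'b::zero) \<Rightarrow> 'a \<Rightarrow> 'b" where
  "lk \<equiv> Poly_Mapping.lookup"

definition scale :: "complex \<Rightarrow> fock \<Rightarrow> fock" where
  "scale c v = Poly_Mapping.map ((*) c) v"

lemma lookup_scale: "lk (scale c v) b = c * lk v b"
  unfolding scale_def by transfer (simp add: when_def)

lemma vector_space_scale: "vector_space scale"
  by unfold_locales (auto intro!: poly_mapping_eqI simp: lookup_scale lookup_add algebra_simps)

definition bvec :: "monom \<Rightarrow> lattice \<Rightarrow> fock" where
  "bvec p \<alpha> = Poly_Mapping.single (p, \<alpha>) 1"

definition lin_ext :: "(monom \<Rightarrow> lattice \<Rightarrow> fock) \<Rightarrow> operator" where
  "lin_ext f v = (\<Sum>(p, \<alpha>) \<in> Poly_Mapping.keys v. scale (lk v (p, \<alpha>)) (f p \<alpha>))"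

definition eps :: "nat \<Rightarrow> lattice" where
  "eps i = Poly_Mapping.single i 1"

definition form :: "nat \<Rightarrow> lattice \<Rightarrow> lattice \<Rightarrow> int" where
  "form N \<alpha> \<beta> = (\<Sum>i=1..N. lk \<alpha> i * lk \<beta> i)"

definition Qlat :: "nat \<Rightarrow> lattice set" where
  "Qlat N = {\<Sum>i=1..<N. Poly_Mapping.single i (c i) - Poly_Mapping.single (Suc i) (c i) | c. True}"

definition VQ :: "nat \<Rightarrow> fock set" where
  "VQ N = {v. \<forall>(p, \<alpha>) \<in> Poly_Mapping.keys v.
     Poly_Mapping.keys p \<subseteq> {1..N} \<times> {1..} \<and> \<alpha> \<in> Qlat N}"

text \<open>The values of the cocycle outside \<open>Q\<close> are irrelevant.\<close>

definition cocycle :: "nat \<Rightarrow> (lattice \<Rightarrow> lattice \<Rightarrow> complex) \<Rightarrow> bool" where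
  "cocycle N \<epsilon> \<longleftrightarrow>
     (\<forall>\<alpha>\<in>Qlat N. \<forall>\<beta>\<in>Qlat N. \<epsilon> \<alpha> \<beta> \<in> {1, - 1}) \<and>
     (\<forall>\<alpha>\<in>Qlat N. \<forall>\<beta>\<in>Qlat N. \<forall>\<gamma>\<in>Qlat N.
        \<epsilon> (\<alpha> + \<beta>) \<gamma> = \<epsilon> \<alpha> \<gamma> * \<epsilon> \<beta> \<gamma> \<and> \<epsilon> \<alpha> (\<beta> + \<gamma>) = \<epsilon> \<alpha> \<beta> * \<epsilon> \<alpha> \<gamma>) \<and>
     (\<forall>\<alpha>\<in>Qlat N. \<epsilon> \<alpha> \<alpha> = (- 1) powi (form N \<alpha> \<alpha> div 2))"

definition generic :: "complex \<Rightarrow> bool" where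
  "generic q \<longleftrightarrow> q \<noteq> 0 \<and> (\<forall>n>0. q ^ n \<noteq> 1)"

definition qint :: "complex \<Rightarrow> int \<Rightarrow> complex" where
  "qint q m = (q powi m - q powi (- m)) / (q - inverse q)"


section \<open>Operators on \<open>V_Q\<close>\<close>

text \<open>\<open>heis i n\<close> is \<open>\<epsilon>_i(n)\<close> for \<open>n \<noteq> 0\<close>.\<close>

definition heis :: "nat \<Rightarrow> int \<Rightarrow> operator" where
  "heis i n = lin_ext (\<lambda>p \<alpha>.
     if n < 0 then bvec (p + Poly_Mapping.single (i, nat (- n)) 1) \<alpha>
     else scale (of_int n * of_nat (lk p (i, nat n)))
            (bvec (p - Poly_Mapping.single (i, nat n) 1) \<alpha>))"

text \<open>\<open>\<beta>(0)\<close> for \<open>\<beta> = \<Sum>_i \<beta>_i \<epsilon>_i\<close> with complex coefficients.\<close>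

definition zmode :: "nat \<Rightarrow> (nat \<Rightarrow> complex) \<Rightarrow> operator" where
  "zmode N \<beta> = lin_ext (\<lambda>p \<alpha>. scale (\<Sum>i=1..N. \<beta> i * of_int (lk \<alpha> i)) (bvec p \<alpha>))"

abbreviation unitv :: "nat \<Rightarrow> nat \<Rightarrow> complex" where
  "unitv i \<equiv> (\<lambda>k. if k = i then 1 else 0)"

text \<open>The sum over \<open>n\<close> is finite on every vector.\<close>

definition Dop :: "nat \<Rightarrow> operator" where
  "Dop N v = scale (- 1 / 2) (\<Sum>i=1..N. zmode N (unitv i) (zmode N (unitv i) v))
     - (\<Sum>i=1..N. Sum_any (\<lambda>n. if 1 \<le> n then heis i (- int n) (heis i (int n) v) else 0))"

text \<open>
  \<open>q^T\<close> for an operator \<open>T\<close> which is diagonal in the basis \<open>bvec p \<alpha>\<close>; \<open>L\<close> is the chosen logarithm of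
  \<open>q\<close>, and the argument of \<open>exp\<close> is \<open>L\<close> times the eigenvalue of \<open>T\<close>.
\<close>

definition qpow :: "complex \<Rightarrow> operator \<Rightarrow> operator" where
  "qpow L T = lin_ext (\<lambda>p \<alpha>. scale (exp (L * lk (T (bvec p \<alpha>)) (p, \<alpha>))) (bvec p \<alpha>))"


section \<open>Vertex operators\<close>

text \<open>
  A sequence \<open>A\<close> of operators is the formal series \<open>\<Sum>_n A n z^n\<close>, or \<open>\<Sum>_n A n z^(-n)\<close> for the series
  in \<open>z^(-1)\<close>.  \<open>ser_exp A\<close> is the exponential of \<open>\<Sum>_{n \<ge> 1} A n z^n\<close>; \<open>A 0\<close> is ignored, hence only
  the powers up to \<open>k\<close> contribute to the coefficient of \<open>z^k\<close>.
\<close>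

definition ser_mult :: "(nat \<Rightarrow> operator) \<Rightarrow> (nat \<Rightarrow> operator) \<Rightarrow> nat \<Rightarrow> operator" where
  "ser_mult A B k v = (\<Sum>j\<le>k. A j (B (k - j) v))"

primrec ser_pow :: "(nat \<Rightarrow> operator) \<Rightarrow> nat \<Rightarrow> nat \<Rightarrow> operator" where
  "ser_pow A 0 = (\<lambda>k v. if k = 0 then v else 0)"
| "ser_pow A (Suc s) = ser_mult A (ser_pow A s)"

definition ser_exp :: "(nat \<Rightarrow> operator) \<Rightarrow> nat \<Rightarrow> operator" where
  "ser_exp A k v =
     (\<Sum>s\<le>k. scale (1 / fact s) (ser_pow (\<lambda>n v. if n = 0 then 0 else A n v) s k v))"

text \<open>
  \<open>Eminus i s c k\<close> is the coefficient of \<open>z^k\<close> in \<open>E_-(s \<epsilon>_i, c z)\<close>, and \<open>Eplus i s c k\<close> the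
  coefficient of \<open>z^(-k)\<close> in \<open>E_+(s \<epsilon>_i, c z)\<close>, for \<open>s = \<plusminus>1\<close>.
\<close>

definition Eminus :: "nat \<Rightarrow> complex \<Rightarrow> complex \<Rightarrow> nat \<Rightarrow> operator" where
  "Eminus i s c = ser_exp (\<lambda>n v. scale (s * c ^ n / of_nat n) (heis i (- int n) v))"

definition Eplus :: "nat \<Rightarrow> complex \<Rightarrow> complex \<Rightarrow> nat \<Rightarrow> operator" where
  "Eplus i s c = ser_exp (\<lambda>n v. scale (- s / (of_nat n * c ^ n)) (heis i (int n) v))"

text \<open>
  \<open>Xop q \<epsilon> i j n\<close> is the coefficient of \<open>z^(-n)\<close> in \<open>X_ij(z)\<close>.  On \<open>\<epsilon>^p \<otimes> e^\<alpha>\<close> the factor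
  \<open>z^(\<epsilon>_i - \<epsilon>_j + 1)\<close> contributes \<open>\<alpha>_i - \<alpha>_j + 1\<close> to the exponent of \<open>z\<close>, so the coefficient collects the
  terms of degree \<open>-k\<close> in the \<open>E_+\<close> part and \<open>k - M\<close> in the \<open>E_-\<close> part, \<open>M = n + \<alpha>_i - \<alpha>_j + 1\<close>.  The
  sum over \<open>k\<close> is finite since the \<open>E_+\<close> part annihilates the given monomial for large \<open>k\<close>.
\<close>

definition Xop ::
  "complex \<Rightarrow> (lattice \<Rightarrow> lattice \<Rightarrow> complex) \<Rightarrow> nat \<Rightarrow> nat \<Rightarrow> int \<Rightarrow> operator" where
  "Xop q \<epsilon> i j n = lin_ext (\<lambda>p \<alpha>.
     let d = int i - int j; \<beta> = eps i - eps j; M = n + lk \<alpha> i - lk \<alpha> j + 1 in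
     scale (\<epsilon> \<beta> \<alpha>)
       (Sum_any (\<lambda>k::nat. if M \<le> int k
          then ser_mult (Eminus i 1 1) (Eminus j (- 1) (q powi d)) (nat (int k - M))
                 (ser_mult (Eplus i 1 1) (Eplus j (- 1) (q powi (- d))) k (bvec p (\<alpha> + \<beta>)))
          else 0)))"


section \<open>The quantum affine algebra and its level one action\<close>

text \<open>
  \<open>XP j n\<close>, \<open>XM j n\<close> are \<open>x^+_{jn}\<close>, \<open>x^-_{jn}\<close>; \<open>QC\<close>, \<open>QCinv\<close> are \<open>q^(\<plusminus>c/2)\<close>; \<open>QD\<close> is the added
  operator \<open>q^D\<close>.
\<close>

datatype gen =
    Eps nat int | K nat | Kinv nat | XP nat int | XM nat int | QC | QCinv | QD

definition uq_gens :: "nat \<Rightarrow> gen set" where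
  "uq_gens N = {Eps i m | i m. i \<in> {1..N} \<and> m \<noteq> 0} \<union> K ` {1..N} \<union> Kinv ` {1..N}
     \<union> {XP j n | j n. j \<in> {1..<N}} \<union> {XM j n | j n. j \<in> {1..<N}} \<union> {QC, QCinv}"

abbreviation xg :: "(gen \<Rightarrow> operator) \<Rightarrow> int \<Rightarrow> nat \<Rightarrow> int \<Rightarrow> operator" where
  "xg \<rho> s i n \<equiv> \<rho> (if s = 1 then XP i n else XM i n)"

text \<open>\<open>q^(m c/2)\<close>\<close>

definition qc :: "(gen \<Rightarrow> operator) \<Rightarrow> int \<Rightarrow> operator" where
  "qc \<rho> m = (if 0 \<le> m then \<rho> QC ^^ nat m else \<rho> QCinv ^^ nat (- m))"

definition comm :: "operator \<Rightarrow> operator \<Rightarrow> operator" where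
  "comm S T v = S (T v) - T (S v)"

definition cartan :: "nat \<Rightarrow> nat \<Rightarrow> int" where
  "cartan i j = (if i = j then 2 else if i = Suc j \<or> j = Suc i then - 1 else 0)"

text \<open>\<open>kg q r \<rho> s i n\<close> is \<open>k^\<plusminus>_{i,n}\<close> for \<open>s = \<plusminus>1\<close>; here \<open>r = q^(1/2)\<close>.\<close>

definition kg :: "complex \<Rightarrow> complex \<Rightarrow> (gen \<Rightarrow> operator) \<Rightarrow> int \<Rightarrow> nat \<Rightarrow> int \<Rightarrow> operator" where
  "kg q r \<rho> s i n = (if s * n < 0 then (\<lambda>v. 0) else
     \<rho> (if s = 1 then K i else Kinv i) \<circ>
     ser_exp (\<lambda>m v. scale (of_int s * (q - inverse q))
        (scale (r ^ m) (\<rho> (Eps i (s * int m)) v)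
         - scale (inverse r ^ m) (\<rho> (Eps (Suc i) (s * int m)) v))) (nat \<bar>n\<bar>))"

definition lin_end_on :: "fock set \<Rightarrow> operator \<Rightarrow> bool" where
  "lin_end_on V T \<longleftrightarrow> T ` V \<subseteq> V \<and> (\<forall>u\<in>V. \<forall>v\<in>V. T (u + v) = T u + T v)
     \<and> (\<forall>c. \<forall>v\<in>V. T (scale c v) = scale c (T v))"

text \<open>
  \<open>\<rho>\<close> makes \<open>V\<close> into a module over \<open>U_q(gl^_N)\<close>, that is, it sends the generators to endomorphisms of
  \<open>V\<close> satisfying the defining relations.
\<close>

definition uq_module ::
  "nat \<Rightarrow> complex \<Rightarrow> complex \<Rightarrow> fock set \<Rightarrow> (gen \<Rightarrow> operator) \<Rightarrow> bool" where
  "uq_module N q r V \<rho> \<longleftrightarrow>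
    (\<forall>g\<in>uq_gens N. lin_end_on V (\<rho> g)) \<and>
    (\<forall>v\<in>V.
      \<comment> \<open>inverses, central element\<close>
      (\<forall>i\<in>{1..N}. \<rho> (K i) (\<rho> (Kinv i) v) = v \<and> \<rho> (Kinv i) (\<rho> (K i) v) = v) \<and>
      \<rho> QC (\<rho> QCinv v) = v \<and> \<rho> QCinv (\<rho> QC v) = v \<and>
      (\<forall>g\<in>uq_gens N. comm (\<rho> QC) (\<rho> g) v = 0) \<and>
      \<comment> \<open>\<open>\<epsilon>\<close> with \<open>\<epsilon>\<close>\<close>
      (\<forall>i\<in>{1..N}. \<forall>j\<in>{1..N}. \<forall>m n. m \<noteq> 0 \<longrightarrow> n \<noteq> 0 \<longrightarrow>
         comm (\<rho> (Eps i m)) (\<rho> (Eps j n)) v =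
           (if i = j \<and> m = - n
            then scale (qint q m / of_int m / (q - inverse q))
                   (qc \<rho> (2 * m) v - qc \<rho> (- 2 * m) v)
            else 0)) \<and>
      \<comment> \<open>\<open>\<epsilon>\<close> with \<open>x\<close>\<close>
      (\<forall>s\<in>{1, - 1}. \<forall>i\<in>{1..N}. \<forall>j\<in>{1..<N}. \<forall>m n. m \<noteq> 0 \<longrightarrow>
         comm (\<rho> (Eps i m)) (xg \<rho> s j n) v =
           (if j = i
            then scale (of_int s * (qint q m / of_int m) * r powi \<bar>m\<bar>)
                   (qc \<rho> (- s * \<bar>m\<bar>) (xg \<rho> s j (m + n) v))
            else if Suc j = i
            then scale (- of_int s * (qint q m / of_int m) * r powi (- \<bar>m\<bar>))
                   (qc \<rho> (- s * \<bar>m\<bar>) (xg \<rho> s j (m + n) v))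
            else 0)) \<and>
      \<comment> \<open>\<open>x\<^sup>\<plusminus>\<close> with \<open>x\<^sup>\<plusminus>\<close>\<close>
      (\<forall>s\<in>{1, - 1}. \<forall>i\<in>{1..<N}. \<forall>j\<in>{1..<N}. \<forall>m n.
         xg \<rho> s i (m + 1) (xg \<rho> s j n v)
           - scale (q powi (s * cartan i j)) (xg \<rho> s j n (xg \<rho> s i (m + 1) v))
         = scale (q powi (s * cartan i j)) (xg \<rho> s i m (xg \<rho> s j (n + 1) v))
           - xg \<rho> s j (n + 1) (xg \<rho> s i m v)) \<and>
      (\<forall>s\<in>{1, - 1}. \<forall>i\<in>{1..<N}. \<forall>j\<in>{1..<N}. \<forall>m n. \<bar>int i - int j\<bar> > 1 \<longrightarrow>
         comm (xg \<rho> s i m) (xg \<rho> s j n) v = 0) \<and>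
      \<comment> \<open>\<open>x\<^sup>+\<close> with \<open>x\<^sup>-\<close>\<close>
      (\<forall>i\<in>{1..<N}. \<forall>j\<in>{1..<N}. \<forall>m n.
         comm (\<rho> (XP i m)) (\<rho> (XM j n)) v =
           (if i = j
            then scale (1 / (q - inverse q))
                   (kg q r \<rho> 1 i (m + n) (qc \<rho> (m - n) v)
                    - kg q r \<rho> (- 1) i (m + n) (qc \<rho> (n - m) v))
            else 0)) \<and>
      \<comment> \<open>Serre relations\<close>
      (\<forall>s\<in>{1, - 1}. \<forall>i\<in>{1..<N}. \<forall>j\<in>{1..<N}. \<forall>m1 m2 n. \<bar>int i - int j\<bar> = 1 \<longrightarrow>
         (\<Sum>(a, b) \<leftarrow> [(m1, m2), (m2, m1)].
            xg \<rho> s i a (xg \<rho> s i b (xg \<rho> s j n v))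
            - scale (q + inverse q) (xg \<rho> s i a (xg \<rho> s j n (xg \<rho> s i b v)))
            + xg \<rho> s j n (xg \<rho> s i a (xg \<rho> s i b v))) = 0))"

text \<open>
  The prescribed images of the generators.  No image is prescribed for \<open>k_{N0}\<close>, which occurs in no
  relation (except the one with its inverse), so \<open>acting_gens\<close> omits it.
\<close>

primrec act ::
  "nat \<Rightarrow> complex \<Rightarrow> complex \<Rightarrow> complex \<Rightarrow> (lattice \<Rightarrow> lattice \<Rightarrow> complex) \<Rightarrow> gen \<Rightarrow> operator" where
  "act N q r L \<epsilon> (Eps i m) = (\<lambda>v. scale (qint q m / of_int m) (heis i m v))"
| "act N q r L \<epsilon> (K i) = qpow L (zmode N (\<lambda>k. unitv i k - unitv (Suc i) k))"
| "act N q r L \<epsilon> (Kinv i) = qpow L (zmode N (\<lambda>k. unitv (Suc i) k - unitv i k))"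
| "act N q r L \<epsilon> (XP j n) = Xop q \<epsilon> j (Suc j) n"
| "act N q r L \<epsilon> (XM j n) = Xop q \<epsilon> (Suc j) j n"
| "act N q r L \<epsilon> QC = scale r"
| "act N q r L \<epsilon> QCinv = scale (inverse r)"
| "act N q r L \<epsilon> QD = qpow L (Dop N)"

definition acting_gens :: "nat \<Rightarrow> gen set" where
  "acting_gens N = insert QD (uq_gens N - {K N, Kinv N})"

inductive_set generated :: "operator set \<Rightarrow> operator set" for S :: "operator set" where
  gen: "f \<in> S \<Longrightarrow> f \<in> generated S"
| one: "id \<in> generated S"
| add: "f \<in> generated S \<Longrightarrow> g \<in> generated S \<Longrightarrow> (\<lambda>v. f v + g v) \<in> generated S"
| smult: "f \<in> generated S \<Longrightarrow> (\<lambda>v. scale c (f v)) \<in> generated S"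
| mult: "f \<in> generated S \<Longrightarrow> g \<in> generated S \<Longrightarrow> f \<circ> g \<in> generated S"

text \<open>The algebra \<open>\<B>\<close>, with \<open>q^D\<close> added.\<close>

definition Balg ::
  "nat \<Rightarrow> complex \<Rightarrow> complex \<Rightarrow> (lattice \<Rightarrow> lattice \<Rightarrow> complex) \<Rightarrow> operator set" where
  "Balg N q L \<epsilon> = generated
     ({Xop q \<epsilon> i (Suc i) n | i n. i \<in> {1..<N}} \<union> {Xop q \<epsilon> (Suc i) i n | i n. i \<in> {1..<N}}
      \<union> {heis i n | i n. i \<in> {1..N} \<and> n \<noteq> 0}
      \<union> {qpow L (zmode N (\<lambda>k. s * unitv i k)) | i s. i \<in> {1..N} \<and> s \<in> {1, - 1}}
      \<union> {qpow L (Dop N)})"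

text \<open>
  \<open>\<rho>\<close> acts through \<open>\<B>\<close> by the prescribed operators, with \<open>x^-_i(z)\<close> acting by \<open>\<sigma> F_i(z)\<close>,
  \<open>\<sigma> = \<plusminus>1\<close>.  The sign is needed because \<open>e_\<alpha> e_{-\<alpha>} = \<epsilon>(\<alpha>, -\<alpha>) = -1\<close> for a root \<open>\<alpha>\<close>: for the
  cocycle normalised by \<open>\<epsilon>(\<alpha>, \<alpha>) = (-1)^((\<alpha>, \<alpha>)/2)\<close> the bracket of \<open>E_i(z)\<close> and \<open>F_i(w)\<close> is the negative
  of the one required of \<open>x^+_i(z)\<close> and \<open>x^-_i(w)\<close>.
\<close>

definition acts_through_B ::
  "nat \<Rightarrow> complex \<Rightarrow> complex \<Rightarrow> complex \<Rightarrow> (lattice \<Rightarrow> lattice \<Rightarrow> complex) \<Rightarrow> complex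
    \<Rightarrow> (gen \<Rightarrow> operator) \<Rightarrow> bool" where
  "acts_through_B N q r L \<epsilon> \<sigma> \<rho> \<longleftrightarrow>
     (\<forall>g \<in> insert QD (uq_gens N). \<exists>f \<in> Balg N q L \<epsilon>. \<forall>v \<in> VQ N. \<rho> g v = f v) \<and>
     (\<forall>g \<in> acting_gens N. \<forall>v \<in> VQ N. \<rho> g v =
        (case g of XM j n \<Rightarrow> scale \<sigma> (act N q r L \<epsilon> g v) | _ \<Rightarrow> act N q r L \<epsilon> g v))"

definition h_op :: "complex \<Rightarrow> (gen \<Rightarrow> operator) \<Rightarrow> nat \<Rightarrow> int \<Rightarrow> operator" where
  "h_op r \<rho> i m v = scale (r powi \<bar>m\<bar>) (\<rho> (Eps i m) v)
     - scale (r powi (- \<bar>m\<bar>)) (\<rho> (Eps (Suc i) m) v)"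

text \<open>The image of \<open>U_q(sl^_N)\<close>.\<close>

definition sl_image :: "nat \<Rightarrow> complex \<Rightarrow> (gen \<Rightarrow> operator) \<Rightarrow> operator set" where
  "sl_image N r \<rho> = generated
     ({h_op r \<rho> i m | i m. i \<in> {1..<N} \<and> m \<noteq> 0} \<union> {\<rho> QC, \<rho> QCinv}
      \<union> \<rho> ` (K ` {1..<N} \<union> Kinv ` {1..<N})
      \<union> {\<rho> (XP i n) | i n. i \<in> {1..<N}} \<union> {\<rho> (XM i n) | i n. i \<in> {1..<N}})"


section \<open>Submodules, direct sums, weights\<close>

definition submodule :: "operator set \<Rightarrow> fock set \<Rightarrow> bool" where
  "submodule A W \<longleftrightarrow> module.subspace scale W \<and> (\<forall>f\<in>A. f ` W \<subseteq> W)"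

definition irreducible_under :: "operator set \<Rightarrow> fock set \<Rightarrow> bool" where
  "irreducible_under A V \<longleftrightarrow> submodule A V \<and> V \<noteq> {0}
     \<and> (\<forall>W. submodule A W \<and> W \<subseteq> V \<longrightarrow> W = {0} \<or> W = V)"

definition direct_sum :: "fock set \<Rightarrow> 'i set \<Rightarrow> ('i \<Rightarrow> fock set) \<Rightarrow> bool" where
  "direct_sum V I W \<longleftrightarrow> (\<forall>i\<in>I. module.subspace scale (W i) \<and> W i \<subseteq> V) \<and>
     (\<forall>v\<in>V. \<exists>!f. (\<forall>i\<in>I. f i \<in> W i) \<and> (\<forall>i. i \<notin> I \<longrightarrow> f i = 0) \<and> finite {i. f i \<noteq> 0}
        \<and> v = (\<Sum>i | f i \<noteq> 0. f i))"

definition completely_reducible_under :: "operator set \<Rightarrow> fock set \<Rightarrow> bool" where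
  "completely_reducible_under A V \<longleftrightarrow>
     (\<exists>\<S>. (\<forall>W\<in>\<S>. irreducible_under A W) \<and> direct_sum V \<S> (\<lambda>W. W))"

text \<open>
  The triple \<open>(h, c, d)\<close> is the element \<open>h + c C + d D\<close> of the Cartan subalgebra.  Elements of its dual
  are given by functions on triples.
\<close>

type_synonym cart = "(nat \<Rightarrow> complex) \<times> complex \<times> complex"

definition cartan_alg :: "nat \<Rightarrow> cart set" where
  "cartan_alg N = {\<lambda>k. \<Sum>i=1..<N. a i * (unitv i k - unitv (Suc i) k) | a. True} \<times> UNIV"

definition cart_act :: "nat \<Rightarrow> cart \<Rightarrow> operator" where
  "cart_act N = (\<lambda>(h, c, d) v. zmode N h v + scale c v + scale d (Dop N v))"

definition wt_space :: "nat \<Rightarrow> (cart \<Rightarrow> complex) \<Rightarrow> fock set" where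
  "wt_space N \<mu> = {v \<in> VQ N. \<forall>x\<in>cartan_alg N. cart_act N x v = scale (\<mu> x) v}"

definition q_wt_space :: "nat \<Rightarrow> complex \<Rightarrow> (cart \<Rightarrow> complex) \<Rightarrow> fock set" where
  "q_wt_space N L \<mu> =
     {v \<in> VQ N. \<forall>x\<in>cartan_alg N. qpow L (cart_act N x) v = scale (exp (L * \<mu> x)) v}"

definition omega0 :: "cart \<Rightarrow> complex" where
  "omega0 = (\<lambda>(h, c, d). c)"

definition tau :: "cart \<Rightarrow> complex" where
  "tau = (\<lambda>(h, c, d). d)"

definition lat_wt :: "nat \<Rightarrow> lattice \<Rightarrow> cart \<Rightarrow> complex" where
  "lat_wt N \<alpha> = (\<lambda>(h, c, d). \<Sum>i=1..N. of_int (lk \<alpha> i) * h i)"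

definition wts :: "nat \<Rightarrow> (cart \<Rightarrow> complex) set" where
  "wts N = {\<lambda>x. omega0 x + lat_wt N \<alpha> x + of_int n * tau x | \<alpha> n. \<alpha> \<in> Qlat N \<and> n \<le> 0}"

end

theory Submission
  imports Defs "HOL-Library.Multiset"
begin

text \<open>
  For \<open>U_q(gl^_N)\<close>: a nonzero submodule contains a vector killed by all \<open>\<epsilon>_i(n)\<close>, \<open>n > 0\<close>, that is,
  a combination of the \<open>e^\<alpha>\<close>; since \<open>q\<close> is not a root of unity the \<open>k_{i0}\<close> separate these, the extreme
  coefficients of \<open>E_i(z)\<close> and \<open>F_i(z)\<close> move \<open>e^\<alpha>\<close> to \<open>\<plusminus>e^(\<alpha> \<plusminus> (\<epsilon>_i - \<epsilon>_{i+1}))\<close>, and the creation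
  operators produce everything else.

  For \<open>U_q(sl^_N)\<close>: the operators \<open>z_n = \<Sum>_i q^(i|n|) \<epsilon>_i(n)\<close> commute with \<open>U_q(sl^_N)\<close> and generate a
  Heisenberg algebra with nonzero central terms; together with the \<open>h_{in}\<close> they span all \<open>\<epsilon>_i(n)\<close>.  Hence
  \<open>V_Q\<close> is the direct sum of the spaces \<open>z^M \<Omega>\<close>, where \<open>z^M\<close> runs over the monomials in the \<open>z_{-n}\<close> and
  \<open>\<Omega>\<close> is the common kernel of the \<open>z_n\<close>, \<open>n > 0\<close>, and each of them is irreducible because a proper
  submodule would produce a proper submodule of \<open>V_Q\<close> for the full algebra.
\<close>

section \<open>Linear operators on the Fock space\<close>

text \<open>No inner product is used, q being an arbitrary generic complex number; eigenvalues do
  the separating. The coefficients q^(i|n|) of z_n serve two ends: they make z_n commute with the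
  h_{jm}, and they make it commute with X_ij(z), whose two exponential factors contribute q^(i|n|)
  and -q^(i|n|) thanks to the shift q^(i-j) of the second argument. The central term of z_n and
  z_{-n} is n times a geometric sum in q^(2|n|), which could vanish only at a root of unity. The
  number operators z_{-n} z_n tell the summands apart. A nonzero submodule of z^M \<Omega> has the
  form z^M U; the span of all z^M' U is stable under everything, hence equals V_Q, and its M-th
  component forces U = \<Omega>. Statements about modules are reduced to subspaces of V_Q stable
  under generators. A subspace does not notice signs, which disposes of \<sigma>, and only the
  values on V_Q matter.\<close>

interpretation fock: vector_space scale
  by (rule vector_space_scale)

definition linop :: "operator \<Rightarrow> bool" where
  "linop f \<longleftrightarrow> (\<forall>u v. f (u + v) = f u + f v) \<and> (\<forall>c v. f (scale c v) = scale c (f v))"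

lemma linopI:
  assumes "\<And>u v. f (u + v) = f u + f v" and "\<And>c v. f (scale c v) = scale c (f v)"
  shows "linop f"
  using assms by (simp add: linop_def)

lemma linop_add: "linop f \<Longrightarrow> f (u + v) = f u + f v"
  and linop_scale: "linop f \<Longrightarrow> f (scale c v) = scale c (f v)"
  by (simp_all add: linop_def)

lemma linop_0: "linop f \<Longrightarrow> f 0 = 0"
  using linop_scale[of f 0 0] by simp

lemma linop_diff: "linop f \<Longrightarrow> f (u - v) = f u - f v"
  using linop_add[of f "u - v" v] by simp

lemma linop_sum: "linop f \<Longrightarrow> f (\<Sum>x\<in>I. g x) = (\<Sum>x\<in>I. f (g x))"
  by (induction I rule: infinite_finite_induct) (auto simp: linop_0 linop_add)

lemma linop_id: "linop (\<lambda>v. v)" and linop_zero: "linop (\<lambda>v. 0)"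
  and linop_scaled: "linop f \<Longrightarrow> linop (\<lambda>v. scale c (f v))"
  and linop_plus: "linop f \<Longrightarrow> linop g \<Longrightarrow> linop (\<lambda>v. f v + g v)"
  and linop_minus: "linop f \<Longrightarrow> linop g \<Longrightarrow> linop (\<lambda>v. f v - g v)"
  and linop_comp: "linop f \<Longrightarrow> linop g \<Longrightarrow> linop (\<lambda>v. f (g v))"
  by (auto simp: linop_def fock.scale_right_distrib fock.scale_right_diff_distrib mult.commute)

lemma linop_sums: "(\<And>x. x \<in> I \<Longrightarrow> linop (g x)) \<Longrightarrow> linop (\<lambda>v. \<Sum>x\<in>I. g x v)"
  by (auto simp: linop_def sum.distrib fock.scale_sum_right)

lemma linop_Sum_any:
  assumes "\<And>k. linop (g k)" and "\<And>v. finite {k. g k v \<noteq> 0}"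
  shows "linop (\<lambda>v. Sum_any (\<lambda>k. g k v))"
proof (rule linopI)
  fix u v
  show "Sum_any (\<lambda>k. g k (u + v)) = Sum_any (\<lambda>k. g k u) + Sum_any (\<lambda>k. g k v)"
    using assms by (simp add: linop_add Sum_any.distrib)
next
  fix c v
  have "Sum_any (\<lambda>k. g k (scale c v)) = (\<Sum>k\<in>{k. g k v \<noteq> 0}. g k (scale c v))"
    using assms by (intro Sum_any.expand_superset) (auto simp: linop_scale)
  also have "\<dots> = scale c (Sum_any (\<lambda>k. g k v))"
    using assms by (simp add: linop_scale fock.scale_sum_right Sum_any.expand_set)
  finally show "Sum_any (\<lambda>k. g k (scale c v)) = scale c (Sum_any (\<lambda>k. g k v))" .
qed

lemma linop_apply_Sum_any:
  assumes "linop f" and "finite {k. g k \<noteq> 0}"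
  shows "f (Sum_any g) = Sum_any (\<lambda>k. f (g k))"
proof -
  have "Sum_any (\<lambda>k. f (g k)) = (\<Sum>k\<in>{k. g k \<noteq> 0}. f (g k))"
    using assms by (intro Sum_any.expand_superset) (auto simp: linop_0)
  then show ?thesis
    using assms by (simp add: Sum_any.expand_set linop_sum)
qed

lemma lin_ext_superset:
  assumes "finite S" and "Poly_Mapping.keys v \<subseteq> S"
  shows "lin_ext f v = (\<Sum>b\<in>S. scale (lk v b) (f (fst b) (snd b)))"
  unfolding lin_ext_def case_prod_beta prod.collapse using assms
  by (intro sum.mono_neutral_left) (auto simp: in_keys_iff)

lemma linop_lin_ext: "linop (lin_ext f)"
proof (rule linopI)
  fix u v :: fock
  let ?S = "Poly_Mapping.keys u \<union> Poly_Mapping.keys v"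
  have "Poly_Mapping.keys (u + v) \<subseteq> ?S"
    by (rule keys_add)
  then show "lin_ext f (u + v) = lin_ext f u + lin_ext f v"
    by (simp add: lin_ext_superset[of ?S] lookup_add fock.scale_left_distrib sum.distrib)
next
  fix c and v :: fock
  have "Poly_Mapping.keys (scale c v) \<subseteq> Poly_Mapping.keys v"
    by (auto simp: in_keys_iff lookup_scale)
  then show "lin_ext f (scale c v) = scale c (lin_ext f v)"
    by (simp add: lin_ext_superset[of "Poly_Mapping.keys v"] lookup_scale fock.scale_sum_right)
qed

lemma keys_bvec [simp]: "Poly_Mapping.keys (bvec p \<alpha>) = {(p, \<alpha>)}"
  by (simp add: bvec_def)

lemma lookup_bvec: "lk (bvec p \<alpha>) b = (if b = (p, \<alpha>) then 1 else 0)"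
  by (auto simp: bvec_def lookup_single)

lemma bvec_nonzero [simp]: "bvec p \<alpha> \<noteq> 0"
  by (metis keys_bvec keys_zero insert_not_empty)

lemma lin_ext_bvec [simp]: "lin_ext f (bvec p \<alpha>) = f p \<alpha>"
  by (simp add: lin_ext_def lookup_bvec)

lemma lin_ext_bvec_id: "lin_ext bvec v = v"
proof (rule poly_mapping_eqI)
  fix b
  have "lk (lin_ext bvec v) b = (\<Sum>x\<in>Poly_Mapping.keys v. lk v x * (if b = x then 1 else 0))"
    by (simp add: lin_ext_def case_prod_beta lookup_sum lookup_scale lookup_bvec)
  also have "\<dots> = lk v b"
    by (simp add: in_keys_iff if_distrib cong: if_cong)
  finally show "lk (lin_ext bvec v) b = lk v b" .
qed

lemma linop_expand:
  assumes "linop f"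
  shows "f v = lin_ext (\<lambda>p \<alpha>. f (bvec p \<alpha>)) v"
proof -
  have "f v = f (lin_ext bvec v)"
    by (simp add: lin_ext_bvec_id)
  also have "\<dots> = lin_ext (\<lambda>p \<alpha>. f (bvec p \<alpha>)) v"
    by (simp add: lin_ext_def case_prod_beta linop_sum[OF assms] linop_scale[OF assms])
  finally show ?thesis .
qed

text \<open>Both sides expand over the basis vectors occurring in \<open>v\<close>. Testing just
  those keys admits formulas that hold on \<open>VQ N\<close> or on one lattice component but not on
  the whole type.\<close>

lemma linop_eq_on_keys:
  assumes "linop f" and "linop g"
    and "\<And>p \<alpha>. (p, \<alpha>) \<in> Poly_Mapping.keys v \<Longrightarrow> f (bvec p \<alpha>) = g (bvec p \<alpha>)"
  shows "f v = g v"
  unfolding linop_expand[OF assms(1), of v] linop_expand[OF assms(2), of v] lin_ext_def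
  by (rule sum.cong) (auto simp: assms(3))

lemma linop_eqI:
  assumes "linop f" and "linop g" and "\<And>p \<alpha>. f (bvec p \<alpha>) = g (bvec p \<alpha>)"
  shows "f v = g v"
  using assms by (rule linop_eq_on_keys)

lemma linop_in_subspace:
  assumes "linop f" and "fock.subspace S"
    and "\<And>p \<alpha>. (p, \<alpha>) \<in> Poly_Mapping.keys v \<Longrightarrow> f (bvec p \<alpha>) \<in> S"
  shows "f v \<in> S"
  unfolding linop_expand[OF assms(1), of v] lin_ext_def
  by (intro fock.subspace_sum assms(2)) (auto intro!: fock.subspace_scale assms)

lemma Sum_any_in_subspace:
  assumes "fock.subspace S" and "\<And>k. g k \<in> S"
  shows "Sum_any g \<in> S"
  by (simp add: Sum_any.expand_set fock.subspace_sum assms)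

text \<open>\<open>VQ N\<close>, the degree filtration \<open>below\<close> and the lattice
  components \<open>supp_lat\<close> are all of this shape, so membership of an image under a linear
  map need only be tested on basis vectors.\<close>

definition supp_space :: "(basis \<Rightarrow> bool) \<Rightarrow> fock set" where
  "supp_space P = {v. \<forall>b\<in>Poly_Mapping.keys v. P b}"

lemma subspace_supp_space: "fock.subspace (supp_space P)"
  unfolding fock.subspace_def supp_space_def
  using keys_add by (fastforce simp: in_keys_iff lookup_scale)

lemma bvec_in_supp_space [simp]: "bvec p \<alpha> \<in> supp_space P \<longleftrightarrow> P (p, \<alpha>)"
  by (simp add: supp_space_def)

lemma linop_supp_space:
  assumes "linop f" and "fock.subspace S" and "\<And>p \<alpha>. P (p, \<alpha>) \<Longrightarrow> f (bvec p \<alpha>) \<in> S"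
    and "v \<in> supp_space P"
  shows "f v \<in> S"
  by (rule linop_in_subspace[OF assms(1,2)], rule assms(3)) (use assms(4) in \<open>auto simp: supp_space_def\<close>)

lemma lin_ext_diag_lookup: "lk (lin_ext (\<lambda>p \<alpha>. scale (e (p, \<alpha>)) (bvec p \<alpha>)) v) b = e b * lk v b"
proof -
  have "lk (lin_ext (\<lambda>p \<alpha>. scale (e (p, \<alpha>)) (bvec p \<alpha>)) v) b
      = (\<Sum>x\<in>Poly_Mapping.keys v. lk v x * (e x * (if b = x then 1 else 0)))"
    by (simp add: lin_ext_def case_prod_beta lookup_sum lookup_scale lookup_bvec mult.assoc)
  also have "\<dots> = e b * lk v b"
    by (simp add: in_keys_iff if_distrib cong: if_cong)
  finally show ?thesis .
qed


section \<open>Joint eigenvectors and direct sums\<close>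

text \<open>Induction on the number of components: \<open>T x\<close> minus the scalar
  \<open>e j x\<close> kills the j-th component and rescales the k-th by a nonzero number. With a
  stable \<open>W\<close> this extracts components of its vectors; with \<open>W = {0}\<close> it is
  linear independence.\<close>

lemma eigen_components:
  assumes "finite I" and "fock.subspace W"
    and T: "\<And>x. x \<in> X \<Longrightarrow> linop (T x)" "\<And>x w. x \<in> X \<Longrightarrow> w \<in> W \<Longrightarrow> T x w \<in> W"
    and eig: "\<And>i x. i \<in> I \<Longrightarrow> x \<in> X \<Longrightarrow> T x (u i) = scale (e i x) (u i)"
    and dist: "\<And>i j. i \<in> I \<Longrightarrow> j \<in> I \<Longrightarrow> i \<noteq> j \<Longrightarrow> \<exists>x\<in>X. e i x \<noteq> e j x"
    and "(\<Sum>i\<in>I. u i) \<in> W" and "i \<in> I"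
  shows "u i \<in> W"
  using assms(1) eig dist assms(7,8)
proof (induction I arbitrary: u i rule: finite_induct)
  case empty
  then show ?case by simp
next
  case (insert j I)
  have ind: "u k \<in> W" if "k \<in> I" for k
  proof -
    obtain x where x: "x \<in> X" "e k x \<noteq> e j x"
      using insert.prems(2)[of k j] insert.hyps(2) \<open>k \<in> I\<close> by blast
    \<comment> \<open>The j-th summand carries the factor 0, the k-th one an invertible
      factor.\<close>
    let ?u = "\<lambda>i. scale (e i x - e j x) (u i)"
    have "T x (\<Sum>i\<in>insert j I. u i) - scale (e j x) (\<Sum>i\<in>insert j I. u i) \<in> W"
      using x insert.prems(3) by (intro fock.subspace_diff fock.subspace_scale assms(2) T(2))
    moreover have "T x (\<Sum>i\<in>insert j I. u i) = (\<Sum>i\<in>insert j I. scale (e i x) (u i))"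
      unfolding linop_sum[OF T(1)[OF x(1)]] using x insert.prems(1) by (intro sum.cong) auto
    ultimately have "(\<Sum>i\<in>insert j I. ?u i) \<in> W"
      by (simp add: fock.scale_sum_right sum_subtractf fock.scale_left_diff_distrib)
    then have sumW: "(\<Sum>i\<in>I. ?u i) \<in> W"
      using insert.hyps by simp
    have Tu: "T y (?u i) = scale (e i y) (?u i)" if "i \<in> I" "y \<in> X" for i y
      using that insert.prems(1)[of i y] by (simp add: linop_scale[OF T(1)] mult.commute)
    have "?u k \<in> W"
      by (rule insert.IH[OF Tu _ sumW \<open>k \<in> I\<close>]) (use insert.prems(2) in blast)+
    then have "scale (inverse (e k x - e j x)) (?u k) \<in> W"
      by (rule fock.subspace_scale[OF assms(2)])
    moreover have "inverse (e k x - e j x) * (e k x - e j x) = 1"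
      using x by simp
    ultimately show ?thesis
      by (simp only: fock.scale_scale fock.scale_one)
  qed
  have "(\<Sum>i\<in>insert j I. u i) - (\<Sum>i\<in>I. u i) \<in> W"
    by (rule fock.subspace_diff[OF assms(2) insert.prems(3) fock.subspace_sum[OF assms(2) ind]])
  then have "u j \<in> W"
    using insert.hyps by simp
  then show ?case
    using ind insert.prems(4) by auto
qed

lemma span_UN_subspaces:
  assumes "v \<in> fock.span (\<Union>i\<in>I. W i)" and W: "\<And>i. i \<in> I \<Longrightarrow> fock.subspace (W i)"
  obtains f where "\<And>i. i \<in> I \<Longrightarrow> f i \<in> W i" "\<And>i. i \<notin> I \<Longrightarrow> f i = 0"
    "finite {i. f i \<noteq> 0}" "v = (\<Sum>i | f i \<noteq> 0. f i)"
proof -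
  let ?P = "\<lambda>v f. (\<forall>i\<in>I. f i \<in> W i) \<and> (\<forall>i. i \<notin> I \<longrightarrow> f i = 0) \<and> finite {i. f i \<noteq> 0}
    \<and> v = (\<Sum>i | f i \<noteq> 0. f i)"
  have "\<exists>f. ?P v f"
    using assms(1)
  proof (induction rule: fock.span_induct_alt)
    case base
    show ?case
      using W fock.subspace_0 by (intro exI[of _ "\<lambda>_. 0"]) auto
  next
    case (step c x y)
    then obtain i f where i: "i \<in> I" "x \<in> W i" and f: "?P y f"
      by auto
    define g where "g = f(i := f i + scale c x)"
    have fin: "finite {j. f j \<noteq> 0}"
      using f by blast
    have sub: "{j. g j \<noteq> 0} \<subseteq> insert i {j. f j \<noteq> 0}"
      by (auto simp: g_def)
    have "(\<Sum>j | g j \<noteq> 0. g j) = (\<Sum>j\<in>insert i {j. f j \<noteq> 0}. g j)"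
      using fin sub by (intro sum.mono_neutral_left) auto
    also have "\<dots> = (\<Sum>j\<in>insert i {j. f j \<noteq> 0}. f j + (if j = i then scale c x else 0))"
      by (intro sum.cong) (auto simp: g_def)
    also have "\<dots> = (\<Sum>j\<in>insert i {j. f j \<noteq> 0}. f j) + scale c x"
      using fin by (simp add: sum.distrib)
    also have "(\<Sum>j\<in>insert i {j. f j \<noteq> 0}. f j) = y"
      using f fin by (subst conjunct2[OF conjunct2[OF conjunct2[OF f]]], intro sum.mono_neutral_right) auto
    finally have "scale c x + y = (\<Sum>j | g j \<noteq> 0. g j)"
      by (simp add: add.commute)
    moreover have "finite {j. g j \<noteq> 0}"
      using sub fin finite_subset by blast
    moreover have "\<forall>j\<in>I. g j \<in> W j" "\<forall>j. j \<notin> I \<longrightarrow> g j = 0"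
      using i f W by (auto simp: g_def intro!: fock.subspace_add fock.subspace_scale)
    ultimately show ?case
      by blast
  qed
  then show ?thesis
    using that by blast
qed

text \<open>Existence is the spanning hypothesis. For uniqueness, the difference of two
  decompositions is a vanishing sum of joint eigenvectors with pairwise different eigenvalue
  systems.\<close>

lemma direct_sum_eigen:
  assumes W: "\<And>i. i \<in> I \<Longrightarrow> fock.subspace (W i)" "\<And>i. i \<in> I \<Longrightarrow> W i \<subseteq> V"
    and span: "V \<subseteq> fock.span (\<Union>i\<in>I. W i)"
    and T: "\<And>x. x \<in> X \<Longrightarrow> linop (T x)"
    and eig: "\<And>i x w. i \<in> I \<Longrightarrow> x \<in> X \<Longrightarrow> w \<in> W i \<Longrightarrow> T x w = scale (e i x) w"
    and dist: "\<And>i j. i \<in> I \<Longrightarrow> j \<in> I \<Longrightarrow> i \<noteq> j \<Longrightarrow> \<exists>x\<in>X. e i x \<noteq> e j x"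
  shows "direct_sum V I W"
  unfolding direct_sum_def
proof (intro conjI ballI)
  fix v
  let ?P = "\<lambda>f. (\<forall>i\<in>I. f i \<in> W i) \<and> (\<forall>i. i \<notin> I \<longrightarrow> f i = 0) \<and> finite {i. f i \<noteq> 0}
    \<and> v = (\<Sum>i | f i \<noteq> 0. f i)"
  assume "v \<in> V"
  then have v: "v \<in> fock.span (\<Union>i\<in>I. W i)"
    using span by blast
  have "\<exists>f. ?P f"
    by (rule span_UN_subspaces[OF v W(1)]) blast+
  moreover have "f = g" if f: "?P f" and g: "?P g" for f g
  proof
    fix i
    let ?J = "{i. f i \<noteq> 0} \<union> {i. g i \<noteq> 0}"
    have fin: "finite ?J" and JI: "?J \<subseteq> I"
      using f g by auto
    have "v = sum f ?J"
      by (subst conjunct2[OF conjunct2[OF conjunct2[OF f]]], intro sum.mono_neutral_left fin) auto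
    moreover have "v = sum g ?J"
      by (subst conjunct2[OF conjunct2[OF conjunct2[OF g]]], intro sum.mono_neutral_left fin) auto
    ultimately have sum0: "(\<Sum>i\<in>?J. f i - g i) \<in> {0}"
      by (simp add: sum_subtractf)
    have "f j - g j \<in> {0}" if "j \<in> ?J" for j
    proof (rule eigen_components[where I = ?J and T = T and e = e and X = X
          and u = "\<lambda>j. f j - g j"])
      show "T x (f j - g j) = scale (e j x) (f j - g j)" if "j \<in> ?J" "x \<in> X" for j x
        using that JI f g eig[of j x "f j - g j"] W(1)[of j] fock.subspace_diff by blast
      show "\<exists>x\<in>X. e i x \<noteq> e j x" if "i \<in> ?J" "j \<in> ?J" "i \<noteq> j" for i j
        using that JI dist by blast
    qed (use fin sum0 T that in \<open>auto simp: linop_0 fock.subspace_single_0\<close>)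
    then show "f i = g i"
      by (cases "i \<in> ?J") auto
  qed
  ultimately show "\<exists>!f. ?P f"
    by blast
qed (use W in auto)

section \<open>Invariant subspaces of generated algebras\<close>

lemma submodule_generated: "submodule (generated S) W \<longleftrightarrow> submodule S W"
proof
  assume *: "submodule S W"
  then have W: "fock.subspace W"
    by (simp add: submodule_def)
  have "\<forall>w\<in>W. f w \<in> W" if "f \<in> generated S" for f
    using that
  proof induction
    case (gen f)
    then show ?case
      using * by (auto simp: submodule_def)
  qed (use W in \<open>auto simp: fock.subspace_add fock.subspace_scale\<close>)
  then show "submodule (generated S) W"
    using W by (auto simp: submodule_def)
qed (auto simp: submodule_def intro: generated.gen)

lemma irreducible_under_cong:
  assumes "\<And>W. W \<subseteq> V \<Longrightarrow> submodule A W \<longleftrightarrow> submodule B W"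
  shows "irreducible_under A V \<longleftrightarrow> irreducible_under B V"
  unfolding irreducible_under_def using assms by blast

text \<open>The summands of a decomposition lie in \<open>V\<close>, so only subspaces of
  \<open>V\<close> have to be compared. This matters for operators that are prescribed on
  \<open>VQ N\<close> alone.\<close>

lemma completely_reducible_under_cong:
  assumes "\<And>W. W \<subseteq> V \<Longrightarrow> submodule A W \<longleftrightarrow> submodule B W"
  shows "completely_reducible_under A V \<longleftrightarrow> completely_reducible_under B V"
proof -
  have "(\<forall>W\<in>\<S>. irreducible_under A W) \<longleftrightarrow> (\<forall>W\<in>\<S>. irreducible_under B W)"
    if "direct_sum V \<S> (\<lambda>W. W)" for \<S>
  proof (rule ball_cong)
    fix W assume "W \<in> \<S>"
    then have "W \<subseteq> V"
      using that by (simp add: direct_sum_def)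
    then show "irreducible_under A W \<longleftrightarrow> irreducible_under B W"
      using assms by (intro irreducible_under_cong) auto
  qed simp
  then show ?thesis
    unfolding completely_reducible_under_def by blast
qed

lemma linop_in_span:
  assumes "linop g" and "v \<in> fock.span S" and "\<And>s. s \<in> S \<Longrightarrow> g s \<in> fock.span S"
  shows "g v \<in> fock.span S"
  using assms(2)
proof (induction rule: fock.span_induct_alt)
  case base
  then show ?case
    by (simp add: linop_0[OF assms(1)] fock.span_zero)
next
  case (step c x y)
  then show ?case
    by (simp add: linop_add[OF assms(1)] linop_scale[OF assms(1)] assms(3) fock.span_add fock.span_scale)
qed


section \<open>Splitting off a commuting family of oscillators\<close>

text \<open>\<open>a\<close> and \<open>c\<close> are annihilation and creation operators commuting
  with \<open>A\<close>. The condition \<open>irr\<close> is irreducibility under all three families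
  together, while the goal concerns \<open>A\<close> alone. \<open>vacuum\<close> makes the joint
  kernel of the \<open>a n\<close> nonzero. Any nonzero central terms are allowed, so nothing has to
  be rescaled.\<close>

locale oscillators =
  fixes V :: "fock set" and A :: "operator set" and a c :: "nat \<Rightarrow> operator"
    and \<kappa> :: "nat \<Rightarrow> complex"
  assumes V: "fock.subspace V"
    and A: "f \<in> A \<Longrightarrow> linop f" "f \<in> A \<Longrightarrow> v \<in> V \<Longrightarrow> f v \<in> V"
    and a: "linop (a n)" "v \<in> V \<Longrightarrow> a n v \<in> V"
    and c: "linop (c n)" "v \<in> V \<Longrightarrow> c n v \<in> V"
    and A_a: "f \<in> A \<Longrightarrow> f (a n v) = a n (f v)"
    and A_c: "f \<in> A \<Longrightarrow> f (c n v) = c n (f v)"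
    and c_c: "c m (c n v) = c n (c m v)"
    and a_c: "a m (c n v) = c n (a m v) + (if m = n then scale (\<kappa> n) v else 0)"
    and \<kappa>: "\<kappa> n \<noteq> 0"
    and vacuum: "\<exists>v\<in>V. v \<noteq> 0 \<and> (\<forall>n. a n v = 0)"
    and irr: "fock.subspace W \<Longrightarrow> W \<subseteq> V \<Longrightarrow> W \<noteq> {0} \<Longrightarrow> (\<And>f w. f \<in> A \<Longrightarrow> w \<in> W \<Longrightarrow> f w \<in> W)
      \<Longrightarrow> (\<And>n w. w \<in> W \<Longrightarrow> a n w \<in> W) \<Longrightarrow> (\<And>n w. w \<in> W \<Longrightarrow> c n w \<in> W) \<Longrightarrow> W = V"
begin

text \<open>A monomial in the creation operators. These commute, so a multiset is the right index
  and the fold is well defined.\<close>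

definition cpow :: "nat multiset \<Rightarrow> operator" where
  "cpow M v = fold_mset c v M"

definition \<Omega> :: "fock set" where
  "\<Omega> = {v \<in> V. \<forall>n. a n v = 0}"

lemma cpow_empty: "cpow {#} v = v"
  by (simp add: cpow_def)

lemma cpow_add_mset: "cpow (add_mset n M) v = c n (cpow M v)"
proof -
  interpret comp_fun_commute c
    by unfold_locales (auto simp: fun_eq_iff c_c)
  show ?thesis
    by (simp add: cpow_def)
qed

lemma linop_cpow: "linop (cpow M)"
proof (induction M)
  case empty
  show ?case
    by (rule linopI) (simp_all add: cpow_empty)
next
  case (add n M)
  then show ?case
    by (simp add: linop_def cpow_add_mset linop_add[OF c(1)] linop_scale[OF c(1)])
qed

lemma cpow_V: "v \<in> V \<Longrightarrow> cpow M v \<in> V"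
  by (induction M) (simp_all add: cpow_empty cpow_add_mset c)

lemma A_cpow: "f \<in> A \<Longrightarrow> f (cpow M v) = cpow M (f v)"
  by (induction M) (simp_all add: cpow_empty cpow_add_mset A_c)

text \<open>\<open>a n\<close> acts on monomials as \<open>\<kappa> n\<close> times the derivative
  in the n-th variable: each passage across a factor \<open>c n\<close> leaves one central
  term.\<close>

lemma a_cpow:
  assumes "a n v = 0"
  shows "a n (cpow M v) = scale (\<kappa> n * of_nat (count M n)) (cpow (M - {#n#}) v)"
proof (induction M)
  case empty
  then show ?case
    by (simp add: cpow_empty assms)
next
  case (add x M)
  have *: "c x (cpow (M - {#n#}) v) = cpow (add_mset x (M - {#n#})) v"
    by (simp add: cpow_add_mset)
  show ?case
  proof (cases "x = n")
    case False
    then show ?thesis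
      by (simp add: cpow_add_mset a_c add.IH linop_scale[OF c(1)])
  next
    case True
    \<comment> \<open>Removing and restoring \<open>n\<close> gives back \<open>M\<close> only if
      \<open>n\<close> occurs in it; otherwise the factor \<open>count M n\<close> is 0.\<close>
    have "scale (\<kappa> n * of_nat (count M n)) (cpow (add_mset n (M - {#n#})) v)
        = scale (\<kappa> n * of_nat (count M n)) (cpow M v)"
      by (cases "n \<in># M") (simp_all add: not_in_iff)
    then show ?thesis
      using True *
      by (simp add: cpow_add_mset[of _ M] a_c add.IH linop_scale[OF c(1)] fock.scale_left_distrib
          distrib_left add.commute)
  qed
qed

lemma subspace_\<Omega>: "fock.subspace \<Omega>"
  using V unfolding fock.subspace_def \<Omega>_def
  by (auto simp: linop_0[OF a(1)] linop_add[OF a(1)] linop_scale[OF a(1)])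

lemma A_\<Omega>: "f \<in> A \<Longrightarrow> v \<in> \<Omega> \<Longrightarrow> f v \<in> \<Omega>"
  by (auto simp: \<Omega>_def A simp flip: A_a intro: linop_0)

text \<open>The span is stable under \<open>A\<close> by commutation, under \<open>c n\<close> by
  lengthening monomials and under \<open>a n\<close> by differentiating them, so \<open>irr\<close>
  applies. With \<open>U = \<Omega>\<close> it shows that the summands fill \<open>V\<close>; with
  \<open>U\<close> coming from a submodule it yields irreducibility.\<close>

lemma span_cpow:
  assumes "fock.subspace U" and "U \<subseteq> \<Omega>" and "U \<noteq> {0}"
    and "\<And>f u. f \<in> A \<Longrightarrow> u \<in> U \<Longrightarrow> f u \<in> U"
  shows "fock.span (\<Union>M. cpow M ` U) = V"
proof (rule irr)
  let ?S = "\<Union>M. cpow M ` U"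
  have U: "u \<in> V" "a n u = 0" if "u \<in> U" for u n
    using that assms(2) by (auto simp: \<Omega>_def)
  show "fock.subspace (fock.span ?S)"
    by (rule fock.subspace_span)
  show "fock.span ?S \<subseteq> V"
    using U V by (intro fock.span_minimal) (auto intro: cpow_V)
  obtain u where "u \<in> U" "u \<noteq> 0"
    using assms(1,3) fock.subspace_0 by blast
  moreover have "cpow {#} u \<in> ?S"
    using \<open>u \<in> U\<close> by blast
  ultimately show "fock.span ?S \<noteq> {0}"
    using fock.span_base[of u ?S] by (auto simp: cpow_empty)
  show "f w \<in> fock.span ?S" if "f \<in> A" "w \<in> fock.span ?S" for f w
  proof (rule linop_in_span[OF A(1)[OF that(1)] that(2)])
    fix s assume "s \<in> ?S"
    then obtain M u where s: "s = cpow M u" and "u \<in> U"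
      by blast
    then have "cpow M (f u) \<in> ?S"
      using assms(4) \<open>f \<in> A\<close> by blast
    then show "f s \<in> fock.span ?S"
      using \<open>f \<in> A\<close> by (simp add: s A_cpow fock.span_base)
  qed
  show "c n w \<in> fock.span ?S" if "w \<in> fock.span ?S" for n w
  proof (rule linop_in_span[OF c(1) that])
    fix s assume "s \<in> ?S"
    then obtain M u where s: "s = cpow M u" and "u \<in> U"
      by blast
    then have "cpow (add_mset n M) u \<in> ?S"
      by blast
    then show "c n s \<in> fock.span ?S"
      by (simp add: s cpow_add_mset fock.span_base)
  qed
  show "a n w \<in> fock.span ?S" if "w \<in> fock.span ?S" for n w
  proof (rule linop_in_span[OF a(1) that])
    fix s assume "s \<in> ?S"
    then obtain M u where s: "s = cpow M u" and "u \<in> U"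
      by blast
    then have "cpow (M - {#n#}) u \<in> ?S"
      by blast
    then show "a n s \<in> fock.span ?S"
      using \<open>u \<in> U\<close> by (simp add: s a_cpow U fock.span_scale fock.span_base)
  qed
qed

lemma subspace_cpow_image:
  assumes "fock.subspace U"
  shows "fock.subspace (cpow M ` U)"
proof (rule fock.subspaceI)
  show "0 \<in> cpow M ` U"
    using fock.subspace_0[OF assms] linop_0[OF linop_cpow] by (metis imageI)
  show "x + y \<in> cpow M ` U" if "x \<in> cpow M ` U" "y \<in> cpow M ` U" for x y
    using that assms by (auto simp: fock.subspace_add simp flip: linop_add[OF linop_cpow])
  show "scale k x \<in> cpow M ` U" if "x \<in> cpow M ` U" for k x
    using that assms by (auto simp: fock.subspace_scale simp flip: linop_scale[OF linop_cpow])
qed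

text \<open>Differentiating and multiplying back is, up to the factor \<open>\<kappa> n\<close>, the
  Euler operator counting the factors \<open>c n\<close>.\<close>

lemma number_operator:
  assumes "v \<in> cpow M ` \<Omega>"
  shows "c n (a n v) = scale (\<kappa> n * of_nat (count M n)) v"
proof -
  obtain w where w: "v = cpow M w" "a n w = 0"
    using assms by (auto simp: \<Omega>_def)
  have "c n (a n v) = scale (\<kappa> n * of_nat (count M n)) (cpow (add_mset n (M - {#n#})) w)"
    using w by (simp add: a_cpow linop_scale[OF c(1)] cpow_add_mset)
  then show ?thesis
    using w by (cases "n \<in># M") (simp_all add: not_in_iff)
qed

lemma number_operator_distinct:
  assumes "M \<noteq> M'"
  shows "\<exists>n. \<kappa> n * of_nat (count M n) \<noteq> \<kappa> n * of_nat (count M' n)"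
  using assms \<kappa> by (auto simp: multiset_eq_iff)

lemma cpow_component:
  assumes "v \<in> cpow M ` \<Omega>" and "\<And>M. fock.subspace (U M)" and "\<And>M. U M \<subseteq> cpow M ` \<Omega>"
    and "v \<in> fock.span (\<Union>M. U M)"
  shows "v \<in> U M"
proof -
  obtain f where f: "\<And>M. f M \<in> U M" "finite {M. f M \<noteq> 0}" "v = (\<Sum>M | f M \<noteq> 0. f M)"
    by (rule span_UN_subspaces[OF assms(4,2)]) auto
  let ?J = "insert M {M. f M \<noteq> 0}"
  \<comment> \<open>Subtracting \<open>v\<close> from the M-th component makes the total 0. The
    number operators then force \<open>u M = 0\<close>, which says that \<open>v\<close> is its own
    M-th component.\<close>
  define u where "u M' = f M' - (if M' = M then v else 0)" for M'
  have fin: "finite ?J"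
    using f by simp
  have "(\<Sum>M'\<in>?J. u M') = (\<Sum>M'\<in>?J. f M') - v"
    using fin by (simp add: u_def sum_subtractf)
  also have "(\<Sum>M'\<in>?J. f M') = v"
    using fin by (subst f(3), intro sum.mono_neutral_right) auto
  finally have sum0: "(\<Sum>M'\<in>?J. u M') \<in> {0}"
    by simp
  have u: "u M' \<in> cpow M' ` \<Omega>" for M'
  proof -
    have "f M' \<in> cpow M' ` \<Omega>"
      using f(1) assms(3) by blast
    then show ?thesis
      using assms(1) fock.subspace_diff[OF subspace_cpow_image[OF subspace_\<Omega>], of _ M']
      by (auto simp: u_def)
  qed
  have "u M \<in> {0}"
  proof (rule eigen_components[where T = "\<lambda>n v. c n (a n v)" and I = ?J and X = UNIV])
    show "c n (a n (u M')) = scale (\<kappa> n * of_nat (count M' n)) (u M')" for n M'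
      by (rule number_operator[OF u])
    show "linop (\<lambda>v. c n (a n v))" for n
      by (rule linop_comp[OF c(1) a(1)])
  qed (use fin sum0 number_operator_distinct in \<open>auto simp: linop_0[OF a(1)] linop_0[OF c(1)]\<close>)
  then show ?thesis
    using f(1)[of M] by (simp add: u_def)
qed

lemma irreducible_cpow_image:
  assumes "cpow M ` \<Omega> \<noteq> {0}"
  shows "irreducible_under A (cpow M ` \<Omega>)"
  unfolding irreducible_under_def
proof (intro conjI allI impI)
  show "submodule A (cpow M ` \<Omega>)"
    using subspace_cpow_image[OF subspace_\<Omega>] A_\<Omega> by (auto simp: submodule_def A_cpow)
next
  fix W assume W: "submodule A W \<and> W \<subseteq> cpow M ` \<Omega>"
  then have subW: "fock.subspace W" and AW: "\<And>f w. f \<in> A \<Longrightarrow> w \<in> W \<Longrightarrow> f w \<in> W"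
    by (auto simp: submodule_def)
  \<comment> \<open>\<open>W\<close> divided by the monomial: an \<open>A\<close>-stable subspace of
    \<open>\<Omega>\<close>, from which \<open>W\<close> is recovered because it lies in the image
    of \<open>cpow M\<close>.\<close>
  define U where "U = {v \<in> \<Omega>. cpow M v \<in> W}"
  have U: "fock.subspace U"
    using subspace_\<Omega> subW unfolding fock.subspace_def U_def
    by (auto simp: linop_0[OF linop_cpow] linop_add[OF linop_cpow] linop_scale[OF linop_cpow])
  have image_U: "cpow M ` U = W"
    using W by (auto simp: U_def)
  show "W = {0} \<or> W = cpow M ` \<Omega>"
  proof (cases "W = {0}")
    case False
    then have "U \<noteq> {0}"
      using image_U linop_0[OF linop_cpow, of M] by auto
    then have span: "fock.span (\<Union>M. cpow M ` U) = V"
      using AW A_\<Omega> by (intro span_cpow U) (auto simp: U_def simp flip: A_cpow)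
    have "v \<in> cpow M ` U" if "v \<in> cpow M ` \<Omega>" for v
    proof (rule cpow_component[OF that])
      show "v \<in> fock.span (\<Union>M. cpow M ` U)"
        using that by (auto simp: span \<Omega>_def intro: cpow_V)
    qed (rule subspace_cpow_image[OF U], auto simp: U_def)
    then show ?thesis
      using W image_U by auto
  qed simp
qed (fact assms)

theorem completely_reducible: "completely_reducible_under A V"
  unfolding completely_reducible_under_def
proof (intro exI conjI ballI)
  \<comment> \<open>Irreducible spaces have to be nonzero, so a possible zero image is simply
    discarded.\<close>
  let ?\<S> = "range (\<lambda>M. cpow M ` \<Omega>) - {{0}}"
  show "irreducible_under A W" if "W \<in> ?\<S>" for W
    using that irreducible_cpow_image by auto
  \<comment> \<open>The summands are indexed by themselves. Choosing a monomial for each one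
    recovers its eigenvalues, and different summands get different monomials.\<close>
  define m where "m W = (SOME M. W = cpow M ` \<Omega>)" for W
  have m: "W = cpow (m W) ` \<Omega>" if W: "W \<in> ?\<S>" for W
  proof -
    obtain M where "W = cpow M ` \<Omega>"
      using W by blast
    then show ?thesis
      unfolding m_def by (rule someI)
  qed
  show "direct_sum V ?\<S> (\<lambda>W. W)"
  proof (rule direct_sum_eigen[where X = UNIV and T = "\<lambda>n v. c n (a n v)"
        and e = "\<lambda>W n. \<kappa> n * of_nat (count (m W) n)"])
    show "fock.subspace W" if "W \<in> ?\<S>" for W
      using that subspace_cpow_image[OF subspace_\<Omega>] by auto
    show "W \<subseteq> V" if "W \<in> ?\<S>" for W
      using that by (auto simp: \<Omega>_def intro: cpow_V)
    show "linop (\<lambda>v. c n (a n v))" for n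
      by (rule linop_comp[OF c(1) a(1)])
    show "c n (a n w) = scale (\<kappa> n * of_nat (count (m W) n)) w" if "W \<in> ?\<S>" "w \<in> W" for W n w
      using number_operator m[OF that(1)] that(2) by blast
    show "\<exists>n\<in>UNIV. \<kappa> n * of_nat (count (m W) n) \<noteq> \<kappa> n * of_nat (count (m W') n)"
      if "W \<in> ?\<S>" "W' \<in> ?\<S>" "W \<noteq> W'" for W W'
    proof -
      have "m W \<noteq> m W'"
        using m[OF that(1)] m[OF that(2)] that(3) by metis
      then show ?thesis
        using number_operator_distinct by simp
    qed
    have "fock.span (\<Union>M. cpow M ` \<Omega>) = V"
    proof (rule span_cpow[OF subspace_\<Omega> order_refl])
      show "\<Omega> \<noteq> {0}"
        using vacuum by (auto simp: \<Omega>_def)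
    qed (rule A_\<Omega>)
    moreover have "(\<Union>M. cpow M ` \<Omega>) \<subseteq> insert 0 (\<Union>W\<in>?\<S>. W)"
      by auto
    ultimately show "V \<subseteq> fock.span (\<Union>W\<in>?\<S>. W)"
      by (metis fock.span_insert_0 fock.span_mono)
  qed
qed

end

section \<open>The Heisenberg action\<close>

definition deg :: "monom \<Rightarrow> nat" where
  "deg p = (\<Sum>x\<in>Poly_Mapping.keys p. snd x * lk p x)"

lemma deg_superset:
  assumes "finite S" and "Poly_Mapping.keys p \<subseteq> S"
  shows "deg p = (\<Sum>x\<in>S. snd x * lk p x)"
  unfolding deg_def using assms by (intro sum.mono_neutral_left) (auto simp: in_keys_iff)

lemma deg_add: "deg (p + p') = deg p + deg p'"
proof -
  let ?S = "Poly_Mapping.keys p \<union> Poly_Mapping.keys p'"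
  have "Poly_Mapping.keys (p + p') \<subseteq> ?S"
    by (rule keys_add)
  then show ?thesis
    by (simp add: deg_superset[of ?S] lookup_add distrib_left sum.distrib)
qed

lemma deg_single [simp]: "deg (Poly_Mapping.single x k) = snd x * k"
  by (cases "k = 0") (simp_all add: deg_def)

lemma deg_0 [simp]: "deg 0 = 0"
  by (simp add: deg_def)

lemma minus_add_single:
  fixes p :: monom
  assumes "lk p x \<noteq> 0"
  shows "p - Poly_Mapping.single x 1 + Poly_Mapping.single y 1
    = p + Poly_Mapping.single y 1 - Poly_Mapping.single x 1"
  using assms by (intro poly_mapping_eqI) (auto simp: lookup_add lookup_minus lookup_single when_def)

lemma minus_add_single_same:
  fixes p :: monom
  assumes "lk p x \<noteq> 0"
  shows "p - Poly_Mapping.single x 1 + Poly_Mapping.single x 1 = p"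
  using minus_add_single[OF assms, of x] by simp

lemma deg_minus_single:
  fixes p :: monom
  assumes "lk p x \<noteq> 0"
  shows "deg p = deg (p - Poly_Mapping.single x 1) + snd x"
  by (subst minus_add_single_same[OF assms, symmetric], subst deg_add) simp

lemma linop_heis: "linop (heis i n)"
  unfolding heis_def by (rule linop_lin_ext)

lemmas linop_heis_comp = linop_comp[OF linop_heis]

lemma heis_creation:
  "0 < n \<Longrightarrow> heis i (- int n) (bvec p \<alpha>) = bvec (p + Poly_Mapping.single (i, n) 1) \<alpha>"
  by (simp add: heis_def)

lemma heis_annihilation:
  "heis i (int n) (bvec p \<alpha>)
    = scale (of_nat n * of_nat (lk p (i, n))) (bvec (p - Poly_Mapping.single (i, n) 1) \<alpha>)"
  by (simp add: heis_def)

lemma heis_annihilation_creation: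
  assumes "0 < m" and "0 < n"
  shows "heis i (int m) (heis j (- int n) v) = heis j (- int n) (heis i (int m) v)
    + (if i = j \<and> m = n then scale (of_nat m) v else 0)"
proof (rule linop_eqI[where v = v and f = "\<lambda>v. heis i (int m) (heis j (- int n) v)"
      and g = "\<lambda>v. heis j (- int n) (heis i (int m) v)
        + (if i = j \<and> m = n then scale (of_nat m) v else 0)"])
  show "linop (\<lambda>v. heis j (- int n) (heis i (int m) v)
      + (if i = j \<and> m = n then scale (of_nat m) v else 0))"
    by (cases "i = j \<and> m = n")
      (auto intro!: linop_plus linop_heis_comp linop_scaled linop_id linop_zero)
  fix p \<alpha>
  let ?x = "(i, m)" and ?y = "(j, n)"
  \<comment> \<open>Subtraction of exponents is truncated; where this matters, the coefficient
    \<open>lk p ?x\<close> is 0 and both sides vanish.\<close>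
  have *: "scale (of_nat m * of_nat (lk p ?x)) (bvec (p - Poly_Mapping.single ?x 1 + Poly_Mapping.single ?y 1) \<alpha>)
      = scale (of_nat m * of_nat (lk p ?x)) (bvec (p + Poly_Mapping.single ?y 1 - Poly_Mapping.single ?x 1) \<alpha>)"
    by (cases "lk p ?x = 0") (simp_all add: minus_add_single[simplified])
  show "heis i (int m) (heis j (- int n) (bvec p \<alpha>)) = heis j (- int n) (heis i (int m) (bvec p \<alpha>))
    + (if i = j \<and> m = n then scale (of_nat m) (bvec p \<alpha>) else 0)"
    using assms *
    by (auto simp: heis_creation heis_annihilation linop_scale[OF linop_heis] lookup_add lookup_single
        when_def distrib_left fock.scale_left_distrib)
qed (intro linop_heis_comp linop_id)

lemma heis_creation_creation:
  assumes "0 < m" and "0 < n"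
  shows "heis i (- int m) (heis j (- int n) v) = heis j (- int n) (heis i (- int m) v)"
  by (rule linop_eqI[where v = v and f = "\<lambda>v. heis i (- int m) (heis j (- int n) v)"
      and g = "\<lambda>v. heis j (- int n) (heis i (- int m) v)"])
    (use assms in \<open>auto intro!: linop_heis_comp linop_id simp: heis_creation add_ac\<close>)

lemma heis_annihilation_annihilation:
  "heis i (int m) (heis j (int n) v) = heis j (int n) (heis i (int m) v)"
proof (rule linop_eqI[where v = v and f = "\<lambda>v. heis i (int m) (heis j (int n) v)"
      and g = "\<lambda>v. heis j (int n) (heis i (int m) v)"])
  fix p :: monom and \<alpha>
  have "p - Poly_Mapping.single (j, n) 1 - Poly_Mapping.single (i, m) 1
      = p - Poly_Mapping.single (i, m) 1 - Poly_Mapping.single (j, n) 1"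
    by (rule poly_mapping_eqI) (simp add: lookup_minus)
  then show "heis i (int m) (heis j (int n) (bvec p \<alpha>)) = heis j (int n) (heis i (int m) (bvec p \<alpha>))"
    by (cases "(i, m) = (j, n)")
      (auto simp: heis_annihilation linop_scale[OF linop_heis] lookup_minus lookup_single when_def
        mult_ac)
qed (intro linop_heis_comp linop_id)+

lemma heis_commutator:
  assumes "m \<noteq> 0" and "n \<noteq> 0"
  shows "heis i m (heis j n v) = heis j n (heis i m v)
    + (if i = j \<and> m = - n then scale (of_int m) v else 0)"
proof -
  consider k l where "m = int k" "n = int l" | k l where "m = - int k" "n = - int l"
    | k l where "m = int k" "n = - int l" | k l where "m = - int k" "n = int l"
    by (metis int_cases2)
  then show ?thesis
  proof cases
    case 1
    then show ?thesis
      using assms by (simp add: heis_annihilation_annihilation)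
  next
    case 2
    then show ?thesis
      using assms by (simp add: heis_creation_creation)
  next
    case 3
    then show ?thesis
      using assms by (simp add: heis_annihilation_creation)
  next
    case 4
    \<comment> \<open>The preceding case with the two modes exchanged. Moving the central term to
      the other side turns \<open>l\<close> into \<open>- l\<close>, which is
      \<open>m\<close>.\<close>
    then have "heis j n (heis i m v) = heis i m (heis j n v)
        + (if j = i \<and> l = k then scale (of_nat l) v else 0)"
      using assms by (simp add: heis_annihilation_creation)
    then show ?thesis
      using 4 by (auto simp: add.assoc simp flip: fock.scale_left_distrib)
  qed
qed

section \<open>Degree filtration and invariance of \<open>VQ N\<close>\<close>

definition below :: "nat \<Rightarrow> fock set" where
  "below d = supp_space (\<lambda>(p, \<alpha>). deg p < d)"

lemma subspace_below: "fock.subspace (below d)"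
  unfolding below_def by (rule subspace_supp_space)

text \<open>The bound in \<open>below\<close> is strict, so level 0 is trivial. Together with
  truncated subtraction of levels, this turns "the degree drops below 0" into "the vector is
  0".\<close>

lemma below_0: "below 0 = {0}"
proof -
  have "v = 0" if "\<forall>p \<alpha>. (p, \<alpha>) \<notin> Poly_Mapping.keys v" for v :: fock
    using that by (intro poly_mapping_eqI) (auto simp: in_keys_iff)
  then show ?thesis
    by (auto simp: below_def supp_space_def)
qed

lemma bvec_below [simp]: "bvec p \<alpha> \<in> below d \<longleftrightarrow> deg p < d"
  by (simp add: below_def)

lemma exists_below: "\<exists>d. v \<in> below d"
proof -
  have "finite ((\<lambda>b. deg (fst b)) ` Poly_Mapping.keys v)"
    by simp
  then obtain d where "\<forall>x\<in>(\<lambda>b. deg (fst b)) ` Poly_Mapping.keys v. x < d"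
    using finite_nat_set_iff_bounded by blast
  then show ?thesis
    by (auto simp: below_def supp_space_def intro!: exI[of _ d])
qed

lemma heis_below:
  assumes "v \<in> below d"
  shows "heis i (int n) v \<in> below (d - n)"
  unfolding below_def[of d]
proof (rule linop_supp_space[OF linop_heis subspace_below])
  show "v \<in> supp_space (\<lambda>(p, \<alpha>). deg p < d)"
    using assms by (simp add: below_def)
  fix p :: monom and \<alpha> :: lattice assume p: "case (p, \<alpha>) of (p, \<alpha>) \<Rightarrow> deg p < d"
  show "heis i (int n) (bvec p \<alpha>) \<in> below (d - n)"
  proof (cases "lk p (i, n) = 0")
    case True
    then show ?thesis
      by (simp add: heis_annihilation fock.subspace_0[OF subspace_below])
  next
    case False
    then have "deg p = deg (p - Poly_Mapping.single (i, n) 1) + n"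
      using deg_minus_single[of p "(i, n)"] by simp
    then show ?thesis
      using p by (auto simp: heis_annihilation intro!: fock.subspace_scale subspace_below)
  qed
qed

lemma VQ_supp_space:
  "VQ N = supp_space (\<lambda>(p, \<alpha>). Poly_Mapping.keys p \<subseteq> {1..N} \<times> {1..} \<and> \<alpha> \<in> Qlat N)"
  by (simp add: VQ_def supp_space_def)

lemma subspace_VQ: "fock.subspace (VQ N)"
  unfolding VQ_supp_space by (rule subspace_supp_space)

lemma bvec_VQ: "bvec p \<alpha> \<in> VQ N \<longleftrightarrow> Poly_Mapping.keys p \<subseteq> {1..N} \<times> {1..} \<and> \<alpha> \<in> Qlat N"
  by (simp add: VQ_supp_space)

lemma linop_VQ:
  assumes "linop f"
    and "\<And>p \<alpha>. Poly_Mapping.keys p \<subseteq> {1..N} \<times> {1..} \<Longrightarrow> \<alpha> \<in> Qlat N \<Longrightarrow> f (bvec p \<alpha>) \<in> VQ N"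
    and "v \<in> VQ N"
  shows "f v \<in> VQ N"
  using assms(3) unfolding VQ_supp_space[of N]
  by (rule linop_supp_space[OF assms(1) subspace_VQ[unfolded VQ_supp_space], rotated])
    (use assms(2) in \<open>auto simp: VQ_supp_space\<close>)

lemma keys_minus_single: "Poly_Mapping.keys (p - Poly_Mapping.single x 1) \<subseteq> Poly_Mapping.keys p"
  for p :: monom
  by (auto simp: in_keys_iff lookup_minus)

lemma heis_VQ:
  assumes "i \<in> {1..N}" and "n \<noteq> 0" and "v \<in> VQ N"
  shows "heis i n v \<in> VQ N"
proof (rule linop_VQ[OF linop_heis _ assms(3)])
  fix p :: monom and \<alpha> assume p: "Poly_Mapping.keys p \<subseteq> {1..N} \<times> {1..}" and \<alpha>: "\<alpha> \<in> Qlat N"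
  show "heis i n (bvec p \<alpha>) \<in> VQ N"
  proof (cases n rule: int_cases2)
    case (nonneg k)
    then show ?thesis
      using p \<alpha> keys_minus_single[of p "(i, k)"]
      by (auto simp: heis_annihilation bvec_VQ intro!: fock.subspace_scale[OF subspace_VQ])
  next
    case (nonpos k)
    have "Poly_Mapping.keys (p + Poly_Mapping.single (i, k) 1) \<subseteq> {1..N} \<times> {1..}"
      using p assms nonpos keys_add[of p "Poly_Mapping.single (i, k) 1"] by auto
    then show ?thesis
      using nonpos \<alpha> assms by (simp add: heis_creation bvec_VQ)
  qed
qed


section \<open>Exponentials of operator series\<close>

lemma linop_ser_mult:
  "(\<And>j. linop (A j)) \<Longrightarrow> (\<And>j. linop (B j)) \<Longrightarrow> linop (ser_mult A B k)"
  unfolding ser_mult_def[abs_def] by (rule linop_sums) (rule linop_comp)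

lemma linop_ser_pow: "(\<And>j. linop (A j)) \<Longrightarrow> linop (ser_pow A s k)"
proof (induction s arbitrary: k)
  case 0
  then show ?case
    by (simp add: linop_def)
next
  case (Suc s)
  then show ?case
    by (simp add: linop_ser_mult)
qed

lemma linop_if: "linop f \<Longrightarrow> linop (\<lambda>v. if P then 0 else f v)"
  by (cases P) (simp_all add: linop_zero)

lemma linop_ser_exp: "(\<And>j. linop (A j)) \<Longrightarrow> linop (ser_exp A k)"
  unfolding ser_exp_def[abs_def] by (intro linop_sums linop_scaled linop_ser_pow linop_if)

text \<open>One notion for two purposes: with \<open>S = below\<close> it shows that high
  coefficients of E_+ kill a given vector, and with constant \<open>S\<close> it shows that the
  coefficients preserve \<open>VQ N\<close>.\<close>

definition filtered :: "(nat \<Rightarrow> fock set) \<Rightarrow> (nat \<Rightarrow> operator) \<Rightarrow> bool" where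
  "filtered S P \<longleftrightarrow> (\<forall>d j. \<forall>v\<in>S d. P j v \<in> S (d - j))"

lemma filtered_ser_mult:
  assumes S: "\<And>d. fock.subspace (S d)" and A: "filtered S A" and B: "filtered S B"
  shows "filtered S (ser_mult A B)"
  unfolding filtered_def
proof (intro allI ballI)
  fix d k v assume v: "v \<in> S d"
  have "A j (B (k - j) v) \<in> S (d - k)" if "j \<le> k" for j
  proof -
    have "A j (B (k - j) v) \<in> S (d - (k - j) - j)"
      using A B v unfolding filtered_def by blast
    then show ?thesis
      using that by simp
  qed
  then show "ser_mult A B k v \<in> S (d - k)"
    unfolding ser_mult_def by (intro fock.subspace_sum S) auto
qed

lemma filtered_ser_pow:
  assumes S: "\<And>d. fock.subspace (S d)" and A: "filtered S A"
  shows "filtered S (ser_pow A s)"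
proof (induction s)
  case 0
  then show ?case
    using fock.subspace_0[OF S] by (simp add: filtered_def)
next
  case (Suc s)
  then show ?case
    using filtered_ser_mult[OF S A] by simp
qed

lemma filtered_ser_exp:
  assumes S: "\<And>d. fock.subspace (S d)"
    and A: "\<And>d j v. 0 < j \<Longrightarrow> v \<in> S d \<Longrightarrow> A j v \<in> S (d - j)"
  shows "filtered S (ser_exp A)"
proof -
  have "filtered S (ser_pow (\<lambda>n v. if n = 0 then 0 else A n v) s)" for s
    using A fock.subspace_0[OF S] by (intro filtered_ser_pow S) (auto simp: filtered_def)
  then show ?thesis
    unfolding filtered_def ser_exp_def
    by (auto intro!: fock.subspace_sum fock.subspace_scale S)
qed

lemma ser_exp_0: "ser_exp A 0 v = v"
  by (simp add: ser_exp_def)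

lemma sum_atMost_shift_left:
  "(\<Sum>j\<le>k. if m \<le> k - j then g j else 0) = (if m \<le> k then \<Sum>j\<le>k - m. g j else 0)"
  for g :: "nat \<Rightarrow> 'a::comm_monoid_add"
proof (cases "m \<le> k")
  case True
  then show ?thesis
    by (simp flip: sum.inter_filter, intro sum.cong) auto
qed (auto intro!: sum.neutral)

lemma sum_atMost_shift_right:
  "(\<Sum>j\<le>k. if m \<le> j then g (j - m) else 0) = (if m \<le> k then \<Sum>j\<le>k - m. g j else 0)"
  for g :: "nat \<Rightarrow> 'a::comm_monoid_add"
proof (cases "m \<le> k")
  case True
  have "(\<Sum>j\<le>k. if m \<le> j then g (j - m) else 0) = (\<Sum>j\<in>{j\<in>{..k}. m \<le> j}. g (j - m))"
    by (simp flip: sum.inter_filter)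
  also have "\<dots> = (\<Sum>j\<le>k - m. g j)"
    using True by (intro sum.reindex_bij_witness[of _ "\<lambda>j. j + m" "\<lambda>j. j - m"]) auto
  finally show ?thesis
    using True by simp
qed (auto intro!: sum.neutral)

text \<open>The commutator of \<open>z\<close> with the series \<open>P(t)\<close> is \<open>x t^m P(t)\<close>.\<close>

definition twisted :: "operator \<Rightarrow> nat \<Rightarrow> complex \<Rightarrow> (nat \<Rightarrow> operator) \<Rightarrow> bool" where
  "twisted z m x P \<longleftrightarrow>
    (\<forall>k v. z (P k v) = P k (z v) + (if m \<le> k then scale x (P (k - m) v) else 0))"

text \<open>The commutator with \<open>z\<close> is a derivation and both factors contribute
  multiples of the same t^m. The case \<open>x + y = 0\<close> is what later makes
  \<open>zop\<close> commute with vertex operators.\<close>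

lemma twisted_ser_mult:
  assumes "linop z" and A: "\<And>j. linop (A j)" and "twisted z m x A" and "twisted z m y B"
  shows "twisted z m (x + y) (ser_mult A B)"
  unfolding twisted_def
proof (intro allI)
  fix k v
  have "z (ser_mult A B k v) = (\<Sum>j\<le>k. z (A j (B (k - j) v)))"
    by (simp add: ser_mult_def linop_sum[OF assms(1)])
  also have "\<dots> = (\<Sum>j\<le>k. A j (B (k - j) (z v))
      + (if m \<le> k - j then scale y (A j (B (k - m - j) v)) else 0)
      + (if m \<le> j then scale x (A (j - m) (B (k - m - (j - m)) v)) else 0))"
    using assms(3,4)
    by (intro sum.cong) (auto simp: twisted_def linop_add[OF A] linop_scale[OF A] linop_0[OF A] add.commute)
  also have "\<dots> = ser_mult A B k (z v)
      + (if m \<le> k then scale y (ser_mult A B (k - m) v) else 0)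
      + (if m \<le> k then scale x (ser_mult A B (k - m) v) else 0)"
    unfolding sum.distrib sum_atMost_shift_left
      sum_atMost_shift_right[where g = "\<lambda>i. scale x (A i (B (k - m - i) v))"]
    by (simp add: ser_mult_def fock.scale_sum_right)
  finally show "z (ser_mult A B k v) = ser_mult A B k (z v)
      + (if m \<le> k then scale (x + y) (ser_mult A B (k - m) v) else 0)"
    by (simp add: fock.scale_left_distrib)
qed

text \<open>Without constant term, the s-th power starts in degree s. This is also why the sum in
  \<open>ser_exp\<close> may stop at \<open>k\<close>.\<close>

lemma ser_pow_eq_0:
  assumes "\<And>j. linop (A j)" and "\<And>v. A 0 v = 0" and "k < s"
  shows "ser_pow A s k v = 0"
  using assms(3)
proof (induction s arbitrary: k)
  case (Suc s)
  have "A j (ser_pow A s (k - j) v) = 0" if "j \<le> k" for j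
  proof (cases "j = 0")
    case False
    then show ?thesis
      using Suc that by (auto simp: linop_0[OF assms(1)])
  qed (simp add: assms(2))
  then show ?case
    by (simp add: ser_mult_def)
qed simp

text \<open>Here [z, A(t)] = x t^m is scalar and passes through the other factors, whence
  [z, A(t)^s] = s x t^m A(t)^(s-1). For s = 0 the truncated exponent is harmless, as the factor s
  vanishes.\<close>

lemma ser_pow_commutator:
  assumes "linop z" and A: "\<And>j. linop (A j)"
    and zA: "\<And>n v. z (A n v) = A n (z v) + (if n = m then scale x v else 0)"
  shows "z (ser_pow A s k v) = ser_pow A s k (z v)
    + (if m \<le> k then scale (of_nat s * x) (ser_pow A (s - 1) (k - m) v) else 0)"
proof (induction s arbitrary: k)
  case 0
  then show ?case
    by (simp add: linop_0[OF assms(1)])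
next
  case (Suc s)
  have "z (ser_pow A (Suc s) k v) = (\<Sum>j\<le>k. z (A j (ser_pow A s (k - j) v)))"
    by (simp add: ser_mult_def linop_sum[OF assms(1)])
  also have "\<dots> = (\<Sum>j\<le>k. A j (ser_pow A s (k - j) (z v))
      + (if m \<le> k - j then scale (of_nat s * x) (A j (ser_pow A (s - 1) (k - m - j) v)) else 0)
      + (if j = m then scale x (ser_pow A s (k - m) v) else 0))"
    by (intro sum.cong)
      (auto simp: zA Suc linop_add[OF A] linop_scale[OF A] linop_0[OF A] add.commute)
  also have "\<dots> = ser_pow A (Suc s) k (z v)
      + (if m \<le> k then scale (of_nat s * x) (ser_mult A (ser_pow A (s - 1)) (k - m) v) else 0)
      + (if m \<le> k then scale x (ser_pow A s (k - m) v) else 0)"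
    unfolding sum.distrib sum_atMost_shift_left
    by (simp add: ser_mult_def fock.scale_sum_right)
  also have "scale (of_nat s * x) (ser_mult A (ser_pow A (s - 1)) (k - m) v)
      = scale (of_nat s * x) (ser_pow A s (k - m) v)"
    by (cases s) simp_all
  finally show ?case
    by (simp add: distrib_right fock.scale_left_distrib add_ac)
qed

text \<open>Since s / s! = 1 / (s-1)!, the commutators of the powers add up to x t^m times the
  exponential again.\<close>

lemma twisted_ser_exp:
  assumes "linop z" and A: "\<And>j. linop (A j)" and "0 < m"
    and zA: "\<And>n v. 0 < n \<Longrightarrow> z (A n v) = A n (z v) + (if n = m then scale x v else 0)"
  shows "twisted z m x (ser_exp A)"
  unfolding twisted_def
proof (intro allI)
  fix k v
  let ?P = "ser_pow (\<lambda>n v. if n = 0 then 0 else A n v)"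
  have B: "linop (\<lambda>v. if n = 0 then 0 else A n v)" for n
    by (intro linop_if A)
  have comm: "z (?P s k v) = ?P s k (z v)
      + (if m \<le> k then scale (of_nat s * x) (?P (s - 1) (k - m) v) else 0)" for s k v
    by (rule ser_pow_commutator[OF assms(1) B]) (use assms(3) zA linop_0[OF assms(1)] in auto)
  have z: "z (ser_exp A k v) = ser_exp A k (z v)
      + (\<Sum>s\<le>k. if m \<le> k then scale (of_nat s * x / fact s) (?P (s - 1) (k - m) v) else 0)"
    by (cases "m \<le> k") (simp_all add: ser_exp_def linop_sum[OF assms(1)] linop_scale[OF assms(1)]
        comm fock.scale_right_distrib sum.distrib)
  show "z (ser_exp A k v) = ser_exp A k (z v) + (if m \<le> k then scale x (ser_exp A (k - m) v) else 0)"
  proof (cases "m \<le> k")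
    case True
    then obtain l where k: "k = Suc l"
      using \<open>0 < m\<close> by (cases k) auto
    have "(\<Sum>s\<le>k. scale (of_nat s * x / fact s) (?P (s - 1) (k - m) v))
        = (\<Sum>s\<le>l. scale (of_nat (Suc s) * x / fact (Suc s)) (?P s (k - m) v))"
      unfolding k by (subst sum.atMost_Suc_shift) simp
    also have "\<dots> = (\<Sum>s\<le>l. scale (x / fact s) (?P s (k - m) v))"
      by (intro sum.cong refl arg_cong2[of _ _ _ _ scale])
        (simp_all add: field_simps del: of_nat_Suc)
    \<comment> \<open>The exponential is truncated at different places on the two sides, but powers
      beyond \<open>k - m\<close> have no coefficient in that degree.\<close>
    also have "\<dots> = (\<Sum>s\<le>k - m. scale (x / fact s) (?P s (k - m) v))"
      using True \<open>0 < m\<close> k by (intro sum.mono_neutral_right) (auto simp: ser_pow_eq_0[OF B])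
    also have "\<dots> = scale x (ser_exp A (k - m) v)"
      by (simp add: ser_exp_def fock.scale_sum_right)
    finally show ?thesis
      using True z by simp
  qed (simp add: z)
qed

section \<open>A Heisenberg algebra commuting with \<open>U_q(sl^_N)\<close>\<close>

text \<open>
  Commuting with \<open>h_{jm}\<close> forces the coefficients \<open>a_i\<close> of \<open>\<epsilon>_i(n)\<close> to satisfy \<open>a_{i+1} = q^|n| a_i\<close>.
\<close>

definition zop :: "complex \<Rightarrow> nat \<Rightarrow> int \<Rightarrow> operator" where
  "zop q N n v = (\<Sum>i=1..N. scale (q ^ (i * nat \<bar>n\<bar>)) (heis i n v))"

lemma linop_zop: "linop (zop q N n)"
  unfolding zop_def[abs_def] by (intro linop_sums linop_scaled linop_heis)

lemma zop_heis:
  assumes "i \<in> {1..N}" and "m \<noteq> 0" and "n \<noteq> 0"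
  shows "zop q N n (heis i m v) = heis i m (zop q N n v)
    + (if n = - m then scale (of_int n * q ^ (i * nat \<bar>n\<bar>)) v else 0)"
proof -
  have "zop q N n (heis i m v) = (\<Sum>j=1..N. scale (q ^ (j * nat \<bar>n\<bar>)) (heis i m (heis j n v))
      + (if j = i then if n = - m then scale (of_int n * q ^ (i * nat \<bar>n\<bar>)) v else 0 else 0))"
    unfolding zop_def
    by (intro sum.cong refl)
      (auto simp: heis_commutator[OF assms(3,2)] fock.scale_right_distrib mult.commute)
  also have "\<dots> = heis i m (zop q N n v)
      + (if n = - m then scale (of_int n * q ^ (i * nat \<bar>n\<bar>)) v else 0)"
    using assms(1) unfolding sum.distrib
    by (simp add: zop_def linop_sum[OF linop_heis] linop_scale[OF linop_heis])
  finally show ?thesis .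
qed

text \<open>Only equal indices contribute, so the coefficients are squared and the central term
  becomes a geometric sum in q^(2|m|).\<close>

lemma zop_zop:
  assumes "m \<noteq> 0" and "n \<noteq> 0"
  shows "zop q N m (zop q N n v) = zop q N n (zop q N m v)
    + (if m = - n then scale (of_int m * (\<Sum>i=1..N. (q ^ (2 * nat \<bar>m\<bar>)) ^ i)) v else 0)"
proof -
  have pow: "q ^ (i * k) * q ^ (i * k) = (q ^ (2 * k)) ^ i" for i k
  proof -
    have "2 * (i * k) = 2 * k * i"
      by simp
    then have "q ^ (2 * (i * k)) = (q ^ (2 * k)) ^ i"
      by (simp only: power_mult)
    then show ?thesis
      by (simp add: mult_2 power_add)
  qed
  have "zop q N m (zop q N n v) = (\<Sum>i=1..N. scale (q ^ (i * nat \<bar>n\<bar>)) (zop q N m (heis i n v)))"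
    by (simp add: zop_def[of q N n] linop_sum[OF linop_zop] linop_scale[OF linop_zop])
  also have "\<dots> = (\<Sum>i=1..N. scale (q ^ (i * nat \<bar>n\<bar>)) (heis i n (zop q N m v))
      + (if m = - n then scale (of_int m * (q ^ (2 * nat \<bar>m\<bar>)) ^ i) v else 0))"
    using assms pow
    by (intro sum.cong refl) (auto simp: zop_heis fock.scale_right_distrib mult.left_commute)
  also have "\<dots> = zop q N n (zop q N m v)
      + (if m = - n then scale (of_int m * (\<Sum>i=1..N. (q ^ (2 * nat \<bar>m\<bar>)) ^ i)) v else 0)"
    unfolding sum.distrib
    by (cases "m = - n") (simp_all add: zop_def[of q N n] sum_distrib_left fock.scale_sum_left)
  finally show ?thesis .
qed

definition supp_lat :: "lattice \<Rightarrow> fock set" where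
  "supp_lat \<alpha> = supp_space (\<lambda>(p, \<alpha>'). \<alpha>' = \<alpha>)"

lemma heis_bvec_supp_lat: "heis i n (bvec p \<alpha>) \<in> supp_lat \<alpha>"
  by (auto simp: heis_def supp_lat_def intro!: fock.subspace_scale subspace_supp_space)

lemma zop_bvec_supp_lat: "zop q N n (bvec p \<alpha>) \<in> supp_lat \<alpha>"
proof -
  have "fock.subspace (supp_lat \<alpha>)"
    unfolding supp_lat_def by (rule subspace_supp_space)
  then show ?thesis
    unfolding zop_def using heis_bvec_supp_lat
    by (intro fock.subspace_sum) (auto intro: fock.subspace_scale)
qed

lemma zop_VQ: "n \<noteq> 0 \<Longrightarrow> v \<in> VQ N \<Longrightarrow> zop q N n v \<in> VQ N"
  unfolding zop_def by (intro fock.subspace_sum fock.subspace_scale subspace_VQ heis_VQ)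

text \<open>\<open>f\<close> is a scalar on each component S(H^-) \<otimes> e^\<alpha>, and
  \<open>g\<close> preserves these components.\<close>

lemma lattice_diagonal_commute:
  assumes "linop f" and "linop g" and f: "\<And>p \<alpha>. f (bvec p \<alpha>) = scale (e \<alpha>) (bvec p \<alpha>)"
    and g: "\<And>p \<alpha>. g (bvec p \<alpha>) \<in> supp_lat \<alpha>"
  shows "f (g v) = g (f v)"
proof (rule linop_eqI[where v = v and f = "\<lambda>v. f (g v)" and g = "\<lambda>v. g (f v)"])
  fix p \<alpha>
  have "f w = scale (e \<alpha>) w" if "w \<in> supp_lat \<alpha>" for w
    by (rule linop_eq_on_keys[OF assms(1) linop_scaled[OF linop_id]])
      (use that f in \<open>auto simp: supp_lat_def supp_space_def\<close>)
  then show "f (g (bvec p \<alpha>)) = g (f (bvec p \<alpha>))"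
    by (simp add: f g linop_scale[OF assms(2)])
qed (rule linop_comp[OF assms(1,2)], rule linop_comp[OF assms(2,1)])


section \<open>Vertex operators\<close>

lemma linop_Eminus: "linop (Eminus i s c k)"
  unfolding Eminus_def by (intro linop_ser_exp linop_scaled linop_heis)

lemma linop_Eplus: "linop (Eplus i s c k)"
  unfolding Eplus_def by (intro linop_ser_exp linop_scaled linop_heis)

text \<open>Only for \<open>0 < n\<close> does \<open>zop q N n\<close> meet creation operators
  noncommutatively; its central term then cancels the denominator in the exponent of E_-.\<close>

lemma twisted_Eminus:
  assumes "i \<in> {1..N}" and "n \<noteq> 0"
  shows "twisted (zop q N n) (nat \<bar>n\<bar>) (if 0 < n then s * c ^ nat \<bar>n\<bar> * q ^ (i * nat \<bar>n\<bar>) else 0)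
    (Eminus i s c)"
  unfolding Eminus_def
proof (rule twisted_ser_exp)
  fix k :: nat and v assume "0 < k"
  have "nat \<bar>n\<bar> = k \<longleftrightarrow> n = int k \<or> n = - int k"
    by auto
  then show "zop q N n (scale (s * c ^ k / of_nat k) (heis i (- int k) v))
    = scale (s * c ^ k / of_nat k) (heis i (- int k) (zop q N n v))
    + (if k = nat \<bar>n\<bar> then scale (if 0 < n then s * c ^ nat \<bar>n\<bar> * q ^ (i * nat \<bar>n\<bar>) else 0) v else 0)"
    using assms \<open>0 < k\<close>
    by (auto simp: linop_scale[OF linop_zop] zop_heis fock.scale_right_distrib)
qed (rule linop_zop, rule linop_scaled[OF linop_heis], use assms in simp)

lemma twisted_Eplus:
  assumes "i \<in> {1..N}" and "n \<noteq> 0"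
  shows "twisted (zop q N n) (nat \<bar>n\<bar>) (if n < 0 then s * q ^ (i * nat \<bar>n\<bar>) / c ^ nat \<bar>n\<bar> else 0)
    (Eplus i s c)"
  unfolding Eplus_def
proof (rule twisted_ser_exp)
  fix k :: nat and v assume "0 < k"
  have "nat \<bar>n\<bar> = k \<longleftrightarrow> n = int k \<or> n = - int k"
    by auto
  moreover define a where "a = - s / (of_nat k * c ^ k)"
  moreover have "a * (of_int (- int k) * q ^ (i * k)) = s * q ^ (i * k) / c ^ k"
    using \<open>0 < k\<close> by (simp add: a_def)
  ultimately show "zop q N n (scale (- s / (of_nat k * c ^ k)) (heis i (int k) v))
    = scale (- s / (of_nat k * c ^ k)) (heis i (int k) (zop q N n v))
    + (if k = nat \<bar>n\<bar> then scale (if n < 0 then s * q ^ (i * nat \<bar>n\<bar>) / c ^ nat \<bar>n\<bar> else 0) v else 0)"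
    unfolding a_def[symmetric] using assms \<open>0 < k\<close>
    by (auto simp: linop_scale[OF linop_zop] zop_heis fock.scale_right_distrib)
qed (rule linop_zop, rule linop_scaled[OF linop_heis], use assms in simp)

text \<open>The creation half of X_ij(z), by powers of z; \<open>Ep\<close> is the annihilation
  half, by powers of 1/z.\<close>

definition Em :: "complex \<Rightarrow> nat \<Rightarrow> nat \<Rightarrow> nat \<Rightarrow> operator" where
  "Em q i j = ser_mult (Eminus i 1 1) (Eminus j (- 1) (q powi (int i - int j)))"

definition Ep :: "complex \<Rightarrow> nat \<Rightarrow> nat \<Rightarrow> nat \<Rightarrow> operator" where
  "Ep q i j = ser_mult (Eplus i 1 1) (Eplus j (- 1) (q powi (- (int i - int j))))"

lemma linop_Em: "linop (Em q i j k)" and linop_Ep: "linop (Ep q i j k)"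
  unfolding Em_def Ep_def by (intro linop_ser_mult linop_Eminus linop_Eplus)+

text \<open>For \<open>0 < n\<close> the twists of the two factors are q^(i|n|) and -(q^(i-j))^|n|
  q^(j|n|), which cancel; for \<open>n < 0\<close> both are 0. The shift in the second argument of
  the vertex operator is exactly what is needed.\<close>

lemma zop_Em:
  assumes "q \<noteq> 0" and "i \<in> {1..N}" and "j \<in> {1..N}" and "n \<noteq> 0"
  shows "zop q N n (Em q i j k v) = Em q i j k (zop q N n v)"
proof -
  let ?m = "nat \<bar>n\<bar>"
  have "(q powi (int i - int j)) ^ ?m * q ^ (j * ?m) = q ^ (i * ?m)"
    using assms(1) by (simp add: power_int_diff power_divide power_mult)
  then show ?thesis
    using twisted_ser_mult[OF linop_zop linop_Eminus
        twisted_Eminus[OF assms(2,4), of q 1 1] twisted_Eminus[OF assms(3,4), of q "- 1" "q powi (int i - int j)"]]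
    by (auto simp: twisted_def Em_def split: if_splits)
qed

lemma zop_Ep:
  assumes "q \<noteq> 0" and "i \<in> {1..N}" and "j \<in> {1..N}" and "n \<noteq> 0"
  shows "zop q N n (Ep q i j k v) = Ep q i j k (zop q N n v)"
proof -
  let ?m = "nat \<bar>n\<bar>"
  have "q ^ (j * ?m) / (q powi (- (int i - int j))) ^ ?m = q ^ (i * ?m)"
    using assms(1) by (simp add: power_int_diff power_int_minus power_divide power_mult)
  then show ?thesis
    using twisted_ser_mult[OF linop_zop linop_Eplus
        twisted_Eplus[OF assms(2,4), of q 1 1] twisted_Eplus[OF assms(3,4), of q "- 1" "q powi (- (int i - int j))"]]
    by (auto simp: twisted_def Ep_def split: if_splits)
qed

lemma Em_0: "Em q i j 0 v = v" and Ep_0: "Ep q i j 0 v = v"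
  by (simp_all add: Em_def Ep_def ser_mult_def Eminus_def Eplus_def ser_exp_0)

lemma Ep_below:
  assumes "v \<in> below d"
  shows "Ep q i j k v \<in> below (d - k)"
proof -
  have "filtered below (Eplus i s c)" for i s c
    unfolding Eplus_def
    by (intro filtered_ser_exp subspace_below fock.subspace_scale heis_below)
  then have "filtered below (Ep q i j)"
    unfolding Ep_def by (intro filtered_ser_mult subspace_below)
  then show ?thesis
    using assms by (simp add: filtered_def)
qed

lemma finite_Ep: "finite {k. Ep q i j k v \<noteq> 0}"
proof -
  obtain d where "v \<in> below d"
    using exists_below by blast
  then have "Ep q i j k v = 0" if "d \<le> k" for k
    using Ep_below[of v d q i j k] that by (simp add: below_0)
  then have "{k. Ep q i j k v \<noteq> 0} \<subseteq> {..<d}"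
    by (auto simp: not_less[symmetric])
  then show ?thesis
    using finite_subset by blast
qed

lemma EmEp_VQ:
  assumes "i \<in> {1..N}" and "j \<in> {1..N}" and "v \<in> VQ N"
  shows "Em q i j l (Ep q i j k v) \<in> VQ N"
proof -
  let ?S = "\<lambda>d::nat. VQ N"
  have *: "filtered ?S (Eplus i s c)" "filtered ?S (Eminus i s c)" if "i \<in> {1..N}" for i s c
    unfolding Eplus_def Eminus_def using that
    by (intro filtered_ser_exp subspace_VQ fock.subspace_scale[OF subspace_VQ] heis_VQ; simp)+
  have "filtered ?S (Ep q i j)" "filtered ?S (Em q i j)"
    unfolding Ep_def Em_def using assms by (auto intro!: filtered_ser_mult subspace_VQ *)
  then show ?thesis
    using assms(3) by (simp add: filtered_def)
qed

section \<open>Lattice shifts and the modes of X_ij(z)\<close>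

definition shift :: "lattice \<Rightarrow> operator" where
  "shift \<beta> = lin_ext (\<lambda>p \<alpha>. bvec p (\<alpha> + \<beta>))"

lemma linop_shift: "linop (shift \<beta>)"
  unfolding shift_def by (rule linop_lin_ext)

lemma shift_bvec [simp]: "shift \<beta> (bvec p \<alpha>) = bvec p (\<alpha> + \<beta>)"
  by (simp add: shift_def)

lemma heis_shift: "heis i n (shift \<beta> v) = shift \<beta> (heis i n v)"
  by (rule linop_eqI[where v = v and f = "\<lambda>v. heis i n (shift \<beta> v)" and g = "\<lambda>v. shift \<beta> (heis i n v)"])
    (rule linop_heis_comp[OF linop_shift], rule linop_comp[OF linop_shift linop_heis],
      simp add: heis_def linop_scale[OF linop_shift])

lemma zop_shift: "zop q N n (shift \<beta> v) = shift \<beta> (zop q N n v)"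
  by (simp add: zop_def heis_shift linop_sum[OF linop_shift] linop_scale[OF linop_shift])

text \<open>The restriction of \<open>X_ij\<close> to \<open>S(H^-) \<otimes> e^\<alpha>\<close>, extended to the whole space.\<close>

definition Xat :: "complex \<Rightarrow> (lattice \<Rightarrow> lattice \<Rightarrow> complex) \<Rightarrow> nat \<Rightarrow> nat \<Rightarrow> int \<Rightarrow> lattice \<Rightarrow> operator" where
  "Xat q \<epsilon> i j n \<alpha> v = scale (\<epsilon> (eps i - eps j) \<alpha>) (Sum_any (\<lambda>k.
     if n + lk \<alpha> i - lk \<alpha> j + 1 \<le> int k
     then Em q i j (nat (int k - (n + lk \<alpha> i - lk \<alpha> j + 1))) (Ep q i j k (shift (eps i - eps j) v))
     else 0))"

lemma finite_Xat: "finite {k. (if P k then Em q i j (f k) (Ep q i j k v) else 0) \<noteq> 0}"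
proof (rule finite_subset)
  show "{k. (if P k then Em q i j (f k) (Ep q i j k v) else 0) \<noteq> 0} \<subseteq> {k. Ep q i j k v \<noteq> 0}"
    by (auto simp: linop_0[OF linop_Em])
qed (rule finite_Ep)

lemma linop_Xat: "linop (Xat q \<epsilon> i j n \<alpha>)"
proof -
  have "linop (\<lambda>v. if P then Em q i j l (Ep q i j k (shift \<beta> v)) else 0)" for P l k \<beta>
    using linop_comp[OF linop_Em linop_comp[OF linop_Ep linop_shift]]
    by (cases P) (simp_all add: linop_zero)
  then show ?thesis
    unfolding Xat_def[abs_def] by (intro linop_scaled linop_Sum_any finite_Xat)
qed

lemma linop_Xop: "linop (Xop q \<epsilon> i j n)"
  unfolding Xop_def by (rule linop_lin_ext)

lemma Xop_bvec: "Xop q \<epsilon> i j n (bvec p \<alpha>) = Xat q \<epsilon> i j n \<alpha> (bvec p \<alpha>)"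
  unfolding Xop_def Xat_def Em_def Ep_def Let_def lin_ext_bvec shift_bvec ..

text \<open>On one lattice component the cocycle factor and the exponent of z are constant, so a
  single linear formula gives the mode. As \<open>zop\<close> stays in the component, commutation
  can be checked on that formula.\<close>

lemma Xop_eq_Xat:
  assumes "v \<in> supp_lat \<alpha>"
  shows "Xop q \<epsilon> i j n v = Xat q \<epsilon> i j n \<alpha> v"
  by (rule linop_eq_on_keys[OF linop_Xop linop_Xat])
    (use assms in \<open>auto simp: supp_lat_def supp_space_def Xop_bvec\<close>)

lemma zop_Xat:
  assumes "q \<noteq> 0" and "i \<in> {1..N}" and "j \<in> {1..N}" and "m \<noteq> 0"
  shows "zop q N m (Xat q \<epsilon> i j n \<alpha> v) = Xat q \<epsilon> i j n \<alpha> (zop q N m v)"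
  unfolding Xat_def linop_scale[OF linop_zop] linop_apply_Sum_any[OF linop_zop finite_Xat]
  by (simp add: if_distrib[of "zop q N m"] linop_0[OF linop_zop] zop_Em[OF assms] zop_Ep[OF assms]
      zop_shift cong: if_cong)

lemma zop_Xop:
  assumes "q \<noteq> 0" and "i \<in> {1..N}" and "j \<in> {1..N}" and "m \<noteq> 0"
  shows "zop q N m (Xop q \<epsilon> i j n v) = Xop q \<epsilon> i j n (zop q N m v)"
proof (rule linop_eqI[where v = v and f = "\<lambda>v. zop q N m (Xop q \<epsilon> i j n v)"
      and g = "\<lambda>v. Xop q \<epsilon> i j n (zop q N m v)"])
  show "zop q N m (Xop q \<epsilon> i j n (bvec p \<alpha>)) = Xop q \<epsilon> i j n (zop q N m (bvec p \<alpha>))" for p \<alpha>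
    by (simp add: Xop_bvec zop_Xat[OF assms] Xop_eq_Xat[OF zop_bvec_supp_lat])
qed (rule linop_comp[OF linop_zop linop_Xop], rule linop_comp[OF linop_Xop linop_zop])

text \<open>On e^\<alpha> all terms of E_+ of positive degree vanish. The mode is chosen to match
  the exponent of z contributed by the lattice part, so that of E_- only the constant term
  remains.\<close>

lemma Xop_vacuum:
  "Xop q \<epsilon> i j (lk \<alpha> j - lk \<alpha> i - 1) (bvec 0 \<alpha>)
    = scale (\<epsilon> (eps i - eps j) \<alpha>) (bvec 0 (\<alpha> + (eps i - eps j)))"
proof -
  let ?w = "bvec 0 (\<alpha> + (eps i - eps j))"
  have Ep: "Ep q i j k ?w = 0" if "0 < k" for k
    using Ep_below[of ?w 1 q i j k] that by (simp add: below_0)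
  have "Sum_any (\<lambda>k. Em q i j k (Ep q i j k ?w)) = (\<Sum>k\<in>{0}. Em q i j k (Ep q i j k ?w))"
  proof (rule Sum_any.expand_superset)
    show "{k. Em q i j k (Ep q i j k ?w) \<noteq> 0} \<subseteq> {0}"
    proof
      fix k assume "k \<in> {k. Em q i j k (Ep q i j k ?w) \<noteq> 0}"
      then show "k \<in> {0}"
        using Ep[of k] by (cases "k = 0") (simp_all add: linop_0[OF linop_Em])
    qed
  qed simp
  moreover have "lk \<alpha> j - lk \<alpha> i - 1 + lk \<alpha> i - lk \<alpha> j + 1 = 0"
    by simp
  ultimately show ?thesis
    unfolding Xop_bvec Xat_def by (simp only: shift_bvec) (simp add: Em_0 Ep_0)
qed

section \<open>The root lattice\<close>

abbreviation root :: "nat \<Rightarrow> lattice" where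
  "root i \<equiv> eps i - eps (Suc i)"

lemma Qlat_0: "0 \<in> Qlat N"
  unfolding Qlat_def by (auto intro!: exI[of _ "\<lambda>_. 0"])

lemma Qlat_add:
  assumes "\<alpha> \<in> Qlat N" and "\<beta> \<in> Qlat N"
  shows "\<alpha> + \<beta> \<in> Qlat N"
proof -
  obtain a b where
    "\<alpha> = (\<Sum>i=1..<N. Poly_Mapping.single i (a i) - Poly_Mapping.single (Suc i) (a i))"
    "\<beta> = (\<Sum>i=1..<N. Poly_Mapping.single i (b i) - Poly_Mapping.single (Suc i) (b i))"
    using assms unfolding Qlat_def by blast
  then have "\<alpha> + \<beta> = (\<Sum>i=1..<N. Poly_Mapping.single i (a i + b i) - Poly_Mapping.single (Suc i) (a i + b i))"
    by (simp add: single_add algebra_simps flip: sum.distrib)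
  then show ?thesis
    unfolding Qlat_def by auto
qed

lemma Qlat_uminus:
  assumes "\<alpha> \<in> Qlat N"
  shows "- \<alpha> \<in> Qlat N"
proof -
  obtain a where
    "\<alpha> = (\<Sum>i=1..<N. Poly_Mapping.single i (a i) - Poly_Mapping.single (Suc i) (a i))"
    using assms unfolding Qlat_def by blast
  then have "- \<alpha> = (\<Sum>i=1..<N. Poly_Mapping.single i (- a i) - Poly_Mapping.single (Suc i) (- a i))"
    by (simp add: single_uminus flip: sum_negf)
  then show ?thesis
    unfolding Qlat_def by auto
qed

lemma Qlat_diff: "\<alpha> \<in> Qlat N \<Longrightarrow> \<beta> \<in> Qlat N \<Longrightarrow> \<alpha> - \<beta> \<in> Qlat N"
  using Qlat_add[of \<alpha> N "- \<beta>"] Qlat_uminus by simp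

lemma Qlat_root:
  assumes "i \<in> {1..<N}"
  shows "root i \<in> Qlat N"
proof -
  have "root i = (\<Sum>j=1..<N. Poly_Mapping.single j (if j = i then 1 else 0)
      - Poly_Mapping.single (Suc j) (if j = i then 1 else 0))"
    using assms by (subst sum.remove[of _ i]) (auto simp: eps_def intro!: sum.neutral)
  then show ?thesis
    unfolding Qlat_def by (auto intro!: exI[of _ "\<lambda>j. if j = i then 1 else 0"])
qed

lemma Qlat_neg_root: "i \<in> {1..<N} \<Longrightarrow> eps (Suc i) - eps i \<in> Qlat N"
  using Qlat_uminus[OF Qlat_root] by simp

text \<open>The simple roots generate Q, so one can walk from \<alpha> to \<alpha> + \<beta>:
  integer multiples of one root by two-sided induction, then root after root.\<close>

lemma Qlat_translate:
  assumes "\<alpha> \<in> S" and "\<beta> \<in> Qlat N"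
    and plus: "\<And>\<gamma> i. \<gamma> \<in> S \<Longrightarrow> i \<in> {1..<N} \<Longrightarrow> \<gamma> + root i \<in> S"
    and minus: "\<And>\<gamma> i. \<gamma> \<in> S \<Longrightarrow> i \<in> {1..<N} \<Longrightarrow> \<gamma> - root i \<in> S"
  shows "\<alpha> + \<beta> \<in> S"
proof -
  let ?c = "\<lambda>i k. Poly_Mapping.single i k - Poly_Mapping.single (Suc i) k :: lattice"
  have mult: "\<gamma> + ?c i k \<in> S" if "\<gamma> \<in> S" "i \<in> {1..<N}" for \<gamma> i k
  proof (induction k rule: int_induct[where k = 0])
    case base
    show ?case
      using that by simp
  next
    case (step1 k)
    then show ?case
      using plus[OF step1(2) that(2)] by (simp add: single_add eps_def algebra_simps)
  next
    case (step2 k)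
    then show ?case
      using minus[OF step2(2) that(2)] by (simp add: single_diff eps_def algebra_simps)
  qed
  obtain b where b: "\<beta> = (\<Sum>i=1..<N. ?c i (b i))"
    using assms(2) unfolding Qlat_def by blast
  have "\<alpha> + (\<Sum>i\<in>I. ?c i (b i)) \<in> S" if "finite I" "I \<subseteq> {1..<N}" for I
    using that
  proof (induction I rule: finite_induct)
    case empty
    show ?case
      using assms(1) by simp
  next
    case (insert i I)
    then have "\<alpha> + (\<Sum>i\<in>I. ?c i (b i)) + ?c i (b i) \<in> S"
      by (intro mult) auto
    then show ?case
      using insert.hyps by (simp add: add_ac)
  qed
  then show ?thesis
    unfolding b by blast
qed

lemma Qlat_support:
  assumes "\<alpha> \<in> Qlat N" and "k \<notin> {1..N}"
  shows "lk \<alpha> k = 0"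
  using assms by (auto simp: Qlat_def lookup_sum lookup_minus lookup_single when_def intro!: sum.neutral)

lemma Qlat_coordinate_sum:
  assumes "\<alpha> \<in> Qlat N"
  shows "(\<Sum>k=1..N. lk \<alpha> k) = 0"
proof -
  obtain a where
    "\<alpha> = (\<Sum>i=1..<N. Poly_Mapping.single i (a i) - Poly_Mapping.single (Suc i) (a i))"
    using assms unfolding Qlat_def by blast
  then have "(\<Sum>k=1..N. lk \<alpha> k) = (\<Sum>i=1..<N. \<Sum>k=1..N. (if i = k then a i else 0) - (if Suc i = k then a i else 0))"
    by (subst sum.swap) (simp add: lookup_sum lookup_minus lookup_single when_def)
  also have "\<dots> = 0"
    unfolding sum_subtractf[of _ _ "{1..N}"] by (intro sum.neutral) auto
  finally show ?thesis .
qed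

text \<open>Equal neighbour differences make \<alpha> - \<beta> a multiple of (1, ..., 1), and the
  vanishing coordinate sum kills it. Hence the k_{i0}, and likewise the weights, separate the points
  of Q.\<close>

lemma Qlat_eqI:
  assumes "\<alpha> \<in> Qlat N" and "\<beta> \<in> Qlat N"
    and eq: "\<And>i. i \<in> {1..<N} \<Longrightarrow> lk \<alpha> i - lk \<alpha> (Suc i) = lk \<beta> i - lk \<beta> (Suc i)"
  shows "\<alpha> = \<beta>"
proof -
  define \<gamma> where "\<gamma> = \<alpha> - \<beta>"
  have \<gamma>: "\<gamma> \<in> Qlat N"
    unfolding \<gamma>_def using assms by (intro Qlat_diff)
  have neighbours: "lk \<gamma> (Suc i) = lk \<gamma> i" if "i \<in> {1..<N}" for i
    using eq[OF that] by (simp add: \<gamma>_def lookup_minus)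
  have const: "lk \<gamma> k = lk \<gamma> 1" if "k \<in> {1..N}" for k
  proof -
    have "k \<ge> 1"
      using that by simp
    then have "k \<le> N \<longrightarrow> lk \<gamma> k = lk \<gamma> 1"
    proof (induction k rule: dec_induct)
      case (step k)
      then show ?case
        using neighbours[of k] by simp
    qed simp
    then show ?thesis
      using that by simp
  qed
  have "(\<Sum>k=1..N. lk \<gamma> k) = (\<Sum>k=1..N. lk \<gamma> 1)"
    by (rule sum.cong[OF refl const])
  then have "lk \<gamma> 1 = 0 \<or> N = 0"
    using Qlat_coordinate_sum[OF \<gamma>] by auto
  then have "lk \<gamma> k = 0" for k
    using const[of k] Qlat_support[OF \<gamma>, of k] by (cases "k \<in> {1..N}") auto
  then have "\<gamma> = 0"
    by (intro poly_mapping_eqI) simp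
  then show ?thesis
    by (simp add: \<gamma>_def)
qed

text \<open>A square has the parity of its root, and the coordinates sum to 0. This makes the
  division by 2 in \<open>level\<close> exact.\<close>

lemma form_even:
  assumes "\<alpha> \<in> Qlat N"
  shows "even (form N \<alpha> \<alpha>)"
proof -
  have "form N \<alpha> \<alpha> = (\<Sum>k=1..N. lk \<alpha> k * (lk \<alpha> k - 1)) + (\<Sum>k=1..N. lk \<alpha> k)"
    by (simp add: form_def algebra_simps flip: sum.distrib)
  moreover have "even (\<Sum>k=1..N. lk \<alpha> k * (lk \<alpha> k - 1))"
    by (intro dvd_sum) auto
  ultimately show ?thesis
    using Qlat_coordinate_sum[OF assms] by simp
qed

lemma form_nonneg: "0 \<le> form N \<alpha> \<alpha>"
  unfolding form_def by (intro sum_nonneg) simp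


section \<open>Irreducibility\<close>

lemma generic_powi_inj:
  assumes "generic q" and "q powi m = q powi n"
  shows "m = n"
proof -
  have q: "q \<noteq> 0" "\<And>k. 0 < k \<Longrightarrow> q ^ k \<noteq> 1"
    using assms(1) by (auto simp: generic_def)
  have *: "q powi k \<noteq> 1" if "0 < k" for k
    using q(2)[of "nat k"] that by (simp add: power_int_def)
  have "q powi (m - n) = 1" "q powi (n - m) = 1"
    using assms(2) q(1) by (simp_all add: power_int_diff)
  then show ?thesis
    using *[of "m - n"] *[of "n - m"] by linarith
qed

text \<open>With t = q^(2m) the sum is t (t^N - 1) / (t - 1), and neither t nor t^N is 1. This is
  the nonvanishing of the central terms of the z_n.\<close>

lemma generic_geometric_sum:
  assumes "generic q" and "0 < m" and "0 < N"
  shows "(\<Sum>i=1..N. (q ^ (2 * m)) ^ i) \<noteq> 0"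
proof -
  define t where "t = q ^ (2 * m)"
  have "t \<noteq> 0" "t \<noteq> 1" "t ^ N \<noteq> 1"
    using assms by (auto simp: t_def generic_def simp flip: power_mult)
  moreover have "(\<Sum>i=1..N. t ^ i) = t * (\<Sum>i<N. t ^ i)"
    by (simp add: sum_distrib_left sum.atLeast1_atMost_eq)
  ultimately show ?thesis
    by (simp add: geometric_sum flip: t_def)
qed

lemma qint_nonzero:
  assumes "generic q" and "m \<noteq> 0"
  shows "qint q m \<noteq> 0"
proof -
  have "q powi m \<noteq> q powi (- m)" "q powi 1 \<noteq> q powi (- 1)"
    using generic_powi_inj[OF assms(1), of m "- m"] generic_powi_inj[OF assms(1), of 1 "- 1"] assms(2)
    by linarith+
  then show ?thesis
    by (simp add: qint_def power_int_minus)
qed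

abbreviation Kop :: "nat \<Rightarrow> complex \<Rightarrow> nat \<Rightarrow> operator" where
  "Kop N L i \<equiv> qpow L (zmode N (\<lambda>k. unitv i k - unitv (Suc i) k))"

lemma linop_zmode: "linop (zmode N h)"
  unfolding zmode_def by (rule linop_lin_ext)

lemma zmode_bvec: "zmode N h (bvec p \<alpha>) = scale (\<Sum>i=1..N. h i * of_int (lk \<alpha> i)) (bvec p \<alpha>)"
  by (simp add: zmode_def)

lemma linop_qpow: "linop (qpow L T)"
  unfolding qpow_def by (rule linop_lin_ext)

lemma qpow_bvec:
  "T (bvec p \<alpha>) = scale e (bvec p \<alpha>) \<Longrightarrow> qpow L T (bvec p \<alpha>) = scale (exp (L * e)) (bvec p \<alpha>)"
  by (simp add: qpow_def lookup_scale lookup_bvec)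

lemma Kop_bvec:
  assumes "i \<in> {1..<N}" and "exp L = q"
  shows "Kop N L i (bvec p \<alpha>) = scale (q powi (lk \<alpha> i - lk \<alpha> (Suc i))) (bvec p \<alpha>)"
proof -
  have "(\<Sum>k=1..N. (unitv i k - unitv (Suc i) k) * of_int (lk \<alpha> k))
      = (\<Sum>k=1..N. (if k = i then of_int (lk \<alpha> k) else 0) - (if k = Suc i then of_int (lk \<alpha> k) else 0))"
    by (intro sum.cong) auto
  also have "\<dots> = of_int (lk \<alpha> i - lk \<alpha> (Suc i))"
    using assms(1) by (simp add: sum_subtractf)
  finally have "Kop N L i (bvec p \<alpha>)
      = scale (exp (L * of_int (lk \<alpha> i - lk \<alpha> (Suc i)))) (bvec p \<alpha>)"
    by (intro qpow_bvec) (simp only: zmode_bvec)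
  then show ?thesis
    using assms(2) exp_power_int[of L "lk \<alpha> i - lk \<alpha> (Suc i)"] by (simp add: mult.commute)
qed

text \<open>A monomial arises under the derivative from just one monomial, the one with the factor
  restored. So \<epsilon>_i(n) v determines every coefficient of v at a monomial containing
  \<epsilon>_i(-n).\<close>

lemma heis_annihilation_lookup:
  "lk (heis i (int n) v) (p, \<alpha>)
    = of_nat n * of_nat (Suc (lk p (i, n))) * lk v (p + Poly_Mapping.single (i, n) 1, \<alpha>)"
proof -
  let ?s = "Poly_Mapping.single (i, n) 1 :: monom"
  let ?b = "(p + ?s, \<alpha>)"
  have "lk (heis i (int n) v) (p, \<alpha>) = (\<Sum>x\<in>Poly_Mapping.keys v. lk v x *
      (of_nat n * of_nat (lk (fst x) (i, n)) * (if (p, \<alpha>) = (fst x - ?s, snd x) then 1 else 0)))"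
    by (simp add: heis_def lin_ext_def case_prod_beta lookup_sum lookup_scale lookup_bvec mult.assoc)
  also have "\<dots> = (\<Sum>x\<in>Poly_Mapping.keys v.
      if x = ?b then of_nat n * of_nat (Suc (lk p (i, n))) * lk v x else 0)"
  proof (rule sum.cong[OF refl])
    fix x
    have "x = ?b" if "lk (fst x) (i, n) \<noteq> 0" "(p, \<alpha>) = (fst x - ?s, snd x)"
      using minus_add_single_same[OF that(1)] that(2) by (auto simp: prod_eq_iff)
    then show "lk v x * (of_nat n * of_nat (lk (fst x) (i, n)) * (if (p, \<alpha>) = (fst x - ?s, snd x) then 1 else 0))
      = (if x = ?b then of_nat n * of_nat (Suc (lk p (i, n))) * lk v x else 0)"
      by (cases "x = ?b") (auto simp: lookup_add)
  qed
  also have "\<dots> = of_nat n * of_nat (Suc (lk p (i, n))) * lk v ?b"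
    by (auto simp: in_keys_iff)
  finally show ?thesis .
qed

text \<open>A nonzero vector of \<open>W\<close> with least possible degree bound works: a nonzero
  image under an annihilation operator would have a smaller bound.\<close>

lemma exists_annihilated:
  assumes "w \<in> W" and "w \<noteq> 0" and "\<And>i n w. i \<in> I \<Longrightarrow> 0 < n \<Longrightarrow> w \<in> W \<Longrightarrow> heis i (int n) w \<in> W"
  obtains v where "v \<in> W" "v \<noteq> 0" "\<And>i n. i \<in> I \<Longrightarrow> 0 < n \<Longrightarrow> heis i (int n) v = 0"
proof -
  let ?P = "\<lambda>d. \<exists>v\<in>W. v \<noteq> 0 \<and> v \<in> below d"
  have "\<exists>d. ?P d"
    using assms(1,2) exists_below by blast
  then have "?P (LEAST d. ?P d)"
    by (rule LeastI_ex)
  then obtain v where v: "v \<in> W" "v \<noteq> 0" "v \<in> below (LEAST d. ?P d)"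
    by blast
  have "heis i (int n) v = 0" if "i \<in> I" "0 < n" for i n
  proof (rule ccontr)
    assume "heis i (int n) v \<noteq> 0"
    then have "?P ((LEAST d. ?P d) - n)"
      using assms(3)[OF that v(1)] heis_below[OF v(3)] by blast
    then have "(LEAST d. ?P d) \<le> (LEAST d. ?P d) - n"
      by (rule Least_le)
    \<comment> \<open>With \<open>0 < n\<close>, the inequality survives truncated subtraction only
      at 0, and \<open>below 0\<close> contains no nonzero vector.\<close>
    then have "(LEAST d. ?P d) = 0"
      using that by linarith
    then show False
      using v by (simp add: below_0)
  qed
  then show ?thesis
    using that v by blast
qed

lemma VQ_keysD:
  assumes "v \<in> VQ N" and "(p, \<alpha>) \<in> Poly_Mapping.keys v"
  shows "Poly_Mapping.keys p \<subseteq> {1..N} \<times> {1..}" and "\<alpha> \<in> Qlat N"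
  using assms unfolding VQ_def by blast+

text \<open>Phrased for a subspace stable under the operators themselves, so that it serves both the
  full algebra and the hypothesis \<open>irr\<close> of \<open>oscillators\<close>.\<close>

lemma VQ_eqI:
  assumes "generic q" and L: "exp L = q" and "cocycle N \<epsilon>"
    and W: "fock.subspace W" "W \<subseteq> VQ N" "W \<noteq> {0}"
    and heis: "\<And>i n w. i \<in> {1..N} \<Longrightarrow> n \<noteq> 0 \<Longrightarrow> w \<in> W \<Longrightarrow> heis i n w \<in> W"
    and K: "\<And>i w. i \<in> {1..<N} \<Longrightarrow> w \<in> W \<Longrightarrow> Kop N L i w \<in> W"
    and E: "\<And>i n w. i \<in> {1..<N} \<Longrightarrow> w \<in> W \<Longrightarrow> Xop q \<epsilon> i (Suc i) n w \<in> W"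
    and F: "\<And>i n w. i \<in> {1..<N} \<Longrightarrow> w \<in> W \<Longrightarrow> Xop q \<epsilon> (Suc i) i n w \<in> W"
  shows "W = VQ N"
proof -
  obtain w where "w \<in> W" "w \<noteq> 0"
    using W(1,3) fock.subspace_0 by blast
  then obtain v where v: "v \<in> W" "v \<noteq> 0" "\<And>i n. i \<in> {1..N} \<Longrightarrow> 0 < n \<Longrightarrow> heis i (int n) v = 0"
    by (rule exists_annihilated[where I = "{1..N}"]) (use heis in auto)
  have "p = 0 \<and> \<alpha> \<in> Qlat N" if "(p, \<alpha>) \<in> Poly_Mapping.keys v" for p \<alpha>
  proof
    have p: "Poly_Mapping.keys p \<subseteq> {1..N} \<times> {1..}" and "\<alpha> \<in> Qlat N"
      using VQ_keysD[OF _ that] v(1) W(2) by blast+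
    then show "\<alpha> \<in> Qlat N"
      by simp
    have "x \<notin> Poly_Mapping.keys p" for x
    proof
      assume x: "x \<in> Poly_Mapping.keys p"
      obtain i n where x_eq: "x = (i, n)"
        by (cases x)
      have "(i, n) \<in> {1..N} \<times> {1..}"
        using subsetD[OF p x] by (simp only: x_eq)
      then have "i \<in> {1..N}" "0 < n" "lk p (i, n) \<noteq> 0"
        using x by (auto simp: in_keys_iff x_eq)
      \<comment> \<open>Remove one factor from \<open>p\<close> and read off that coefficient of
        \<epsilon>_i(n) v: it is a nonzero multiple of the coefficient of v at
        \<open>p\<close>.\<close>
      then show False
        using v(3)[of i n] heis_annihilation_lookup[of i n v "p - Poly_Mapping.single (i, n) 1" \<alpha>] that
          minus_add_single_same[of p "(i, n)"]
        by (auto simp: in_keys_iff simp del: of_nat_Suc)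
    qed
    then show "p = 0"
      by (intro poly_mapping_eqI) (auto simp: in_keys_iff)
  qed
  then have keys: "fst b = 0" "snd b \<in> Qlat N" if "b \<in> Poly_Mapping.keys v" for b
    using that by (metis prod.collapse)+
  obtain \<alpha> where \<alpha>: "bvec 0 \<alpha> \<in> W" "\<alpha> \<in> Qlat N"
  proof -
    obtain b where b: "b \<in> Poly_Mapping.keys v"
      using v(2) by (metis ex_in_conv keys_eq_empty)
    let ?u = "\<lambda>b. scale (lk v b) (bvec (fst b) (snd b))"
    \<comment> \<open>The terms of \<open>v\<close> are joint eigenvectors of the k_{i0}. By
      genericity and \<open>Qlat_eqI\<close> their eigenvalue systems differ, so each term lies in
      \<open>W\<close>.\<close>
    have "?u b \<in> W"
    proof (rule eigen_components[where I = "Poly_Mapping.keys v" and X = "{1..<N}" and T = "Kop N L"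
          and u = ?u and e = "\<lambda>b i. q powi (lk (snd b) i - lk (snd b) (Suc i))"])
      show "(\<Sum>b\<in>Poly_Mapping.keys v. ?u b) \<in> W"
        using v(1) lin_ext_bvec_id[of v] by (simp add: lin_ext_def case_prod_beta)
      show "Kop N L i (?u b) = scale (q powi (lk (snd b) i - lk (snd b) (Suc i))) (?u b)"
        if "i \<in> {1..<N}" for b i
        using Kop_bvec[OF that L] by (simp add: linop_scale[OF linop_qpow] mult.commute)
      show "\<exists>i\<in>{1..<N}. q powi (lk (snd b) i - lk (snd b) (Suc i))
          \<noteq> q powi (lk (snd b') i - lk (snd b') (Suc i))"
        if "b \<in> Poly_Mapping.keys v" "b' \<in> Poly_Mapping.keys v" "b \<noteq> b'" for b b'
      proof (rule ccontr)
        assume "\<not> ?thesis"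
        then have "\<And>i. i \<in> {1..<N} \<Longrightarrow> lk (snd b) i - lk (snd b) (Suc i) = lk (snd b') i - lk (snd b') (Suc i)"
          using generic_powi_inj[OF assms(1)] by blast
        then have "snd b = snd b'"
          by (rule Qlat_eqI[OF keys(2)[OF that(1)] keys(2)[OF that(2)]])
        then show False
          using keys(1)[OF that(1)] keys(1)[OF that(2)] that(3) by (simp add: prod_eq_iff)
      qed
    qed (use W(1) K b in \<open>auto intro: linop_qpow\<close>)
    then have "scale (inverse (lk v b)) (?u b) \<in> W"
      by (rule fock.subspace_scale[OF W(1)])
    then have "bvec 0 (snd b) \<in> W"
      using b keys(1)[OF b] by (simp add: in_keys_iff)
    then show ?thesis
      using that keys(2)[OF b] by blast
  qed
  have X: "bvec 0 (\<gamma> + (eps i - eps j)) \<in> W"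
    if "bvec 0 \<gamma> \<in> W" "eps i - eps j \<in> Qlat N" "\<And>n w. w \<in> W \<Longrightarrow> Xop q \<epsilon> i j n w \<in> W" for \<gamma> i j
  proof -
    have "\<gamma> \<in> Qlat N"
      using that(1) W(2) by (auto simp: bvec_VQ)
    then have "\<epsilon> (eps i - eps j) \<gamma> \<noteq> 0"
      using that(2) assms(3) unfolding cocycle_def by force
    moreover have "scale (inverse (\<epsilon> (eps i - eps j) \<gamma>))
        (Xop q \<epsilon> i j (lk \<gamma> j - lk \<gamma> i - 1) (bvec 0 \<gamma>)) \<in> W"
      by (rule fock.subspace_scale[OF W(1) that(3)[OF that(1)]])
    ultimately show ?thesis
      by (simp add: Xop_vacuum)
  qed
  have vac: "bvec 0 \<beta> \<in> W" if "\<beta> \<in> Qlat N" for \<beta>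
  proof -
    have "\<alpha> + (\<beta> - \<alpha>) \<in> {\<gamma>. bvec 0 \<gamma> \<in> W}"
    proof (rule Qlat_translate)
      show "\<gamma> + root i \<in> {\<gamma>. bvec 0 \<gamma> \<in> W}" if "\<gamma> \<in> {\<gamma>. bvec 0 \<gamma> \<in> W}" "i \<in> {1..<N}" for \<gamma> i
        using X[OF _ Qlat_root E] that by simp
      show "\<gamma> - root i \<in> {\<gamma>. bvec 0 \<gamma> \<in> W}" if "\<gamma> \<in> {\<gamma>. bvec 0 \<gamma> \<in> W}" "i \<in> {1..<N}" for \<gamma> i
        using X[OF _ Qlat_neg_root F, of \<gamma> i] that by (simp add: algebra_simps)
    qed (use \<alpha> that Qlat_diff in auto)
    then show ?thesis
      by simp
  qed
  have all: "bvec p \<beta> \<in> W" if "Poly_Mapping.keys p \<subseteq> {1..N} \<times> {1..}" "\<beta> \<in> Qlat N" for p \<beta>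
    using that
  proof (induction "deg p" arbitrary: p rule: less_induct)
    case less
    show ?case
    proof (cases "p = 0")
      case True
      then show ?thesis
        using vac less.prems by simp
    next
      case False
      then obtain i n where x: "(i, n) \<in> Poly_Mapping.keys p"
        by (metis ex_in_conv keys_eq_empty surj_pair)
      let ?p = "p - Poly_Mapping.single (i, n) 1"
      have "(i, n) \<in> {1..N} \<times> {1..}"
        using subsetD[OF less.prems(1) x] .
      then have p: "lk p (i, n) \<noteq> 0" and i: "i \<in> {1..N}" and n: "0 < n"
        using x by (auto simp: in_keys_iff)
      have "bvec ?p \<beta> \<in> W"
        using deg_minus_single[OF p] n keys_minus_single[of p "(i, n)"] less.prems
        by (intro less.hyps) auto
      then have "heis i (- int n) (bvec ?p \<beta>) \<in> W"
        using i n by (intro heis) auto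
      then show ?thesis
        using minus_add_single_same[OF p] n by (simp add: heis_creation)
    qed
  qed
  have "VQ N \<subseteq> W"
  proof
    fix u assume u: "u \<in> VQ N"
    show "u \<in> W"
      by (rule linop_in_subspace[OF linop_id W(1)], rule all) (use VQ_keysD[OF u] in blast)+
  qed
  then show ?thesis
    using W(2) by blast
qed


section \<open>Weights\<close>

lemma lin_ext_diag_eq_scale_iff:
  "lin_ext (\<lambda>p \<alpha>. scale (e (p, \<alpha>)) (bvec p \<alpha>)) v = scale k v \<longleftrightarrow> (\<forall>b\<in>Poly_Mapping.keys v. e b = k)"
  by (auto simp: poly_mapping_eq_iff fun_eq_iff lin_ext_diag_lookup lookup_scale in_keys_iff)

lemma finite_support_nat:
  assumes "\<And>n. d \<le> n \<Longrightarrow> g n = 0"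
  shows "finite {n :: nat. g n \<noteq> 0}"
proof (rule finite_subset)
  show "{n. g n \<noteq> 0} \<subseteq> {..<d}"
    using assms not_le by blast
qed simp

text \<open>Infinite sums are additive only for finite supports, which the degree filtration
  provides for every vector.\<close>

lemma linop_Dop: "linop (Dop N)"
proof -
  have fin: "finite {n. (if 1 \<le> n then heis i (- int n) (heis i (int n) v) else 0) \<noteq> 0}" for i v
  proof -
    obtain d where "v \<in> below d"
      using exists_below by blast
    then have "heis i (int n) v = 0" if "d \<le> n" for n
      using heis_below[of v d i n] that by (simp add: below_0)
    then have "(if 1 \<le> n then heis i (- int n) (heis i (int n) v) else 0) = 0" if "d \<le> n" for n
      using that by (simp add: linop_0[OF linop_heis])
    then show ?thesis
      by (rule finite_support_nat)
  qed
  have lin: "linop (\<lambda>v. if 1 \<le> n then heis i (- int n) (heis i (int n) v) else 0)" for i n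
    using linop_heis_comp[OF linop_heis] by (cases "1 \<le> n") (simp_all add: linop_zero)
  show ?thesis
    unfolding Dop_def[abs_def]
    by (intro linop_minus linop_scaled linop_sums linop_comp[OF linop_zmode linop_zmode]
        linop_Sum_any lin fin)
qed

text \<open>The eigenvalue of D on a basis vector of V_Q. It is an integer because the norm is even
  on Q.\<close>

definition level :: "nat \<Rightarrow> basis \<Rightarrow> int" where
  "level N b = - (form N (snd b) (snd b) div 2) - int (deg (fst b))"

lemma Dop_bvec:
  assumes "Poly_Mapping.keys p \<subseteq> {1..N} \<times> {1..}" and "\<alpha> \<in> Qlat N"
  shows "Dop N (bvec p \<alpha>) = scale (of_int (level N (p, \<alpha>))) (bvec p \<alpha>)"
proof -
  let ?b = "bvec p \<alpha>"
  have "zmode N (unitv i) ?b = scale (of_int (lk \<alpha> i)) ?b" if "i \<in> {1..N}" for i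
    using that by (simp add: zmode_bvec if_distrib[of "\<lambda>x. x * _"] cong: if_cong)
  then have "(\<Sum>i=1..N. zmode N (unitv i) (zmode N (unitv i) ?b))
      = (\<Sum>i=1..N. scale (of_int (lk \<alpha> i * lk \<alpha> i)) ?b)"
    by (intro sum.cong) (auto simp: linop_scale[OF linop_zmode])
  also have "\<dots> = scale (of_int (form N \<alpha> \<alpha>)) ?b"
    by (simp add: form_def fock.scale_sum_left)
  finally have z: "scale (- 1 / 2) (\<Sum>i=1..N. zmode N (unitv i) (zmode N (unitv i) ?b))
      = scale (of_int (- (form N \<alpha> \<alpha> div 2))) ?b"
    using form_even[OF assms(2)] by (auto elim!: evenE)
  obtain d where d: "snd ` Poly_Mapping.keys p \<subseteq> {..<d}"
    using finite_nat_set_iff_bounded[of "snd ` Poly_Mapping.keys p"] by (auto simp: subset_eq)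
  \<comment> \<open>Lowering and then raising multiplies the monomial by n times its exponent;
    summed over all variables this is the degree.\<close>
  have num: "heis i (- int n) (heis i (int n) ?b) = scale (of_nat (n * lk p (i, n))) ?b" if "1 \<le> n" for i n
    using that minus_add_single_same[of p "(i, n)"]
    by (cases "lk p (i, n) = 0")
      (auto simp: heis_annihilation heis_creation linop_scale[OF linop_heis] linop_0[OF linop_heis])
  have "Sum_any (\<lambda>n. if 1 \<le> n then heis i (- int n) (heis i (int n) ?b) else 0)
      = (\<Sum>n\<in>{1..<d}. scale (of_nat (n * lk p (i, n))) ?b)" for i
  proof -
    have "Sum_any (\<lambda>n. if 1 \<le> n then heis i (- int n) (heis i (int n) ?b) else 0)
        = (\<Sum>n\<in>{1..<d}. if 1 \<le> n then heis i (- int n) (heis i (int n) ?b) else 0)"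
    proof (rule Sum_any.expand_superset)
      show "{n. (if 1 \<le> n then heis i (- int n) (heis i (int n) ?b) else 0) \<noteq> 0} \<subseteq> {1..<d}"
      proof
        fix n assume "n \<in> {n. (if 1 \<le> n then heis i (- int n) (heis i (int n) ?b) else 0) \<noteq> 0}"
        then have "1 \<le> n" "heis i (- int n) (heis i (int n) ?b) \<noteq> 0"
          by (simp_all split: if_splits)
        then have "(i, n) \<in> Poly_Mapping.keys p"
          using num[of n i] by (auto simp: in_keys_iff)
        then have "n < d"
          using d by force
        then show "n \<in> {1..<d}"
          using \<open>1 \<le> n\<close> by simp
      qed
    qed simp
    also have "\<dots> = (\<Sum>n\<in>{1..<d}. scale (of_nat (n * lk p (i, n))) ?b)"
      using num by (intro sum.cong) auto
    finally show ?thesis .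
  qed
  then have "(\<Sum>i=1..N. Sum_any (\<lambda>n. if 1 \<le> n then heis i (- int n) (heis i (int n) ?b) else 0))
      = scale (of_nat (\<Sum>i=1..N. \<Sum>n\<in>{1..<d}. n * lk p (i, n))) ?b"
    by (simp only: fock.scale_sum_left of_nat_sum)
  also have "(\<Sum>i=1..N. \<Sum>n\<in>{1..<d}. n * lk p (i, n)) = deg p"
  proof -
    have "Poly_Mapping.keys p \<subseteq> {1..N} \<times> {1..<d}"
    proof
      fix x assume x: "x \<in> Poly_Mapping.keys p"
      then have "x \<in> {1..N} \<times> {1..}" "snd x < d"
        using assms(1) d by blast+
      then show "x \<in> {1..N} \<times> {1..<d}"
        by (cases x) auto
    qed
    then show ?thesis
      by (simp add: deg_superset[of "{1..N} \<times> {1..<d}"] sum.cartesian_product case_prod_beta)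
  qed
  finally show ?thesis
    unfolding Dop_def z by (simp add: level_def fock.scale_left_diff_distrib)
qed

definition wt :: "nat \<Rightarrow> basis \<Rightarrow> cart \<Rightarrow> complex" where
  "wt N b x = omega0 x + lat_wt N (snd b) x + of_int (level N b) * tau x"

lemma linop_cart_act: "linop (cart_act N x)"
  unfolding cart_act_def case_prod_beta
  by (intro linop_plus linop_scaled linop_zmode linop_Dop linop_id)

lemma cart_act_bvec:
  assumes "Poly_Mapping.keys p \<subseteq> {1..N} \<times> {1..}" and "\<alpha> \<in> Qlat N"
  shows "cart_act N x (bvec p \<alpha>) = scale (wt N (p, \<alpha>) x) (bvec p \<alpha>)"
  by (simp add: cart_act_def case_prod_beta zmode_bvec Dop_bvec[OF assms] wt_def omega0_def lat_wt_def
      tau_def fock.scale_left_distrib mult.commute add_ac)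

text \<open>The Cartan subalgebra is diagonal in the monomial basis of \<open>VQ N\<close>, so both
  kinds of weight spaces become conditions on the keys of \<open>v\<close>.\<close>

lemma cart_act_eigen_iff:
  assumes "v \<in> VQ N"
  shows "cart_act N x v = scale k v \<longleftrightarrow> (\<forall>b\<in>Poly_Mapping.keys v. wt N b x = k)"
    and "qpow L (cart_act N x) v = scale k v \<longleftrightarrow> (\<forall>b\<in>Poly_Mapping.keys v. exp (L * wt N b x) = k)"
proof -
  have keys: "Poly_Mapping.keys p \<subseteq> {1..N} \<times> {1..}" "\<alpha> \<in> Qlat N"
    if "(p, \<alpha>) \<in> Poly_Mapping.keys v" for p \<alpha>
    using VQ_keysD[OF assms that] by auto
  have "cart_act N x v = lin_ext (\<lambda>p \<alpha>. scale (wt N (p, \<alpha>) x) (bvec p \<alpha>)) v"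
    by (rule linop_eq_on_keys[OF linop_cart_act linop_lin_ext]) (simp add: cart_act_bvec[OF keys])
  then show "cart_act N x v = scale k v \<longleftrightarrow> (\<forall>b\<in>Poly_Mapping.keys v. wt N b x = k)"
    using lin_ext_diag_eq_scale_iff[of "\<lambda>b. wt N b x"] by simp
  have "qpow L (cart_act N x) v = lin_ext (\<lambda>p \<alpha>. scale (exp (L * wt N (p, \<alpha>) x)) (bvec p \<alpha>)) v"
    by (rule linop_eq_on_keys[OF linop_qpow linop_lin_ext]) (simp only: lin_ext_bvec, intro qpow_bvec cart_act_bvec keys)
  then show "qpow L (cart_act N x) v = scale k v \<longleftrightarrow> (\<forall>b\<in>Poly_Mapping.keys v. exp (L * wt N b x) = k)"
    using lin_ext_diag_eq_scale_iff[of "\<lambda>b. exp (L * wt N b x)"] by simp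
qed

lemma wt_in_wts:
  assumes "snd b \<in> Qlat N"
  shows "wt N b \<in> wts N"
proof -
  have "level N b \<le> 0"
    using form_nonneg[of N "snd b"] by (simp add: level_def)
  then show ?thesis
    using assms unfolding wts_def wt_def[abs_def] by blast
qed

text \<open>Evaluation at D determines n, and evaluation at the simple coroots determines the
  neighbour differences of the lattice part.\<close>

lemma wts_eqI:
  assumes "\<mu> \<in> wts N" and "\<nu> \<in> wts N" and eq: "\<And>x. x \<in> cartan_alg N \<Longrightarrow> \<mu> x = \<nu> x"
  shows "\<mu> = \<nu>"
proof -
  obtain \<alpha> m where \<alpha>: "\<alpha> \<in> Qlat N" "\<mu> = (\<lambda>x. omega0 x + lat_wt N \<alpha> x + of_int m * tau x)"
    using assms(1) unfolding wts_def by blast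
  obtain \<beta> n where \<beta>: "\<beta> \<in> Qlat N" "\<nu> = (\<lambda>x. omega0 x + lat_wt N \<beta> x + of_int n * tau x)"
    using assms(2) unfolding wts_def by blast
  have "(\<lambda>k. 0, 0, 1) \<in> cartan_alg N"
    unfolding cartan_alg_def by (auto intro!: exI[of _ "\<lambda>_. 0"])
  from eq[OF this] have "m = n"
    by (simp add: \<alpha> \<beta> omega0_def lat_wt_def tau_def)
  moreover have "\<alpha> = \<beta>"
  proof (rule Qlat_eqI[OF \<alpha>(1) \<beta>(1)])
    fix i assume i: "i \<in> {1..<N}"
    let ?h = "\<lambda>k. unitv i k - unitv (Suc i) k"
    have "?h = (\<lambda>k. \<Sum>j=1..<N. (if j = i then 1 else 0) * (unitv j k - unitv (Suc j) k))"
      using i by (simp add: if_distrib[of "\<lambda>x. x * _"] cong: if_cong)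
    then have "(?h, 0, 0) \<in> cartan_alg N"
      unfolding cartan_alg_def
      by (intro SigmaI CollectI exI[of _ "\<lambda>j. if j = i then 1 else 0"] conjI TrueI UNIV_I)
    from eq[OF this] have *: "lat_wt N \<alpha> (?h, 0, 0) = lat_wt N \<beta> (?h, 0, 0)"
      by (simp add: \<alpha> \<beta> omega0_def tau_def)
    have "lat_wt N \<gamma> (?h, 0, 0) = of_int (lk \<gamma> i - lk \<gamma> (Suc i))" for \<gamma>
      using i by (simp add: lat_wt_def right_diff_distrib sum_subtractf if_distrib[of "\<lambda>x. _ * x"] cong: if_cong)
    then show "lk \<alpha> i - lk \<alpha> (Suc i) = lk \<beta> i - lk \<beta> (Suc i)"
      using * by (simp only: of_int_eq_iff)
  qed
  ultimately show ?thesis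
    by (simp add: \<alpha> \<beta>)
qed

lemma direct_sum_wt_space: "direct_sum (VQ N) (wts N) (wt_space N)"
proof (rule direct_sum_eigen[where X = "cartan_alg N" and T = "cart_act N" and e = "\<lambda>\<mu> x. \<mu> x"])
  show "fock.subspace (wt_space N \<mu>)" for \<mu>
    using subspace_VQ[of N] unfolding fock.subspace_def wt_space_def
    by (auto simp: linop_0[OF linop_cart_act] linop_add[OF linop_cart_act]
        linop_scale[OF linop_cart_act] fock.scale_right_distrib mult.commute)
  show "VQ N \<subseteq> fock.span (\<Union>\<mu>\<in>wts N. wt_space N \<mu>)"
  proof
    fix v assume v: "v \<in> VQ N"
    show "v \<in> fock.span (\<Union>\<mu>\<in>wts N. wt_space N \<mu>)"
    proof (rule linop_in_subspace[OF linop_id fock.subspace_span])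
      fix p \<alpha> assume "(p, \<alpha>) \<in> Poly_Mapping.keys v"
      then have "Poly_Mapping.keys p \<subseteq> {1..N} \<times> {1..}" "\<alpha> \<in> Qlat N"
        using VQ_keysD[OF v] by blast+
      then have "bvec p \<alpha> \<in> wt_space N (wt N (p, \<alpha>))" "wt N (p, \<alpha>) \<in> wts N"
        by (simp_all add: wt_space_def cart_act_bvec bvec_VQ wt_in_wts)
      then show "bvec p \<alpha> \<in> fock.span (\<Union>\<mu>\<in>wts N. wt_space N \<mu>)"
        by (blast intro: fock.span_base)
    qed
  qed
  show "\<exists>x\<in>cartan_alg N. \<mu> x \<noteq> \<nu> x" if "\<mu> \<in> wts N" "\<nu> \<in> wts N" "\<mu> \<noteq> \<nu>" for \<mu> \<nu>
    using wts_eqI that by blast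
qed (auto simp: wt_space_def linop_cart_act)

lemma q_wt_space_eq:
  assumes "L \<noteq> 0" and "\<mu> \<in> wts N"
  shows "q_wt_space N L \<mu> = wt_space N \<mu>"
proof -
  let ?t = "\<lambda>t (h, c, d). (\<lambda>k. t * h k, t * c, t * d)"
  have hom: "\<nu> (?t t x) = t * \<nu> x" if "\<nu> \<in> wts N" for \<nu> t x
    using that by (cases x) (auto simp: wts_def omega0_def lat_wt_def tau_def algebra_simps sum_distrib_left)
  have closed: "?t t x \<in> cartan_alg N" if "x \<in> cartan_alg N" for t x
  proof -
    obtain h c d where hcd: "x = (h, c, d)"
      by (cases x)
    have "h \<in> {\<lambda>k. \<Sum>i=1..<N. a i * (unitv i k - unitv (Suc i) k) | a. True}"
      using \<open>x \<in> cartan_alg N\<close> unfolding cartan_alg_def hcd by (rule SigmaD1)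
    then obtain a where a: "h = (\<lambda>k. \<Sum>i=1..<N. a i * (unitv i k - unitv (Suc i) k))"
      by blast
    have "(\<lambda>k. t * (\<Sum>i=1..<N. a i * (unitv i k - unitv (Suc i) k)))
        = (\<lambda>k. \<Sum>i=1..<N. (t * a i) * (unitv i k - unitv (Suc i) k))"
      by (simp add: sum_distrib_left mult.assoc)
    then show ?thesis
      unfolding hcd a cartan_alg_def prod.case
      by (intro SigmaI CollectI exI[of _ "\<lambda>i. t * a i"] conjI TrueI UNIV_I)
  qed
  text \<open>The Cartan algebra is closed under scaling, so the equality of exponentials holds along a
    whole complex line.\<close>
  have exp_inj: "\<nu> x = \<mu> x"
    if "\<nu> \<in> wts N" "\<And>x. x \<in> cartan_alg N \<Longrightarrow> exp (L * \<nu> x) = exp (L * \<mu> x)" "x \<in> cartan_alg N" for \<nu> x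
  proof (rule ccontr)
    assume "\<nu> x \<noteq> \<mu> x"
    \<comment> \<open>The scale at which the two exponents differ by exactly 1, and
      \<open>exp 1\<close> is not 1; here \<open>L\<close> must be nonzero.\<close>
    define t where "t = 1 / (L * (\<nu> x - \<mu> x))"
    have "exp (L * (t * \<nu> x)) = exp (L * (t * \<mu> x))"
      using that(2)[OF closed[OF that(3), of t]] hom[OF that(1)] hom[OF assms(2)] by simp
    then have "exp (L * (t * \<nu> x) - L * (t * \<mu> x)) = 1"
      by (simp add: exp_diff)
    moreover have "L * (t * \<nu> x) - L * (t * \<mu> x) = t * (L * (\<nu> x - \<mu> x))"
      by (simp add: algebra_simps)
    moreover have "t * (L * (\<nu> x - \<mu> x)) = 1"
      using assms(1) \<open>\<nu> x \<noteq> \<mu> x\<close> by (simp add: t_def)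
    ultimately have "exp (1 :: complex) = 1"
      by simp
    then have "exp (1 :: real) = 1"
      by (metis exp_of_real of_real_1 of_real_eq_1_iff)
    then show False
      by simp
  qed
  have "wt N b \<in> wts N" if "v \<in> VQ N" "b \<in> Poly_Mapping.keys v" for v b
    using that VQ_keysD(2)[of v N "fst b" "snd b"] by (intro wt_in_wts) simp
  then show ?thesis
    using exp_inj unfolding q_wt_space_def wt_space_def
    by (auto simp: cart_act_eigen_iff)
qed

section \<open>The action of the generators\<close>

lemma subspace_scale_iff:
  assumes "fock.subspace W" and "c \<noteq> 0"
  shows "scale c w \<in> W \<longleftrightarrow> w \<in> W"
proof
  assume "scale c w \<in> W"
  then have "scale (inverse c) (scale c w) \<in> W"
    by (rule fock.subspace_scale[OF assms(1)])
  then show "w \<in> W"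
    using assms(2) by simp
qed (rule fock.subspace_scale[OF assms(1)])

text \<open>Modulo \<open>W\<close> the h's give x_{j+1} = q^m x_j for x_j = \<epsilon>_j(n) w and m
  = |n|, so z_n w becomes a multiple of x_1 with nonzero factor. Hence x_1 is in \<open>W\<close>,
  and then every x_i.\<close>

lemma heis_from_h_zop:
  assumes "generic q" and r: "r ^ 2 = q" and "n \<noteq> 0" and W: "fock.subspace W"
    and h: "\<And>i. i \<in> {1..<N} \<Longrightarrow>
      scale (r powi \<bar>n\<bar>) (heis i n w) - scale (r powi (- \<bar>n\<bar>)) (heis (Suc i) n w) \<in> W"
    and z: "zop q N n w \<in> W" and "i \<in> {1..N}"
  shows "heis i n w \<in> W"
proof -
  define m where "m = nat \<bar>n\<bar>"
  define x where "x i = heis i n w" for i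
  have m: "0 < m" "\<bar>n\<bar> = int m"
    using assms(3) by (auto simp: m_def)
  have q0: "q \<noteq> 0"
    using assms(1) by (simp add: generic_def)
  then have r0: "r \<noteq> 0"
    using r by auto
  have rm: "r ^ m * r ^ m = q ^ m"
    by (simp add: r[symmetric] power2_eq_square power_mult_distrib)
  have step: "x (Suc j) - scale (q ^ m) (x j) \<in> W" if "j \<in> {1..<N}" for j
  proof -
    \<comment> \<open>The factor is chosen to normalise the coefficient of \<open>x (Suc j)\<close>;
      that of \<open>x j\<close> becomes -r^(2m) = -q^m.\<close>
    have "scale (- (r ^ m)) (scale (r ^ m) (x j) - scale (inverse (r ^ m)) (x (Suc j))) \<in> W"
      using h[OF that] by (intro fock.subspace_scale[OF W]) (simp add: m power_int_minus x_def)
    then show ?thesis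
      using r0 rm by (simp add: fock.scale_right_diff_distrib)
  qed
  have cong: "x (Suc j) - scale (q ^ (j * m)) (x 1) \<in> W" if "j < N" for j
    using that
  proof (induction j)
    case 0
    show ?case
      using fock.subspace_0[OF W] by simp
  next
    case (Suc j)
    have "x (Suc (Suc j)) - scale (q ^ m) (x (Suc j))
        + scale (q ^ m) (x (Suc j) - scale (q ^ (j * m)) (x 1)) \<in> W"
      using Suc by (intro fock.subspace_add[OF W] fock.subspace_scale[OF W] step) auto
    then show ?case
      by (simp add: fock.scale_right_diff_distrib power_add)
  qed
  have cong': "x j - scale (q ^ ((j - 1) * m)) (x 1) \<in> W" if "j \<in> {1..N}" for j
    using cong[of "j - 1"] that by (cases j) auto
  \<comment> \<open>Replacing each \<open>x j\<close> by its multiple of \<open>x 1\<close> leaves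
    q^(-m) times the geometric sum that also gives the central terms.\<close>
  have "zop q N n w - (\<Sum>j=1..N. scale (q ^ (j * m)) (x j - scale (q ^ ((j - 1) * m)) (x 1))) \<in> W"
    by (intro fock.subspace_diff[OF W z] fock.subspace_sum[OF W] fock.subspace_scale[OF W] cong')
  also have "zop q N n w - (\<Sum>j=1..N. scale (q ^ (j * m)) (x j - scale (q ^ ((j - 1) * m)) (x 1)))
      = (\<Sum>j=1..N. scale (q ^ (j * m) * q ^ ((j - 1) * m)) (x 1))"
    by (simp add: zop_def x_def m_def fock.scale_right_diff_distrib sum_subtractf)
  also have "\<dots> = scale (\<Sum>j=1..N. q ^ (j * m) * q ^ ((j - 1) * m)) (x 1)"
    by (simp add: fock.scale_sum_left)
  also have "(\<Sum>j=1..N. q ^ (j * m) * q ^ ((j - 1) * m)) = inverse (q ^ m) * (\<Sum>j=1..N. (q ^ (2 * m)) ^ j)"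
    unfolding sum_distrib_left
  proof (rule sum.cong[OF refl])
    fix j assume j: "j \<in> {1..N}"
    have "q ^ m * (q ^ (j * m) * q ^ ((j - 1) * m)) = q ^ (m + (j * m + (j - 1) * m))"
      by (simp only: power_add)
    also have "m + (j * m + (j - 1) * m) = 2 * m * j"
      using j by (cases j) (auto simp: algebra_simps)
    finally have "q ^ m * (q ^ (j * m) * q ^ ((j - 1) * m)) = (q ^ (2 * m)) ^ j"
      by (simp only: power_mult)
    then show "q ^ (j * m) * q ^ ((j - 1) * m) = inverse (q ^ m) * (q ^ (2 * m)) ^ j"
      using q0 by (metis mult.assoc mult_1 left_inverse power_not_zero)
  qed
  finally have "scale (inverse (q ^ m) * (\<Sum>j=1..N. (q ^ (2 * m)) ^ j)) (x 1) \<in> W" (is "scale ?s _ \<in> _") .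
  moreover have "?s \<noteq> 0"
    using generic_geometric_sum[OF assms(1) m(1), of N] assms(7) q0 by simp
  ultimately have x1: "x 1 \<in> W"
    using subspace_scale_iff[OF W] by blast
  have "x i - scale (q ^ ((i - 1) * m)) (x 1) + scale (q ^ ((i - 1) * m)) (x 1) \<in> W"
    by (intro fock.subspace_add[OF W] fock.subspace_scale[OF W] cong' x1 assms(7))
  then show ?thesis
    by (simp add: x_def)
qed

lemma Xop_VQ:
  assumes "i \<in> {1..N}" and "j \<in> {1..N}" and "eps i - eps j \<in> Qlat N" and "v \<in> VQ N"
  shows "Xop q \<epsilon> i j n v \<in> VQ N"
proof (rule linop_VQ[OF linop_Xop _ assms(4)])
  fix p :: monom and \<alpha> assume p: "Poly_Mapping.keys p \<subseteq> {1..N} \<times> {1..}" "\<alpha> \<in> Qlat N"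
  have "bvec p (\<alpha> + (eps i - eps j)) \<in> VQ N"
    unfolding bvec_VQ using p Qlat_add[OF p(2) assms(3)] by blast
  then show "Xop q \<epsilon> i j n (bvec p \<alpha>) \<in> VQ N"
    unfolding Xop_bvec Xat_def shift_bvec
    by (intro fock.subspace_scale[OF subspace_VQ] Sum_any_in_subspace[OF subspace_VQ])
      (auto intro: EmEp_VQ[OF assms(1,2)] fock.subspace_0[OF subspace_VQ])
qed

lemma qpow_VQ:
  assumes "\<And>p \<alpha>. Poly_Mapping.keys p \<subseteq> {1..N} \<times> {1..} \<Longrightarrow> \<alpha> \<in> Qlat N \<Longrightarrow>
      T (bvec p \<alpha>) = scale (e p \<alpha>) (bvec p \<alpha>)"
    and "v \<in> VQ N"
  shows "qpow L T v \<in> VQ N"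
proof (rule linop_VQ[OF linop_qpow _ assms(2)])
  fix p :: monom and \<alpha> assume p: "Poly_Mapping.keys p \<subseteq> {1..N} \<times> {1..}" "\<alpha> \<in> Qlat N"
  have "bvec p \<alpha> \<in> VQ N"
    unfolding bvec_VQ using p by blast
  then show "qpow L T (bvec p \<alpha>) \<in> VQ N"
    unfolding qpow_bvec[where T = T, OF assms(1)[OF p]] by (rule fock.subspace_scale[OF subspace_VQ])
qed

lemma qpow_zmode_bvec:
  "qpow L (zmode N h) (bvec p \<alpha>) = scale (exp (L * (\<Sum>i=1..N. h i * of_int (lk \<alpha> i)))) (bvec p \<alpha>)"
  by (rule qpow_bvec) (rule zmode_bvec)

lemma zop_qpow_zmode: "zop q N m (qpow L (zmode N h) v) = qpow L (zmode N h) (zop q N m v)"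
  by (rule lattice_diagonal_commute[symmetric, OF linop_qpow linop_zop _ zop_bvec_supp_lat,
        where e = "\<lambda>\<alpha>. exp (L * (\<Sum>i=1..N. h i * of_int (lk \<alpha> i)))"])
    (rule qpow_zmode_bvec)

lemma linop_act: "linop (act N q r L \<epsilon> g)"
proof (cases g)
  case (Eps i m)
  then show ?thesis
    by (simp add: linop_scaled linop_heis)
qed (simp_all add: linop_qpow linop_Xop linop_scaled[OF linop_id])

lemma act_VQ:
  assumes "g \<in> acting_gens N" and "v \<in> VQ N"
  shows "act N q r L \<epsilon> g v \<in> VQ N"
proof (cases g)
  case (Eps i m)
  then show ?thesis
    using assms by (auto simp: acting_gens_def uq_gens_def
        intro!: fock.subspace_scale[OF subspace_VQ] heis_VQ)
next
  case (XP j n)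
  then have "j \<in> {1..<N}"
    using assms by (auto simp: acting_gens_def uq_gens_def)
  then show ?thesis
    using XP Xop_VQ[of j N "Suc j"] Qlat_root assms(2) by simp
next
  case (XM j n)
  then have "j \<in> {1..<N}"
    using assms by (auto simp: acting_gens_def uq_gens_def)
  then show ?thesis
    using XM Xop_VQ[of "Suc j" N j] Qlat_neg_root assms(2) by simp
next
  case QD
  then show ?thesis
    using qpow_VQ[OF Dop_bvec assms(2)] by simp
qed (use assms(2) in \<open>auto intro: fock.subspace_scale[OF subspace_VQ] qpow_VQ[OF zmode_bvec]\<close>)

lemma h_op_act: "h_op r (act N q r L \<epsilon>) i m w = scale (qint q m / of_int m)
  (scale (r powi \<bar>m\<bar>) (heis i m w) - scale (r powi (- \<bar>m\<bar>)) (heis (Suc i) m w))"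
  by (simp add: h_op_def fock.scale_right_diff_distrib mult.commute)

text \<open>For opposite modes the two central contributions are proportional to r^|m| q^(i|m|) and
  -r^(-|m|) q^((i+1)|m|), which cancel since r^2 = q.\<close>

lemma zop_h_op:
  assumes r: "r ^ 2 = q" "q \<noteq> 0" and i: "i \<in> {1..<N}" and "m \<noteq> 0" and "n \<noteq> 0"
  shows "zop q N n (h_op r (act N q r L \<epsilon>) i m v) = h_op r (act N q r L \<epsilon>) i m (zop q N n v)"
proof -
  have r0: "r \<noteq> 0"
    using r by auto
  have "r powi (- \<bar>n\<bar>) * q ^ nat \<bar>n\<bar> = r powi \<bar>n\<bar>"
    using r0 by (simp add: r(1)[symmetric] power_int_def power2_eq_square power_mult_distrib field_simps)
  moreover define y :: complex where "y = (if n = - m then of_int n else 0)"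
  ultimately have y: "r powi (- \<bar>m\<bar>) * (y * q ^ (Suc i * nat \<bar>n\<bar>)) = r powi \<bar>m\<bar> * (y * q ^ (i * nat \<bar>n\<bar>))"
    by (auto simp: power_add mult_ac)
  have "i \<in> {1..N}" "Suc i \<in> {1..N}"
    using i by auto
  then have "zop q N n (heis j m v) = heis j m (zop q N n v) + scale (y * q ^ (j * nat \<bar>n\<bar>)) v"
    if "j \<in> {i, Suc i}" for j
    using that zop_heis[OF _ assms(4,5), of j N q v] by (auto simp: y_def)
  then show ?thesis
    unfolding h_op_act using y
    by (auto simp: linop_scale[OF linop_zop] linop_diff[OF linop_zop] fock.scale_right_distrib
        simp del: mult_Suc)
qed

section \<open>The generators of the subalgebra and the oscillators commuting with it\<close>

definition sl_gens :: "nat \<Rightarrow> complex \<Rightarrow> (gen \<Rightarrow> operator) \<Rightarrow> operator set" where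
  "sl_gens N r \<rho> = {h_op r \<rho> i m | i m. i \<in> {1..<N} \<and> m \<noteq> 0} \<union> {\<rho> QC, \<rho> QCinv}
      \<union> \<rho> ` (K ` {1..<N} \<union> Kinv ` {1..<N})
      \<union> {\<rho> (XP i n) | i n. i \<in> {1..<N}} \<union> {\<rho> (XM i n) | i n. i \<in> {1..<N}}"

lemma sl_image_eq: "sl_image N r \<rho> = generated (sl_gens N r \<rho>)"
  by (simp add: sl_image_def sl_gens_def)

lemma sl_gens_cases:
  assumes "f \<in> sl_gens N r \<rho>"
  obtains i m where "f = h_op r \<rho> i m" "i \<in> {1..<N}" "m \<noteq> 0"
    | g where "f = \<rho> g" "g \<in> acting_gens N" "\<And>i m. g \<noteq> Eps i m" "g \<noteq> QD"
  using assms unfolding sl_gens_def acting_gens_def uq_gens_def by fastforce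

lemma submodule_sl_gens_iff:
  "submodule (sl_gens N r \<rho>) W \<longleftrightarrow> fock.subspace W
    \<and> (\<forall>i\<in>{1..<N}. \<forall>m. m \<noteq> 0 \<longrightarrow> (\<forall>w\<in>W. h_op r \<rho> i m w \<in> W))
    \<and> (\<forall>w\<in>W. \<rho> QC w \<in> W) \<and> (\<forall>w\<in>W. \<rho> QCinv w \<in> W)
    \<and> (\<forall>i\<in>{1..<N}. \<forall>w\<in>W. \<rho> (K i) w \<in> W) \<and> (\<forall>i\<in>{1..<N}. \<forall>w\<in>W. \<rho> (Kinv i) w \<in> W)
    \<and> (\<forall>i\<in>{1..<N}. \<forall>n. \<forall>w\<in>W. \<rho> (XP i n) w \<in> W) \<and> (\<forall>i\<in>{1..<N}. \<forall>n. \<forall>w\<in>W. \<rho> (XM i n) w \<in> W)"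
proof -
  have *: "(\<forall>f\<in>{g i m | i m. P i m}. f ` W \<subseteq> W) \<longleftrightarrow> (\<forall>i m. P i m \<longrightarrow> (\<forall>w\<in>W. g i m w \<in> W))"
    for g :: "nat \<Rightarrow> int \<Rightarrow> operator" and P
    by (fastforce simp: image_subset_iff)
  show ?thesis
    unfolding submodule_def sl_gens_def ball_Un * by (auto simp: image_subset_iff ball_Un)
qed

lemma linop_h_op: "linop (h_op r (act N q r L \<epsilon>) i m)"
  unfolding h_op_def[abs_def] by (intro linop_minus linop_scaled linop_act)

lemma h_op_VQ:
  assumes "i \<in> {1..<N}" and "m \<noteq> 0" and "v \<in> VQ N"
  shows "h_op r (act N q r L \<epsilon>) i m v \<in> VQ N"
  unfolding h_op_act using assms
  by (intro fock.subspace_diff[OF subspace_VQ] fock.subspace_scale[OF subspace_VQ] heis_VQ; simp)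

lemma sl_gens_act:
  assumes "r ^ 2 = q" and "q \<noteq> 0" and "f \<in> sl_gens N r (act N q r L \<epsilon>)"
  shows "linop f" and "v \<in> VQ N \<Longrightarrow> f v \<in> VQ N"
    and "m \<noteq> 0 \<Longrightarrow> f (zop q N m v) = zop q N m (f v)"
proof -
  have "linop f \<and> (v \<in> VQ N \<longrightarrow> f v \<in> VQ N) \<and> (m \<noteq> 0 \<longrightarrow> f (zop q N m v) = zop q N m (f v))"
    using assms(3)
  proof (cases rule: sl_gens_cases)
    case (1 i k)
    then show ?thesis
      unfolding 1(1) using zop_h_op[OF assms(1,2) 1(2,3)] linop_h_op h_op_VQ[OF 1(2,3)] by simp
  next
    case (2 g)
    have "m \<noteq> 0 \<longrightarrow> f (zop q N m v) = zop q N m (f v)"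
    proof (cases g)
      case (XP j n)
      then have "j \<in> {1..N}" "Suc j \<in> {1..N}"
        using 2(2) by (auto simp: acting_gens_def uq_gens_def)
      then show ?thesis
        using 2(1) XP zop_Xop[OF assms(2)] by simp
    next
      case (XM j n)
      then have "j \<in> {1..N}" "Suc j \<in> {1..N}"
        using 2(2) by (auto simp: acting_gens_def uq_gens_def)
      then show ?thesis
        using 2(1) XM zop_Xop[OF assms(2)] by simp
    qed (use 2 in \<open>auto simp: zop_qpow_zmode linop_scale[OF linop_zop]\<close>)
    then show ?thesis
      using 2 linop_act act_VQ by auto
  qed
  then show "linop f" and "v \<in> VQ N \<Longrightarrow> f v \<in> VQ N"
    and "m \<noteq> 0 \<Longrightarrow> f (zop q N m v) = zop q N m (f v)"
    by blast+
qed

lemma bvec_0_VQ: "bvec 0 0 \<in> VQ N"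
  by (simp add: bvec_VQ Qlat_0)

text \<open>The index \<open>n\<close> stands for the mode n + 1, as modes start at 1. The
  hypothesis \<open>irr\<close> holds because the h_{in} and z_n together recover all Heisenberg
  operators, which leads back to \<open>VQ_eqI\<close>.\<close>

lemma oscillators_VQ:
  assumes "0 < N" and "generic q" and "r ^ 2 = q" and "exp L = q" and "cocycle N \<epsilon>"
  shows "oscillators (VQ N) (sl_gens N r (act N q r L \<epsilon>)) (\<lambda>n. zop q N (int (Suc n)))
    (\<lambda>n. zop q N (- int (Suc n))) (\<lambda>n. of_int (int (Suc n)) * (\<Sum>i=1..N. (q ^ (2 * Suc n)) ^ i))"
proof
  have q0: "q \<noteq> 0"
    using assms(2) by (simp add: generic_def)
  note act = sl_gens_act[OF assms(3) q0]
  fix f v and m n :: nat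
  show "fock.subspace (VQ N)"
    by (rule subspace_VQ)
  show "linop f" if "f \<in> sl_gens N r (act N q r L \<epsilon>)"
    using act(1)[OF that] .
  show "f v \<in> VQ N" if "f \<in> sl_gens N r (act N q r L \<epsilon>)" "v \<in> VQ N"
    using act(2)[OF that] .
  show "linop (zop q N (int (Suc n)))" "linop (zop q N (- int (Suc n)))"
    by (rule linop_zop)+
  show "zop q N (int (Suc n)) v \<in> VQ N" "zop q N (- int (Suc n)) v \<in> VQ N" if "v \<in> VQ N"
    using that by (intro zop_VQ; simp)+
  show "f (zop q N (int (Suc n)) v) = zop q N (int (Suc n)) (f v)"
    "f (zop q N (- int (Suc n)) v) = zop q N (- int (Suc n)) (f v)"
    if "f \<in> sl_gens N r (act N q r L \<epsilon>)"
    using act(3)[OF that] by simp_all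
  show "zop q N (- int (Suc m)) (zop q N (- int (Suc n)) v) = zop q N (- int (Suc n)) (zop q N (- int (Suc m)) v)"
    using zop_zop[of "- int (Suc m)" "- int (Suc n)" q N v] by simp
  show "zop q N (int (Suc m)) (zop q N (- int (Suc n)) v) = zop q N (- int (Suc n)) (zop q N (int (Suc m)) v)
      + (if m = n then scale (of_int (int (Suc n)) * (\<Sum>i=1..N. (q ^ (2 * Suc n)) ^ i)) v else 0)"
    using zop_zop[of "int (Suc m)" "- int (Suc n)" q N v]
    by (cases "m = n") (simp_all only: nat_int abs_of_nat minus_minus of_nat_eq_iff nat.inject, simp_all)
  show "of_int (int (Suc n)) * (\<Sum>i=1..N. (q ^ (2 * Suc n)) ^ i) \<noteq> 0"
    using generic_geometric_sum[OF assms(2) zero_less_Suc assms(1), of n]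
    by (simp del: of_nat_Suc mult_Suc_right power_Suc)
  have "zop q N (int (Suc n)) (bvec 0 0) = 0" for n
    unfolding zop_def heis_annihilation by simp
  then show "\<exists>v\<in>VQ N. v \<noteq> 0 \<and> (\<forall>n. zop q N (int (Suc n)) v = 0)"
    using bvec_0_VQ by (intro bexI[of _ "bvec 0 0"]) auto
next
  fix W
  assume W: "fock.subspace W" "W \<subseteq> VQ N" "W \<noteq> {0}"
    and A: "\<And>f w. f \<in> sl_gens N r (act N q r L \<epsilon>) \<Longrightarrow> w \<in> W \<Longrightarrow> f w \<in> W"
    and a: "\<And>n w. w \<in> W \<Longrightarrow> zop q N (int (Suc n)) w \<in> W"
    and c: "\<And>n w. w \<in> W \<Longrightarrow> zop q N (- int (Suc n)) w \<in> W"
  have "submodule (sl_gens N r (act N q r L \<epsilon>)) W"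
    using W(1) A by (auto simp: submodule_def)
  note sub = this[unfolded submodule_sl_gens_iff]
  show "W = VQ N"
  proof (rule VQ_eqI[OF assms(2,4,5) W])
    fix i w and n :: int assume i: "i \<in> {1..N}" and n: "n \<noteq> 0" and w: "w \<in> W"
    show "heis i n w \<in> W"
    proof (rule heis_from_h_zop[OF assms(2,3) n W(1) _ _ i])
      show "zop q N n w \<in> W"
        using n a[OF w, of "nat n - 1"] c[OF w, of "nat (- n) - 1"] by (cases "0 < n") auto
      show "scale (r powi \<bar>n\<bar>) (heis i n w) - scale (r powi (- \<bar>n\<bar>)) (heis (Suc i) n w) \<in> W"
        if "i \<in> {1..<N}" for i
      proof -
        have "h_op r (act N q r L \<epsilon>) i n w \<in> W"
          using sub that n w by blast
        \<comment> \<open>The prefactor [n]/n is nonzero by genericity and can be divided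
          out.\<close>
        then show ?thesis
          using n qint_nonzero[OF assms(2) n] unfolding h_op_act
          by (subst (asm) subspace_scale_iff[OF W(1)]) auto
      qed
    qed
  next
    fix i w assume "i \<in> {1..<N}" "w \<in> W"
    then have "act N q r L \<epsilon> (K i) w \<in> W" "act N q r L \<epsilon> (XP i n) w \<in> W" "act N q r L \<epsilon> (XM i n) w \<in> W" for n
      using sub by blast+
    then show "Kop N L i w \<in> W" "Xop q \<epsilon> i (Suc i) n w \<in> W" "Xop q \<epsilon> (Suc i) i n w \<in> W" for n
      by simp_all
  qed
qed

lemma completely_reducible_act:
  assumes "0 < N" and "generic q" and "r ^ 2 = q" and "exp L = q" and "cocycle N \<epsilon>"
  shows "completely_reducible_under (sl_image N r (act N q r L \<epsilon>)) (VQ N)"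
proof -
  have "completely_reducible_under (sl_gens N r (act N q r L \<epsilon>)) (VQ N)"
    using oscillators.completely_reducible[OF oscillators_VQ[OF assms]] .
  then show ?thesis
    unfolding sl_image_eq
    by (subst completely_reducible_under_cong[OF submodule_generated])
qed

lemma act_submodule_trivial:
  assumes "generic q" and "exp L = q" and "cocycle N \<epsilon>"
    and W: "fock.subspace W" "W \<subseteq> VQ N"
    and act: "\<And>g w. g \<in> acting_gens N \<Longrightarrow> w \<in> W \<Longrightarrow> act N q r L \<epsilon> g w \<in> W"
  shows "W = {0} \<or> W = VQ N"
proof (cases "W = {0}")
  case False
  have "W = VQ N"
  proof (rule VQ_eqI[OF assms(1-3) W False])
    fix i w and n :: int assume "i \<in> {1..N}" and n: "n \<noteq> 0" and "w \<in> W"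
    then have "act N q r L \<epsilon> (Eps i n) w \<in> W"
      by (intro act) (auto simp: acting_gens_def uq_gens_def)
    then show "heis i n w \<in> W"
      using n qint_nonzero[OF assms(1) n] by (simp add: subspace_scale_iff[OF W(1)])
  next
    fix i w assume "i \<in> {1..<N}" "w \<in> W"
    then have "act N q r L \<epsilon> (K i) w \<in> W" "act N q r L \<epsilon> (XP i n) w \<in> W" "act N q r L \<epsilon> (XM i n) w \<in> W" for n
      by (intro act; auto simp: acting_gens_def uq_gens_def)+
    then show "Kop N L i w \<in> W" "Xop q \<epsilon> i (Suc i) n w \<in> W" "Xop q \<epsilon> (Suc i) i n w \<in> W" for n
      by simp_all
  qed
  then show ?thesis ..
qed simp

lemma irreducible_act:
  assumes "generic q" and "exp L = q" and "cocycle N \<epsilon>"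
    and V: "\<And>f v. f \<in> S \<Longrightarrow> v \<in> VQ N \<Longrightarrow> f v \<in> VQ N"
    and S: "\<And>W g w. submodule S W \<Longrightarrow> W \<subseteq> VQ N \<Longrightarrow> g \<in> acting_gens N \<Longrightarrow> w \<in> W
      \<Longrightarrow> act N q r L \<epsilon> g w \<in> W"
  shows "irreducible_under (generated S) (VQ N)"
proof (subst irreducible_under_cong[OF submodule_generated], unfold irreducible_under_def,
    intro conjI allI impI)
  show "submodule S (VQ N)"
    using V subspace_VQ by (auto simp: submodule_def)
  show "VQ N \<noteq> {0}"
    using bvec_0_VQ by (metis bvec_nonzero singletonD)
  fix W assume W: "submodule S W \<and> W \<subseteq> VQ N"
  then have "fock.subspace W"
    by (simp add: submodule_def)
  then show "W = {0} \<or> W = VQ N"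
    using W S by (intro act_submodule_trivial[OF assms(1-3), of W r]) auto
qed

section \<open>Transfer from the prescribed operators to an arbitrary action \<rho>\<close>

lemma acts_through_B_in_subspace_iff:
  assumes "acts_through_B N q r L \<epsilon> \<sigma> \<rho>" and "\<sigma> \<in> {1, - 1}"
    and "g \<in> acting_gens N" and "w \<in> VQ N" and W: "fock.subspace W"
  shows "\<rho> g w \<in> W \<longleftrightarrow> act N q r L \<epsilon> g w \<in> W"
proof -
  have "\<rho> g w = (case g of XM j n \<Rightarrow> scale \<sigma> (act N q r L \<epsilon> g w) | _ \<Rightarrow> act N q r L \<epsilon> g w)"
    using assms(1,3,4) unfolding acts_through_B_def by blast
  moreover have "\<sigma> \<noteq> 0"
    using assms(2) by auto
  ultimately show ?thesis
    by (cases g) (simp_all add: subspace_scale_iff[OF W])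
qed

lemma h_op_acts_through_B:
  assumes "acts_through_B N q r L \<epsilon> \<sigma> \<rho>" and "w \<in> VQ N" and "i \<in> {1..<N}" and "m \<noteq> 0"
  shows "h_op r \<rho> i m w = h_op r (act N q r L \<epsilon>) i m w"
proof -
  have "Eps i m \<in> acting_gens N" "Eps (Suc i) m \<in> acting_gens N"
    using assms(3,4) by (auto simp: acting_gens_def uq_gens_def)
  then have "\<rho> (Eps i m) w = act N q r L \<epsilon> (Eps i m) w" "\<rho> (Eps (Suc i) m) w = act N q r L \<epsilon> (Eps (Suc i) m) w"
    using assms(1,2) unfolding acts_through_B_def by force+
  then show ?thesis
    by (simp only: h_op_def)
qed

text \<open>On \<open>VQ N\<close> only the x^- can differ, by the sign \<sigma>, which does not
  affect invariance of a subspace; \<open>h_op\<close> involves no x^-. Off \<open>VQ N\<close> the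
  values of \<rho> are arbitrary, hence the restriction on \<open>W\<close>.\<close>

lemma submodule_sl_gens_acts_through_B:
  assumes "acts_through_B N q r L \<epsilon> \<sigma> \<rho>" and "\<sigma> \<in> {1, - 1}" and "W \<subseteq> VQ N"
  shows "submodule (sl_gens N r \<rho>) W \<longleftrightarrow> submodule (sl_gens N r (act N q r L \<epsilon>)) W"
proof (cases "fock.subspace W")
  case True
  have g: "QC \<in> acting_gens N" "QCinv \<in> acting_gens N"
    "\<And>i. i \<in> {1..<N} \<Longrightarrow> K i \<in> acting_gens N" "\<And>i. i \<in> {1..<N} \<Longrightarrow> Kinv i \<in> acting_gens N"
    "\<And>i n. i \<in> {1..<N} \<Longrightarrow> XP i n \<in> acting_gens N" "\<And>i n. i \<in> {1..<N} \<Longrightarrow> XM i n \<in> acting_gens N"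
    by (auto simp: acting_gens_def uq_gens_def)
  have iff: "\<rho> g w \<in> W \<longleftrightarrow> act N q r L \<epsilon> g w \<in> W" if "g \<in> acting_gens N" "w \<in> W" for g w
    using acts_through_B_in_subspace_iff[OF assms(1,2) that(1) _ True] that(2) assms(3) by blast
  have h: "h_op r \<rho> i m w = h_op r (act N q r L \<epsilon>) i m w"
    if "w \<in> W" "i \<in> {1..<N}" "m \<noteq> 0" for i m w
    using h_op_acts_through_B[OF assms(1) _ that(2,3)] that(1) assms(3) by blast
  show ?thesis
    unfolding submodule_sl_gens_iff using g iff h
    by (intro conj_cong ball_cong refl) (simp_all del: act.simps)
qed (simp add: submodule_sl_gens_iff)

theorem proposition4p39:
  fixes N :: nat and q r L :: complex and \<epsilon> :: "lattice \<Rightarrow> lattice \<Rightarrow> complex"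
  assumes "3 \<le> N"
    and "generic q" and "r ^ 2 = q" and "exp L = q"
    and "cocycle N \<epsilon>"
  shows
    "irreducible_under (generated (act N q r L \<epsilon> ` acting_gens N)) (VQ N)
     \<and> direct_sum (VQ N) (wts N) (wt_space N)
     \<and> (\<forall>\<mu>\<in>wts N. q_wt_space N L \<mu> = wt_space N \<mu>)
     \<and> completely_reducible_under (sl_image N r (act N q r L \<epsilon>)) (VQ N)
     \<and> (\<forall>\<rho> \<sigma>. \<sigma> \<in> {1, - 1} \<longrightarrow> uq_module N q r (VQ N) \<rho> \<longrightarrow> acts_through_B N q r L \<epsilon> \<sigma> \<rho> \<longrightarrow>
          irreducible_under (generated (\<rho> ` insert QD (uq_gens N))) (VQ N)
          \<and> completely_reducible_under (sl_image N r \<rho>) (VQ N))"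
proof (intro conjI allI impI)
  show "irreducible_under (generated (act N q r L \<epsilon> ` acting_gens N)) (VQ N)"
    by (rule irreducible_act[where r = r, OF assms(2,4,5)]) (use act_VQ in \<open>fastforce simp: submodule_def simp del: act.simps\<close>)+
  show "direct_sum (VQ N) (wts N) (wt_space N)"
    by (rule direct_sum_wt_space)
  have "q \<noteq> 1"
    using assms(2) by (force simp: generic_def)
  then have "L \<noteq> 0"
    using assms(4) by auto
  then show "\<forall>\<mu>\<in>wts N. q_wt_space N L \<mu> = wt_space N \<mu>"
    using q_wt_space_eq by blast
  show cr: "completely_reducible_under (sl_image N r (act N q r L \<epsilon>)) (VQ N)"
    using assms by (intro completely_reducible_act) auto
  fix \<rho> \<sigma>
  assume \<sigma>: "\<sigma> \<in> {1, - 1 :: complex}" and mod: "uq_module N q r (VQ N) \<rho>"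
    and B: "acts_through_B N q r L \<epsilon> \<sigma> \<rho>"
  note iff = acts_through_B_in_subspace_iff[OF B \<sigma>]
  show "irreducible_under (generated (\<rho> ` insert QD (uq_gens N))) (VQ N)"
  proof (rule irreducible_act[where r = r, OF assms(2,4,5)])
    fix f v assume "f \<in> \<rho> ` insert QD (uq_gens N)" and v: "v \<in> VQ N"
    then obtain g where g: "f = \<rho> g" "g = QD \<or> g \<in> uq_gens N"
      by blast
    \<comment> \<open>For q^D the image is prescribed; for the other generators, including k_{N0},
      stability of V_Q is part of the module axioms.\<close>
    from g(2) show "f v \<in> VQ N"
    proof
      assume "g = QD"
      then have "g \<in> acting_gens N"
        by (simp add: acting_gens_def)
      then show ?thesis
        unfolding g(1) using iff[OF _ v subspace_VQ] act_VQ v by blast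
    next
      assume "g \<in> uq_gens N"
      then have "\<rho> g ` VQ N \<subseteq> VQ N"
        using mod unfolding uq_module_def lin_end_on_def by blast
      then show ?thesis
        using v g(1) by blast
    qed
  next
    fix W g w
    assume W: "submodule (\<rho> ` insert QD (uq_gens N)) W" "W \<subseteq> VQ N" and g: "g \<in> acting_gens N" and w: "w \<in> W"
    have "\<rho> g w \<in> W"
      using W(1) g w unfolding submodule_def acting_gens_def by blast
    moreover have "fock.subspace W"
      using W(1) by (simp add: submodule_def)
    ultimately show "act N q r L \<epsilon> g w \<in> W"
      using iff[OF g] W(2) w by blast
  qed
  show "completely_reducible_under (sl_image N r \<rho>) (VQ N)"
    using cr completely_reducible_under_cong[of "VQ N" "sl_image N r \<rho>" "sl_image N r (act N q r L \<epsilon>)"]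
      submodule_sl_gens_acts_through_B[OF B \<sigma>]
    by (simp add: sl_image_eq submodule_generated)
qed

end
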